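(* Let $N\in\{1,2,3,5,6,7,11,14,15,23\}$. Any element $f(z)$ of $$\mathcal{M}_{kw^{(N)}}\left(\tfrac{1}{2}\Gamma_0(4N)^+,(\chi^{(N)})^k\right)$$ can be written uniquely as $$f(z)=g_1(z)^k\sum_{i=0}^{\lfloor k\,{\rm ord}_1(g_1)\rfloor} c_i\, g_2(z)^i.$$ For a cusp form, $c_0=0$, and if $k\,{\rm ord}_1(g_1)$ is an integer then the coefficient $c_{k\,{\rm ord}_1(g_1)}$ must also be zero.
   Context: $C^{(N)}=\sum_{d|N}\sqrt{d}\,\mathbb{Z}$ (orthogonal direct sum), $d(N)$ is the number of divisors of $N$, and $D_N=24\,d(N)/\prod_{p|N}(p+1)$, $s=D_N/\dim C^{(N)}$. $\Gamma_0(M)^+$ is the group generated by $\Gamma_0(M)$ and its Atkin–Lehner involutions of all levels $m\,\|\,M$; $\frac12\Gamma=\{\left(\begin{array}{cc} a&2b\\c/2&d\end{array}\right): \left(\begin{array}{cc} a&b\\c&d\end{array}\right)\in\Gamma\}$. $\mathcal{M}_k(\Gamma,\chi)$ denotes modular forms of weight $k$ for $\Gamma$ with character $\chi$. $g_1(z)=\Theta_{C^{(N)}}(z)$, $w^{(N)}$ is its weight, and $\chi^{(N)}$ is the character of $\frac12\Gamma_0(4N)^+$ under which it is invariant; ${\rm ord}_1$ is the order at the cusp class of $1$. With $q=e^{\pi i z}$, $\eta(z)=q^{1/12}\prod_{m\ge1}(1-q^{2m})$ and $\eta^{(M)}(z)=\prod_{d|M}\eta(dz)$, $g_2$ is the modular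 function for $\frac12\Gamma_0(4N)^+$ with divisor $\infty-\mathbf{1}$ given by $g_2(z)=\{\eta^{(N)}(z/2)\eta^{(N)}(2z)/\eta^{(N)}(z)^2\}^{s}$ if $N$ is odd and $g_2(z)=\{\eta^{(N/2)}(z/2)\eta^{(N/2)}(4z)/(\eta^{(N/2)}(z)\eta^{(N/2)}(2z))\}^{s}$ if $N$ is even. *)

theory Defs
  imports
    "HOL-Complex_Analysis.Complex_Analysis"
    "HOL-Algebra.Generated_Groups"
    "HOL-Computational_Algebra.Primes"
begin

section \<open>Matrix groups\<close>

definition mat2 :: "real \<Rightarrow> real \<Rightarrow> real \<Rightarrow> real \<Rightarrow> real^2^2" where
  "mat2 a b c d = vector [vector [a, b], vector [c, d]]"

definition SL2R :: "(real^2^2) monoid" where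
  "SL2R = \<lparr>carrier = {A. det A = 1}, monoid.mult = (**), one = mat 1\<rparr>"

definition Gamma0 :: "nat \<Rightarrow> (real^2^2) set" where
  "Gamma0 M = {mat2 (of_int a) (of_int b) (of_int c) (of_int d) | a b c d :: int.
     a * d - b * c = 1 \<and> int M dvd c}"

definition exact_dvd :: "nat \<Rightarrow> nat \<Rightarrow> bool" where
  "exact_dvd m M \<longleftrightarrow> m dvd M \<and> coprime m (M div m)"

text \<open>The Atkin--Lehner involutions of level \<open>m\<close> are the integral matrices
  \<open>(ma, b; Mc, md)\<close> of determinant \<open>m\<close>; they are scaled here to determinant 1, so that
  they live in \<open>SL\<^sub>2(\<real>)\<close>.\<close>

definition atkin_lehner :: "nat \<Rightarrow> nat \<Rightarrow> (real^2^2) set" where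
  "atkin_lehner M m = {(1 / sqrt (real m)) *\<^sub>R
       mat2 (of_int (int m * a)) (of_int b) (of_int (int M * c)) (of_int (int m * d)) | a b c d :: int.
     (int m * a) * (int m * d) - b * (int M * c) = int m}"

definition Gamma0_plus :: "nat \<Rightarrow> (real^2^2) set" where
  "Gamma0_plus M =
     generate SL2R (Gamma0 M \<union> (\<Union>m\<in>{m. exact_dvd m M}. atkin_lehner M m))"

definition half_group :: "(real^2^2) set \<Rightarrow> (real^2^2) set" where
  "half_group \<Gamma> = {mat2 a (2 * b) (c / 2) d | a b c d. mat2 a b c d \<in> \<Gamma>}"

section \<open>Modular forms of real weight with a character\<close>

definition upper_half_plane :: "complex set" where
  "upper_half_plane = {z. Im z > 0}"

definition at_iinfinity :: "complex filter" where
  "at_iinfinity = filtercomap Im at_top"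

definition act :: "real^2^2 \<Rightarrow> complex \<Rightarrow> complex" where
  "act A z = moebius (of_real (A$1$1)) (of_real (A$1$2)) (of_real (A$2$1)) (of_real (A$2$2)) z"

text \<open>The power \<open>(cz + d)\<^sup>w\<close> is taken with the principal branch, which matters for half-integral \<open>w\<close>.\<close>

definition aut_factor :: "real \<Rightarrow> real^2^2 \<Rightarrow> complex \<Rightarrow> complex" where
  "aut_factor w A z = (of_real (A$2$1) * z + of_real (A$2$2)) powr (of_real w)"

definition slash :: "real \<Rightarrow> (complex \<Rightarrow> complex) \<Rightarrow> real^2^2 \<Rightarrow> complex \<Rightarrow> complex" where
  "slash w f A z = f (act A z) / aut_factor w A z"

text \<open>For \<open>\<sigma>\<close> in \<open>SL\<^sub>2(\<real>)\<close>, the set of all \<open>h > 0\<close> such that \<open>\<Gamma>\<close> contains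
  \<open>\<sigma> (1, h; 0, 1) \<sigma>\<^sup>-\<^sup>1\<close> up to sign. It is nonempty precisely if \<open>\<sigma>(\<infinity>)\<close> is a cusp of \<open>\<Gamma>\<close>,
  and for discrete \<open>\<Gamma>\<close> its least element is then the width of that cusp relative to \<open>\<sigma>\<close>.\<close>

definition cusp_translations :: "(real^2^2) set \<Rightarrow> real^2^2 \<Rightarrow> real set" where
  "cusp_translations \<Gamma> \<sigma> = {h. h > 0 \<and>
     (\<exists>\<gamma>\<in>\<Gamma>. \<gamma> ** \<sigma> = \<sigma> ** mat2 1 h 0 1 \<or> \<gamma> ** \<sigma> = - (\<sigma> ** mat2 1 h 0 1))}"

definition cusp_at :: "(real^2^2) set \<Rightarrow> real^2^2 \<Rightarrow> bool" where
  "cusp_at \<Gamma> \<sigma> \<longleftrightarrow> det \<sigma> = 1 \<and> cusp_translations \<Gamma> \<sigma> \<noteq> {}"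

definition cusp_width :: "(real^2^2) set \<Rightarrow> real^2^2 \<Rightarrow> real" where
  "cusp_width \<Gamma> \<sigma> = Inf (cusp_translations \<Gamma> \<sigma>)"

definition modular_forms ::
    "real \<Rightarrow> (real^2^2) set \<Rightarrow> (real^2^2 \<Rightarrow> complex) \<Rightarrow> (complex \<Rightarrow> complex) set" where
  "modular_forms w \<Gamma> chi = {f.
     f holomorphic_on upper_half_plane \<and>
     (\<forall>\<gamma>\<in>\<Gamma>. \<forall>z\<in>upper_half_plane. f (act \<gamma> z) = chi \<gamma> * aut_factor w \<gamma> z * f z) \<and>
     (\<forall>\<sigma>. cusp_at \<Gamma> \<sigma> \<longrightarrow> Bfun (slash w f \<sigma>) at_iinfinity)}"

definition cusp_forms ::
    "real \<Rightarrow> (real^2^2) set \<Rightarrow> (real^2^2 \<Rightarrow> complex) \<Rightarrow> (complex \<Rightarrow> complex) set" where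
  "cusp_forms w \<Gamma> chi = {f \<in> modular_forms w \<Gamma> chi.
     \<forall>\<sigma>. cusp_at \<Gamma> \<sigma> \<longrightarrow> (slash w f \<sigma> \<longlongrightarrow> 0) at_iinfinity}"

text \<open>The order at the cusp \<open>\<sigma>(\<infinity>)\<close> is the leading exponent of \<open>f|\<sigma>\<close> in the local parameter
  \<open>exp (2\<pi>iz/h)\<close>, with \<open>h\<close> the width of the cusp. It need not be an integer, as the character
  may be nontrivial on the stabiliser of the cusp.\<close>

definition cusp_order :: "real \<Rightarrow> (real^2^2) set \<Rightarrow> real^2^2 \<Rightarrow> (complex \<Rightarrow> complex) \<Rightarrow> real" where
  "cusp_order w \<Gamma> \<sigma> f = (THE r. \<exists>L. L \<noteq> 0 \<and>
     ((\<lambda>z. slash w f \<sigma> z / exp (2 * of_real pi * \<i> * of_real r * z / of_real (cusp_width \<Gamma> \<sigma>)))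
        \<longlongrightarrow> L) at_iinfinity)"

section \<open>The lattice \<open>C\<^sup>(\<^sup>N\<^sup>)\<close> and its theta series\<close>

definition divisors :: "nat \<Rightarrow> nat set" where
  "divisors N = {d. d dvd N}"

text \<open>Vectors are families of reals indexed by the divisors of \<open>N\<close>, so that the extensional
  product below is the orthogonal direct sum of the rank one lattices \<open>\<surd>d \<int>\<close>.\<close>

definition C_lattice :: "nat \<Rightarrow> (nat \<Rightarrow> real) set" where
  "C_lattice N = (\<Pi>\<^sub>E d\<in>divisors N. range (\<lambda>n::int. sqrt (real d) * of_int n))"

definition C_dim :: "nat \<Rightarrow> nat" where
  "C_dim N = card (divisors N)"

definition theta_series :: "'i set \<Rightarrow> ('i \<Rightarrow> real) set \<Rightarrow> complex \<Rightarrow> complex" where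
  "theta_series I L z = (\<Sum>\<^sub>\<infinity>x\<in>L. exp (of_real pi * \<i> * z * of_real (\<Sum>i\<in>I. (x i)\<^sup>2)))"

definition g1 :: "nat \<Rightarrow> complex \<Rightarrow> complex" where
  "g1 N = theta_series (divisors N) (C_lattice N)"

definition g1_weight :: "nat \<Rightarrow> real" where
  "g1_weight N = real (C_dim N) / 2"

definition modular_group :: "nat \<Rightarrow> (real^2^2) set" where
  "modular_group N = half_group (Gamma0_plus (4 * N))"

definition g1_character :: "nat \<Rightarrow> real^2^2 \<Rightarrow> complex" where
  "g1_character N \<gamma> =
     (THE c. \<forall>z\<in>upper_half_plane. g1 N (act \<gamma> z) = c * aut_factor (g1_weight N) \<gamma> z * g1 N z)"

text \<open>The matrix \<open>(1, 0; 1, 1)\<close> maps \<open>\<infinity>\<close> to 1.\<close>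

definition ord_1_g1 :: "nat \<Rightarrow> real" where
  "ord_1_g1 N = cusp_order (g1_weight N) (modular_group N) (mat2 1 0 1 1) (g1 N)"

section \<open>The modular function \<open>g\<^sub>2\<close>\<close>

text \<open>With \<open>q = exp (\<pi>iz)\<close>.\<close>

definition eta :: "complex \<Rightarrow> complex" where
  "eta z = exp (of_real pi * \<i> * z / 12) *
     (\<Prod>m. 1 - exp (of_real pi * \<i> * z) ^ (2 * Suc m))"

definition eta_prod :: "nat \<Rightarrow> complex \<Rightarrow> complex" where
  "eta_prod M z = (\<Prod>d\<in>divisors M. eta (of_nat d * z))"

definition D_const :: "nat \<Rightarrow> real" where
  "D_const N = 24 * real (card (divisors N)) / (\<Prod>p\<in>prime_factors N. real p + 1)"

definition s_const :: "nat \<Rightarrow> real" where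
  "s_const N = D_const N / real (C_dim N)"

text \<open>For the levels of interest \<open>s_const N\<close> is a positive integer (for instance 24 for \<open>N = 1\<close>
  and 1 for \<open>N = 23\<close>), so no choice of branch enters in the powers below, whose bases are nonzero on
  the upper half plane.\<close>

definition g2 :: "nat \<Rightarrow> complex \<Rightarrow> complex" where
  "g2 N z =
     (if odd N
      then (eta_prod N (z / 2) * eta_prod N (2 * z) / (eta_prod N z)\<^sup>2) powr of_real (s_const N)
      else (eta_prod (N div 2) (z / 2) * eta_prod (N div 2) (4 * z) /
             (eta_prod (N div 2) z * eta_prod (N div 2) (2 * z))) powr of_real (s_const N))"

end

theory Submission
  imports Defs "HOL-Number_Theory.Cong" "HOL-Computational_Algebra.Squarefree"
begin

text \<open>By Jacobi's triple product, \<open>g\<^sub>1\<close> is a product of quotients \<open>\<eta>(z)\<^sup>5 / (\<eta>(z/2)\<eta>(2z))\<^sup>2\<close> taken at \<open>dz\<close>,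
  and \<open>g\<^sub>2\<close> is a power of a product of Weber functions. Their behaviour under \<open>z \<mapsto> -1/z\<close> follows from
  that of \<open>\<eta>\<close>, whose logarithmic derivative is the Eisenstein series of weight 2. The character of
  Weber's function on the theta group has order 24; the characters coming from the \<open>d | N\<close> add up to
  a multiple of \<open>\<sigma>(N)\<close>, up to a condition modulo 3, and cancel since \<open>s \<sigma>(N) = 24\<close>. A fundamental
  domain shows that \<open>\<infinity>\<close> and 1 are the only cusps, and at 1 the product formulas give the orders.

  Hence \<open>f / g\<^sub>1\<^sup>k\<close> is a modular function with its only pole at the cusp 1, of order at most
  \<open>k ord\<^sub>1(g\<^sub>1)\<close>. Subtracting its value at \<open>\<infinity>\<close> and dividing by \<open>g\<^sub>2\<close> lowers that order by one;
  once it is negative, the function vanishes by the maximum principle.\<close>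

section \<open>Eisenstein series of weight 2 and the inversion of the Dedekind eta function\<close>

section \<open>Sums over the integers\<close>

text \<open>Powers with half-integral exponent take the principal branch, so transformation laws
  compose only up to constants. For \<open>g1\<close> this does no harm: its character is by
  definition whichever constant occurs. For \<open>g2\<close> invariance must be exact, which is why
  the exponents of the 24th root of unity in Weber's law are followed through the generators of the
  theta group by explicit congruences modulo 8 and 3.

  The fundamental domain is crude on purpose: Dirichlet approximation moves every point to height at
  least 1/(5N) above infinity or 1, and what lies below two cusp neighbourhoods is covered by a
  compact set. This needs a bound on the scaling factor r of the Atkin-Lehner matrix that carries a
  cusp to p/q; explicit Bezout constructions give r^2 <= N.

  In the last step a negative pole order yields a zero at 1 but none at infinity, so the maximum
  principle is applied to F (F - F(infinity)), which vanishes at both cusps and leaves two values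
  for F.\<close>

lemma has_sum_minus:
  fixes f g :: "'b \<Rightarrow> 'a :: topological_ab_group_add"
  assumes "(f has_sum a) A" "(g has_sum b) A"
  shows "((\<lambda>x. f x - g x) has_sum (a - b)) A"
  using has_sum_add[where f = f and g = "\<lambda>x. - g x" and a = a and b = "- b" and A = A] assms
  by (simp add: has_sum_uminus)

lemma has_sum_int_split:
  fixes f :: "int \<Rightarrow> 'a :: {topological_comm_monoid_add, t2_space}"
  assumes "((\<lambda>k::nat. f (int k)) has_sum a) UNIV" "((\<lambda>k::nat. f (- int k - 1)) has_sum b) UNIV"
  shows "(f has_sum (a + b)) UNIV"
proof -
  let ?A = "range int" and ?B = "range (\<lambda>k::nat. - int k - 1)"
  have inj: "inj (\<lambda>k::nat. - int k - 1)" by (auto simp: inj_on_def)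
  have A: "(f has_sum a) ?A" "(f has_sum b) ?B"
    using assms unfolding has_sum_reindex[OF inj] has_sum_reindex[OF inj_of_nat] o_def by auto
  have "n \<in> ?A \<union> ?B" for n :: int
  proof (cases "n \<ge> 0")
    case True thus ?thesis by (metis UnI1 nonneg_int_cases rangeI)
  next
    case False
    hence "n = - int (nat (- n - 1)) - 1" by simp
    thus ?thesis by blast
  qed
  hence AB: "?A \<union> ?B = UNIV" by blast
  have "?A \<inter> ?B = {}" by auto
  from has_sum_Un_disjoint[OF A this] show ?thesis unfolding AB .
qed

lemma summable_on_int_split:
  fixes f :: "int \<Rightarrow> 'a :: {topological_comm_monoid_add, t2_space}"
  assumes "(\<lambda>k::nat. f (int k)) summable_on UNIV" "(\<lambda>k::nat. f (- int k - 1)) summable_on UNIV"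
  shows "f summable_on UNIV"
  using assms has_sum_int_split[of f] unfolding summable_on_def by blast

text \<open>The half-open range suits telescoping differences t(n) - t(n + 1), which collapse on it
  to t(-N) - t(N).\<close>

lemma has_sum_int_imp_tendsto:
  fixes f :: "int \<Rightarrow> 'a :: topological_comm_monoid_add"
  assumes "(f has_sum s) UNIV"
  shows "(\<lambda>N. \<Sum>n\<in>{- int N..<int N}. f n) \<longlonglongrightarrow> s"
proof -
  have "filterlim (\<lambda>N. {- int N..<int N}) (finite_subsets_at_top UNIV) sequentially"
    unfolding filterlim_finite_subsets_at_top
  proof safe
    fix X :: "int set" assume X: "finite X"
    define M where "M = Max (insert 0 ((\<lambda>x. nat \<bar>x\<bar>) ` X))"
    have M: "nat \<bar>x\<bar> \<le> M" if "x \<in> X" for x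
      unfolding M_def using X that by (intro Max_ge) auto
    show "\<forall>\<^sub>F N in sequentially. finite {- int N..<int N} \<and> X \<subseteq> {- int N..<int N} \<and> {- int N..<int N} \<subseteq> UNIV"
      using eventually_gt_at_top[of M]
    proof eventually_elim
      case (elim N)
      have "x \<in> {- int N..<int N}" if "x \<in> X" for x
        using M[OF that] elim by auto
      thus ?case by auto
    qed
  qed
  with assms show ?thesis
    unfolding has_sum_def by (rule filterlim_compose)
qed

lemma has_sum_int_nonzero_imp_sums:
  fixes f :: "int \<Rightarrow> 'a :: real_normed_vector"
  assumes "(f has_sum s) (- {0})"
  shows "(\<lambda>j. f (int (Suc j)) + f (- int (Suc j))) sums s"
proof -
  have "filterlim (\<lambda>N. {- int N..int N} - {0}) (finite_subsets_at_top (- {0})) sequentially"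
    unfolding filterlim_finite_subsets_at_top
  proof safe
    fix X :: "int set" assume X: "finite X" "X \<subseteq> - {0}"
    define M where "M = Max (insert 0 ((\<lambda>x. nat \<bar>x\<bar>) ` X))"
    have M: "nat \<bar>x\<bar> \<le> M" if "x \<in> X" for x
      unfolding M_def using X that by (intro Max_ge) auto
    show "\<forall>\<^sub>F N in sequentially. finite ({- int N..int N} - {0}) \<and> X \<subseteq> {- int N..int N} - {0} \<and>
        {- int N..int N} - {0} \<subseteq> - {0}"
      using eventually_gt_at_top[of M]
    proof eventually_elim
      case (elim N)
      have "x \<in> {- int N..int N}" if "x \<in> X" for x
        using M[OF that] elim by auto
      thus ?case using X by auto
    qed
  qed
  with assms have lim: "(\<lambda>N. \<Sum>n\<in>{- int N..int N} - {0}. f n) \<longlonglongrightarrow> s"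
    unfolding has_sum_def by (rule filterlim_compose)
  have "(\<Sum>n\<in>{- int N..int N} - {0}. f n) = (\<Sum>j<N. f (int (Suc j)) + f (- int (Suc j)))" for N
  proof (induction N)
    case (Suc N)
    have "{- int (Suc N)..int (Suc N)} - {0} =
        insert (int (Suc N)) (insert (- int (Suc N)) ({- int N..int N} - {0}))"
      by auto
    thus ?case using Suc by (simp add: algebra_simps)
  qed simp
  with lim show ?thesis by (simp add: sums_def)
qed

section \<open>Partial fractions of the cotangent\<close>

lemma sin_pi_eq_0_iff_complex: "sin (of_real pi * x) = 0 \<longleftrightarrow> x \<in> \<int>" for x :: complex
proof -
  have "sin (of_real pi * x) = 0 \<longleftrightarrow> (\<exists>n::int. of_real pi * x = of_real pi * of_int n)"
    unfolding sin_eq_0 by (simp add: mult.commute)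
  also have "\<dots> \<longleftrightarrow> x \<in> \<int>"
    by (auto elim!: Ints_cases)
  finally show ?thesis .
qed

text \<open>Logarithmic derivative of the reflection formula Gamma(x) Gamma(1 - x) = pi / sin(pi
  x).\<close>

lemma Digamma_reflection_complex:
  fixes x :: complex
  assumes x: "x \<notin> \<int>"
  shows "Digamma (1 - x) - Digamma x = of_real pi * cot (of_real pi * x)"
proof -
  have nx: "x \<notin> \<int>\<^sub>\<le>\<^sub>0" "1 - x \<notin> \<int>\<^sub>\<le>\<^sub>0"
    using x nonpos_Ints_Int[of x] nonpos_Ints_Int[of "1 - x"] Ints_diff[of 1 "1 - x"] by auto
  have s: "sin (of_real pi * x) \<noteq> 0"
    using x by (simp add: sin_pi_eq_0_iff_complex)
  have "((\<lambda>z. Gamma z * Gamma (1 - z)) has_field_derivative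
          (Gamma x * Digamma x * Gamma (1 - x) - Gamma x * (Gamma (1 - x) * Digamma (1 - x)))) (at x)"
    using nx by (auto intro!: derivative_eq_intros)
  moreover have "((\<lambda>z. Gamma z * Gamma (1 - z)) has_field_derivative
          (- (of_real pi * (cos (of_real pi * x) * of_real pi)) / (sin (of_real pi * x))\<^sup>2)) (at x)"
    unfolding Gamma_reflection_complex using s
    by (auto intro!: derivative_eq_intros simp: power2_eq_square)
  ultimately have "Gamma x * Digamma x * Gamma (1 - x) - Gamma x * (Gamma (1 - x) * Digamma (1 - x))
      = - (of_real pi * (cos (of_real pi * x) * of_real pi)) / (sin (of_real pi * x))\<^sup>2"
    by (rule DERIV_unique)
  moreover have "Gamma x * Digamma x * Gamma (1 - x) - Gamma x * (Gamma (1 - x) * Digamma (1 - x))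
      = (Gamma x * Gamma (1 - x)) * (Digamma x - Digamma (1 - x))"
    by (simp add: algebra_simps)
  ultimately have "of_real pi / sin (of_real pi * x) * (Digamma x - Digamma (1 - x)) =
      - (of_real pi * (cos (of_real pi * x) * of_real pi)) / (sin (of_real pi * x))\<^sup>2"
    by (simp add: Gamma_reflection_complex)
  hence "of_real pi / sin (of_real pi * x) * (Digamma x - Digamma (1 - x)) =
      of_real pi / sin (of_real pi * x) * (- (of_real pi * cos (of_real pi * x)) / sin (of_real pi * x))"
    by (simp add: power2_eq_square mult_ac)
  hence "Digamma x - Digamma (1 - x) = - (of_real pi * cos (of_real pi * x)) / sin (of_real pi * x)"
    using s by (subst (asm) mult_cancel_left) simp
  thus ?thesis
    by (simp add: cot_def algebra_simps)
qed

text \<open>Subtracting the series of the two Digamma values in the reflection formula gives the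
  poles at all integers.\<close>

lemma cot_partial_fractions:
  fixes x :: complex
  assumes x: "x \<notin> \<int>"
  shows "(\<lambda>k. 2 * x / (x\<^sup>2 - (of_nat (Suc k))\<^sup>2)) sums (of_real pi * cot (of_real pi * x) - 1 / x)"
proof -
  have x0: "x \<noteq> 0" "1 - x \<noteq> 0" using x by auto
  have nz: "x + of_nat k \<noteq> 0" "x - of_nat k \<noteq> 0" "1 - x + of_nat k \<noteq> 0" for k
  proof -
    show "x + of_nat k \<noteq> 0" using x by (metis Ints_minus Ints_of_nat add_eq_0_iff minus_minus)
    show "x - of_nat k \<noteq> 0" using x by auto
    show "1 - x + of_nat k \<noteq> 0"
      using x by (metis Ints_1 Ints_add Ints_of_nat add_diff_eq add.commute eq_iff_diff_eq_0 diff_add_eq)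
  qed
  have "(\<lambda>k. (inverse (of_nat (Suc k)) - inverse (1 - x + of_nat k))
            - (inverse (of_nat (Suc k)) - inverse (x + of_nat k))) sums (Digamma (1 - x) - Digamma x)"
    unfolding Digamma_def
    using sums_diff[OF summable_sums[OF summable_Digamma[OF x0(2)]]
                       summable_sums[OF summable_Digamma[OF x0(1)]]]
    by simp
  hence "(\<lambda>k. inverse (x + of_nat k) - inverse (1 - x + of_nat k)) sums (Digamma (1 - x) - Digamma x)"
    by simp
  hence lim: "(\<lambda>M. \<Sum>k<M. inverse (x + of_nat k) - inverse (1 - x + of_nat k))
      \<longlonglongrightarrow> of_real pi * cot (of_real pi * x)"
    by (simp add: sums_def Digamma_reflection_complex[OF x])
  \<comment> \<open>The Digamma terms pair x + k with x - (k + 1). Regrouping into x + k with x - k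
    splits off 1/x at the start and leaves 1/(x + M) over at the end.\<close>
  have eq: "(\<Sum>k<M. inverse (x + of_nat k) - inverse (1 - x + of_nat k)) =
      1 / x + (\<Sum>k<M. 2 * x / (x\<^sup>2 - (of_nat (Suc k))\<^sup>2)) - 1 / (x + of_nat M)" for M
  proof (induction M)
    case (Suc M)
    have "x + of_nat (Suc M) \<noteq> 0" "x - of_nat (Suc M) \<noteq> 0" using nz by blast+
    hence "2 * x / (x\<^sup>2 - (of_nat (Suc M))\<^sup>2) = 1 / (x + of_nat (Suc M)) + 1 / (x - of_nat (Suc M))"
      by (simp only: power2_eq_square square_diff_square_factored) (simp add: field_simps)
    moreover have "inverse (1 - x + of_nat M) = - 1 / (x - of_nat (Suc M))"
      using nz(3)[of M] nz(2)[of "Suc M"] by (simp add: field_simps)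
    ultimately show ?case
      using Suc by (simp add: inverse_eq_divide)
  qed simp
  have "(\<lambda>M. 1 / (x + of_nat M)) \<longlonglongrightarrow> 0"
    by (intro tendsto_divide_0[OF tendsto_const] tendsto_add_filterlim_at_infinity[OF tendsto_const]
        tendsto_of_nat)
  from tendsto_diff[OF tendsto_add[OF lim this] tendsto_const[of "1/x"]]
  show ?thesis
    unfolding sums_def eq by simp
qed

text \<open>Differentiate the Digamma reflection once more: the trigamma series at x supplies the
  terms with n >= 0, the one at 1 - x those with n < 0.\<close>

lemma inverse_sin_squared_partial_fractions:
  fixes x :: complex
  assumes x: "x \<notin> \<int>"
  shows "((\<lambda>n::int. 1 / (x + of_int n)\<^sup>2) has_sum (of_real pi / sin (of_real pi * x))\<^sup>2) UNIV"
    and "(\<lambda>n::int. norm (1 / (x + of_int n)\<^sup>2)) summable_on UNIV"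
proof -
  have s: "sin (of_real pi * x) \<noteq> 0"
    using x by (simp add: sin_pi_eq_0_iff_complex)
  have nx: "x \<notin> \<int>\<^sub>\<le>\<^sub>0" "1 - x \<notin> \<int>\<^sub>\<le>\<^sub>0"
    using x nonpos_Ints_Int[of x] nonpos_Ints_Int[of "1 - x"] Ints_diff[of 1 "1 - x"] by auto
  have 1: "((\<lambda>z. Digamma (1 - z) - Digamma z) has_field_derivative
          (- Polygamma 1 (1 - x) - Polygamma 1 x)) (at x)"
    using nx by (auto intro!: derivative_eq_intros)
  have "((\<lambda>z. of_real pi * cot (of_real pi * z)) has_field_derivative
          (of_real pi * (- inverse ((sin (of_real pi * x))\<^sup>2) * of_real pi))) (at x)"
    by (rule DERIV_cmult DERIV_chain'[where g = cot] DERIV_cot DERIV_cmult_Id s)+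
  hence 2: "((\<lambda>z. of_real pi * cot (of_real pi * z)) has_field_derivative
     - ((of_real pi / sin (of_real pi * x))\<^sup>2)) (at x)"
    by (rule DERIV_cong) (simp add: power2_eq_square divide_inverse mult_ac)
  have "((\<lambda>z. Digamma (1 - z) - Digamma z) has_field_derivative
     - ((of_real pi / sin (of_real pi * x))\<^sup>2)) (at x)"
  proof (rule has_field_derivative_transform_within_open[OF 2])
    show "open (- \<int> :: complex set)"
      using closed_Ints by blast
    show "x \<in> - \<int>" using x by simp
  qed (use Digamma_reflection_complex in auto)
  from DERIV_unique[OF 1 this]
  have P: "Polygamma 1 x + Polygamma 1 (1 - x) = (of_real pi / sin (of_real pi * x))\<^sup>2"
    by (simp add: algebra_simps)
  have *: "((\<lambda>n::nat. 1 / (z + of_nat n)\<^sup>2) has_sum Polygamma 1 z) UNIV \<and>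
        (\<lambda>n::nat. norm (1 / (z + of_nat n)\<^sup>2)) summable_on UNIV"
    if z: "z \<notin> \<int>\<^sub>\<le>\<^sub>0" for z :: complex
  proof -
    have z0: "z \<noteq> 0" using z by auto
    have "summable (\<lambda>n. norm (inverse ((z + of_nat n)^2)))"
    proof -
      have "summable (\<lambda>n. norm (1 / (of_nat n + z)\<^sup>2))"
      proof (rule summable_comparison_test_ev)
        show "\<forall>\<^sub>F n in sequentially. norm (norm (1 / (of_nat n + z)\<^sup>2)) \<le> 4 * inverse (real n ^ 2)"
          using eventually_ge_at_top[of "nat \<lceil>2 * norm z\<rceil> + 1"]
        proof eventually_elim
          case (elim n)
          hence n: "real n \<ge> 2 * norm z" "real n > 0" by linarith+
          have "real n - norm z \<le> norm (of_nat n + z)"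
            by (metis norm_diff_ineq norm_of_nat)
          hence "real n / 2 \<le> norm (of_nat n + z)" using n by simp
          hence "(real n / 2)^2 \<le> norm (of_nat n + z)^2"
            using n by (intro power_mono) auto
          hence "inverse (norm (of_nat n + z)^2) \<le> inverse ((real n / 2)^2)"
            using n by (intro le_imp_inverse_le) auto
          thus ?case by (simp add: norm_divide norm_power inverse_eq_divide power_divide)
        qed
        show "summable (\<lambda>n. 4 * inverse (real n ^ 2))"
          by (intro summable_mult inverse_power_summable) auto
      qed
      thus ?thesis by (simp add: inverse_eq_divide add.commute)
    qed
    hence sm: "summable (\<lambda>n. norm (1 / (z + of_nat n)\<^sup>2))" by (simp add: inverse_eq_divide)
    have "(\<lambda>n. 1 / (z + of_nat n)\<^sup>2) sums Polygamma 1 z"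
      using summable_sums[OF summable_norm_cancel[OF sm]]
      by (simp add: Polygamma_def inverse_eq_divide numeral_2_eq_2)
    thus ?thesis
      using norm_summable_imp_has_sum[OF sm] norm_summable_imp_summable_on[of "\<lambda>n. norm (1 / (z + of_nat n)\<^sup>2)"] sm
      by auto
  qed
  let ?f = "\<lambda>n::int. 1 / (x + of_int n)\<^sup>2"
  have sq: "(x + of_int (- int k - 1))\<^sup>2 = (1 - x + of_nat k)\<^sup>2" for k
    by (simp add: power2_eq_square algebra_simps)
  have A: "((\<lambda>k. ?f (int k)) has_sum Polygamma 1 x) UNIV" "(\<lambda>k. norm (?f (int k))) summable_on UNIV"
    using *[OF nx(1)] by simp_all
  have B: "((\<lambda>k. ?f (- int k - 1)) has_sum Polygamma 1 (1 - x)) UNIV"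
      "(\<lambda>k. norm (?f (- int k - 1))) summable_on UNIV"
    using *[OF nx(2)] unfolding sq by simp_all
  show "(?f has_sum (of_real pi / sin (of_real pi * x))\<^sup>2) UNIV"
    using has_sum_int_split[OF A(1) B(1)] unfolding P .
  show "(\<lambda>n. norm (?f n)) summable_on UNIV"
    by (rule summable_on_int_split[OF A(2) B(2)])
qed

section \<open>The inversion of the weight 2 Eisenstein series\<close>

text \<open>The imaginary part of k z + n controls k, and the triangle inequality then controls
  n.\<close>

lemma lattice_norm_bound:
  assumes z: "Im z > 0"
  obtains \<delta> where "\<delta> > 0" "\<And>k n :: real. \<delta> * (\<bar>k\<bar> + \<bar>n\<bar>) \<le> norm (of_real k * z + of_real n)"
proof
  define C where "C = 1 / Im z + 1 + norm z / Im z"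
  have "1 / Im z > 0" "norm z / Im z \<ge> 0" using z by auto
  hence C: "C > 0" unfolding C_def by linarith
  show "1 / C > 0" using C by simp
  fix k n :: real
  define w where "w = norm (of_real k * z + of_real n)"
  have "\<bar>Im (of_real k * z + of_real n)\<bar> \<le> w" unfolding w_def by (rule abs_Im_le_cmod)
  hence k: "\<bar>k\<bar> \<le> w / Im z" using z by (simp add: abs_mult field_simps)
  have "norm (of_real n :: complex) \<le> w + norm (of_real k * z)"
    unfolding w_def by (metis add_diff_cancel_left' norm_triangle_ineq4)
  hence "\<bar>n\<bar> \<le> w + \<bar>k\<bar> * norm z" by (simp add: norm_mult)
  also have "\<dots> \<le> w + (w / Im z) * norm z" using k by (intro add_left_mono mult_right_mono) auto
  finally have "\<bar>k\<bar> + \<bar>n\<bar> \<le> w * C" using k by (simp add: C_def algebra_simps)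
  thus "1 / C * (\<bar>k\<bar> + \<bar>n\<bar>) \<le> norm (of_real k * z + of_real n)"
    using C by (simp add: w_def field_simps)
qed

text \<open>The exponent is half of the -3 with which the corrected Eisenstein terms decay: since (1
  + |k| + |n|)^2 >= (1 + |k|)(1 + |n|), they are dominated by a product of two such factors.\<close>

lemma summable_on_int_powr: "(\<lambda>k::int. (1 + \<bar>real_of_int k\<bar>) powr (-3/2)) summable_on UNIV"
proof -
  have 0: "summable (\<lambda>n::nat. real n powr (-3/2))"
    by (simp add: summable_real_powr_iff)
  have 1: "summable (\<lambda>n::nat. (1 + real n) powr (-3/2))"
    using 0 by (subst (asm) summable_Suc_iff[symmetric]) simp
  have 2: "summable (\<lambda>n::nat. (2 + real n) powr (-3/2))"
    using 1 by (subst (asm) summable_Suc_iff[symmetric]) (simp add: add_ac)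
  have A: "(\<lambda>n::nat. (1 + \<bar>real_of_int (int n)\<bar>) powr (-3/2)) summable_on UNIV"
    using 1 by (intro norm_summable_imp_summable_on) simp
  have eq: "1 + \<bar>real_of_int (- int n - 1)\<bar> = 2 + real n" for n
    by simp
  have B: "(\<lambda>n::nat. (1 + \<bar>real_of_int (- int n - 1)\<bar>) powr (-3/2)) summable_on UNIV"
    unfolding eq using 2 by (intro norm_summable_imp_summable_on) simp
  from A B show ?thesis
    by (rule summable_on_int_split)
qed

text \<open>The terms of the Eisenstein series of weight 2, corrected by telescoping ones so that the
  double series converges absolutely and the order of summation can be exchanged.\<close>

definition eis2_term :: "complex \<Rightarrow> int \<Rightarrow> int \<Rightarrow> complex" where
  "eis2_term z k n = 1 / (of_int k * z + of_int n)\<^sup>2 -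
     (1 / (of_int k * z + of_int n) - 1 / (of_int k * z + of_int (n + 1)))"

lemma upper_half_int_comb_nonzero:
  assumes "Im z > 0" "k \<noteq> 0"
  shows "of_int k * z + of_int n \<noteq> 0"
proof
  assume "of_int k * z + of_int n = 0"
  hence "Im (of_int k * z + of_int n) = 0" by simp
  thus False using assms by simp
qed

lemma eis2_term_summable:
  assumes z: "Im z > 0"
  shows "(\<lambda>(k, n). eis2_term z k n) summable_on (- {0}) \<times> UNIV"
proof -
  obtain \<delta> where \<delta>: "\<delta> > 0" "\<And>k n :: real. \<delta> * (\<bar>k\<bar> + \<bar>n\<bar>) \<le> norm (of_real k * z + of_real n)"
    using lattice_norm_bound[OF z] by blast
  define g where "g = (\<lambda>k::int. (1 + \<bar>real_of_int k\<bar>) powr (-3/2))"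
  have gs: "g summable_on UNIV" "g summable_on (- {0})"
    using summable_on_int_powr summable_on_subset_banach[OF summable_on_int_powr, of "- {0}"]
    by (simp_all add: g_def)
  have "(\<lambda>(k, n). g k * g n) summable_on (- {0}) \<times> UNIV"
  proof (rule summable_on_SigmaI[where g = "\<lambda>k. g k * infsum g UNIV"])
    fix k :: int
    show "((\<lambda>n. case (k, n) of (k, n) \<Rightarrow> g k * g n) has_sum g k * infsum g UNIV) UNIV"
      using has_sum_cmult_right[OF has_sum_infsum[OF gs(1)], of "g k"] by simp
  next
    show "(\<lambda>k. g k * infsum g UNIV) summable_on - {0}"
      by (rule summable_on_cmult_left[OF gs(2)])
  qed (simp add: g_def)
  hence "(\<lambda>x. 16 / \<delta>^3 * (case x of (k, n) \<Rightarrow> g k * g n)) summable_on (- {0}) \<times> UNIV"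
    by (rule summable_on_cmult_right)
  hence "(\<lambda>x. norm (case x of (k, n) \<Rightarrow> eis2_term z k n)) summable_on (- {0}) \<times> UNIV"
  proof (rule summable_on_comparison_test)
    fix x :: "int \<times> int" assume "x \<in> (- {0}) \<times> UNIV"
    then obtain k n where x: "x = (k, n)" and k: "k \<noteq> 0" by auto
    define u where "u = of_int k * z + of_int n"
    have u: "u \<noteq> 0" "u + 1 \<noteq> 0"
      using upper_half_int_comb_nonzero[OF z k, of n] upper_half_int_comb_nonzero[OF z k, of "n + 1"]
      by (simp_all add: u_def add_ac)
    \<comment> \<open>Here the correction pays off: 1/u - 1/(u + 1) = 1/(u (u + 1)) cancels the
      leading part of 1/u^2, and the decay improves from order 2 to order 3.\<close>
    have b: "eis2_term z k n = 1 / (u\<^sup>2 * (u + 1))"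
    proof -
      define v w where "v = 1 / u" and "w = 1 / (u + 1)"
      have vw: "v - w = v * w"
        using u by (simp add: v_def w_def diff_frac_eq)
      hence "v * v - (v - w) = v * (v - w)"
        by (simp add: algebra_simps)
      hence "v * v - (v - w) = v * v * w"
        by (simp only: vw mult.assoc)
      thus ?thesis
        by (simp add: eis2_term_def u_def[symmetric] add.assoc[symmetric] v_def w_def power2_eq_square)
    qed
    \<comment> \<open>As |k| >= 1, the l1 norm of (k, n) is at least m/2; after the shift from n to
      n + 1 it is still at least m/4. This is the source of 16 = 2^2 * 4.\<close>
    define m where "m = 1 + \<bar>real_of_int k\<bar> + \<bar>real_of_int n\<bar>"
    have k1: "\<bar>real_of_int k\<bar> \<ge> 1" using k by linarith
    have m: "m > 0" by (simp add: m_def)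
    have "\<delta> * (m / 2) \<le> \<delta> * (\<bar>real_of_int k\<bar> + \<bar>real_of_int n\<bar>)"
      using \<delta>(1) k1 by (intro mult_left_mono) (auto simp: m_def)
    also have "\<dots> \<le> norm u" using \<delta>(2)[of k n] by (simp add: u_def)
    finally have u1: "\<delta> * (m / 2) \<le> norm u" .
    have "\<bar>real_of_int n\<bar> \<le> \<bar>real_of_int (n + 1)\<bar> + 1" by linarith
    moreover have "(1 + a + b) / 4 \<le> a + c" if "b \<le> c + 1" "1 \<le> a" "0 \<le> c" for a b c :: real
      using that by simp
    ultimately have "m / 4 \<le> \<bar>real_of_int k\<bar> + \<bar>real_of_int (n + 1)\<bar>"
      using k1 abs_ge_zero unfolding m_def by blast

    hence "\<delta> * (m / 4) \<le> \<delta> * (\<bar>real_of_int k\<bar> + \<bar>real_of_int (n + 1)\<bar>)"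
      using \<delta>(1) by (intro mult_left_mono) auto
    also have "\<dots> \<le> norm (u + 1)" using \<delta>(2)[of k "n + 1"] by (simp add: u_def add_ac)
    finally have u2: "\<delta> * (m / 4) \<le> norm (u + 1)" .
    have "\<delta>^3 / 16 * m^3 = (\<delta> * (m / 2))^2 * (\<delta> * (m / 4))"
      by (simp add: power2_eq_square power3_eq_cube)
    also have "\<dots> \<le> norm u ^ 2 * norm (u + 1)"
      using u1 u2 \<delta>(1) m by (intro mult_mono power_mono) auto
    finally have den: "\<delta>^3 / 16 * m^3 \<le> norm u ^ 2 * norm (u + 1)" .
    have "norm (eis2_term z k n) = 1 / (norm u ^ 2 * norm (u + 1))"
      by (simp add: b norm_divide norm_mult norm_power)
    also have "\<dots> \<le> 1 / (\<delta>^3 / 16 * m^3)"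
      using den \<delta>(1) m by (intro divide_left_mono mult_pos_pos) (use u in auto)
    also have "\<dots> = 16 / \<delta>^3 * (m powr (-3))"
      using m by (simp add: powr_minus powr_numeral field_simps)
    finally have A: "norm (eis2_term z k n) \<le> 16 / \<delta>^3 * (m powr (-3))" .
    have "m powr (-3) = (m * m) powr (-3/2)"
      using m by (simp add: powr_mult powr_add[symmetric])
    also have "(m * m) powr (-3/2) \<le> ((1 + \<bar>real_of_int k\<bar>) * (1 + \<bar>real_of_int n\<bar>)) powr (-3/2)"
      by (intro powr_mono2' mult_mono mult_pos_pos) (auto simp: m_def)
    also have "\<dots> = g k * g n" by (simp add: g_def powr_mult)
    finally have "16 / \<delta>^3 * (m powr (-3)) \<le> 16 / \<delta>^3 * (g k * g n)"
      using \<delta>(1) by (intro mult_left_mono) auto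
    with A show "norm (case x of (k, n) \<Rightarrow> eis2_term z k n) \<le> 16 / \<delta>^3 * (case x of (k, n) \<Rightarrow> g k * g n)"
      by (simp add: x)
  qed auto
  thus ?thesis by (rule abs_summable_summable)
qed

lemma upper_half_int_mult_not_Int:
  assumes "Im z \<noteq> 0" "k \<noteq> 0"
  shows "of_int k * z \<notin> \<int>"
proof
  assume "of_int k * z \<in> \<int>"
  then obtain m where "of_int k * z = of_int m" by (elim Ints_cases)
  hence "Im (of_int k * z) = 0" by simp
  thus False using assms by simp
qed

text \<open>For fixed k the corrections telescope in n to 1/(x - N) - 1/(x + N), which tends to 0;
  so rows do not notice them.\<close>

lemma eis2_term_row_sum:
  assumes z: "Im z > 0" and k: "k \<noteq> 0"
  shows "(eis2_term z k has_sum (of_real pi / sin (of_real pi * (of_int k * z)))\<^sup>2) UNIV"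
proof -
  let ?x = "of_int k * z"
  have x: "?x \<notin> \<int>" using upper_half_int_mult_not_Int z k by auto
  note A = inverse_sin_squared_partial_fractions(1)[OF x]
  have "(\<lambda>n. eis2_term z k n) summable_on UNIV"
    using summable_on_SigmaD1[OF eis2_term_summable[OF z], of k] k by simp
  then obtain s where s: "(eis2_term z k has_sum s) UNIV" by (auto simp: summable_on_def)
  have T: "((\<lambda>n::int. 1 / (?x + of_int n) - 1 / (?x + of_int (n + 1))) has_sum
      ((of_real pi / sin (of_real pi * ?x))\<^sup>2 - s)) UNIV"
    using has_sum_minus[OF A s] by (simp add: eis2_term_def)
  have eq: "(\<Sum>n\<in>{- int N..<int N}. 1 / (?x + of_int n) - 1 / (?x + of_int (n + 1))) =
      1 / (?x - of_nat N) - 1 / (?x + of_nat N)" for N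
  proof (induction N)
    case (Suc N)
    have "{- int (Suc N)..<int (Suc N)} = insert (int N) (insert (- int (Suc N)) {- int N..<int N})"
      by auto
    thus ?case using Suc by (simp add: algebra_simps)
  qed simp
  have "(\<lambda>N. 1 / (?x - of_nat N)) \<longlonglongrightarrow> 0"
  proof -
    have "(\<lambda>N. - (1 / (- ?x + of_nat N))) \<longlonglongrightarrow> - 0"
      by (intro tendsto_minus tendsto_divide_0[OF tendsto_const]
          tendsto_add_filterlim_at_infinity[OF tendsto_const] tendsto_of_nat)
    moreover have "1 / (?x - of_nat N) = - (1 / (- ?x + of_nat N))" for N
      by (metis minus_diff_eq minus_divide_right uminus_add_conv_diff)
    ultimately show ?thesis by simp
  qed
  moreover have "(\<lambda>N. 1 / (?x + of_nat N)) \<longlonglongrightarrow> 0"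
    by (intro tendsto_divide_0[OF tendsto_const]
          tendsto_add_filterlim_at_infinity[OF tendsto_const] tendsto_of_nat)
  ultimately have "(\<lambda>N. 1 / (?x - of_nat N) - 1 / (?x + of_nat N)) \<longlonglongrightarrow> 0 - 0"
    by (rule tendsto_diff)
  hence "(of_real pi / sin (of_real pi * ?x))\<^sup>2 - s = 0"
    using has_sum_int_imp_tendsto[OF T] LIMSEQ_unique unfolding eq by fastforce
  thus ?thesis using s by simp
qed

lemma csc_squared_summable_on:
  assumes z: "Im z > 0"
  shows "(\<lambda>k::int. (of_real pi / sin (of_real pi * (of_int k * z)))\<^sup>2) summable_on (- {0})"
proof -
  have "(\<lambda>k. infsum (eis2_term z k) UNIV) summable_on (- {0})"
    by (rule summable_on_Sigma_banach[OF eis2_term_summable[OF z]])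
  thus ?thesis
    by (rule summable_on_cong[THEN iffD1, rotated]) (use infsumI[OF eis2_term_row_sum[OF z]] in auto)
qed

lemma sums_pair_inverse_squares:
  fixes u :: complex
  assumes u: "u \<notin> \<int>"
  shows "(\<lambda>j. 1 / (u + of_nat (Suc j))\<^sup>2 + 1 / (u - of_nat (Suc j))\<^sup>2) sums
           ((of_real pi / sin (of_real pi * u))\<^sup>2 - 1 / u\<^sup>2)"
proof -
  let ?f = "\<lambda>n::int. 1 / (u + of_int n)\<^sup>2"
  have "(?f has_sum ((of_real pi / sin (of_real pi * u))\<^sup>2 - 1 / u\<^sup>2)) (UNIV - {0})"
    using has_sum_Diff[OF inverse_sin_squared_partial_fractions(1)[OF u] has_sum_finite[of "{0}" ?f]]
    by simp
  from has_sum_int_nonzero_imp_sums[OF this[folded Compl_eq_Diff_UNIV]]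
  show ?thesis by (simp add: algebra_simps)
qed

lemma inverse_squares_sums_complex: "(\<lambda>n. 1 / (of_nat (Suc n))\<^sup>2 :: complex) sums (of_real pi ^ 2 / 6)"
proof -
  show ?thesis
    using sums_of_real[OF inverse_squares_sums, where 'a = complex] by (simp add: add_ac)
qed

text \<open>For fixed n the corrections do not cancel: by the partial fractions of the cotangent
  they leave the difference t(n) - t(n + 1). In the column n = 0 the terms 1/(k z) cancel in pairs
  and the squares give the value of zeta(2).\<close>

lemma eis2_term_column_sum:
  fixes z :: complex
  assumes z: "Im z > 0"
  defines "t \<equiv> \<lambda>n::int. if n = 0 then 0 else (of_real pi * cot (of_real pi * (of_int n / z)) - z / of_int n) / z"
  defines "r \<equiv> \<lambda>n::int. if n = 0 then of_real pi ^ 2 / (3 * z\<^sup>2) else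
                 (of_real pi / sin (of_real pi * (of_int n / z)))\<^sup>2 / z\<^sup>2 - 1 / (of_int n)\<^sup>2"
  shows "(\<Sum>\<^sub>\<infinity>k\<in>- {0}. eis2_term z k n) = r n - (t n - t (n + 1))"
proof -
  have z0: "z \<noteq> 0" using z by auto
  have iz: "Im (1 / z) \<noteq> 0"
    using z z0 by (simp add: Im_divide power2_eq_square complex_eq_iff sum_power2_eq_zero_iff)
  have nI: "of_int n / z \<notin> \<int>" if "n \<noteq> 0" for n
    using upper_half_int_mult_not_Int[OF iz that] by simp
  let ?d = "\<lambda>j (n::int). 1 / (of_nat (Suc j) * z + of_int n) + 1 / (- of_nat (Suc j) * z + of_int n)"
  let ?e = "\<lambda>j (n::int). 1 / (of_nat (Suc j) * z + of_int n)\<^sup>2 + 1 / (- of_nat (Suc j) * z + of_int n)\<^sup>2"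
  have nz: "of_nat (Suc j) * z + of_int n \<noteq> 0" "- of_nat (Suc j) * z + of_int n \<noteq> 0" for j n
    using upper_half_int_comb_nonzero[OF z, of "int (Suc j)" n]
      upper_half_int_comb_nonzero[OF z, of "- int (Suc j)" n] by simp_all
  have d: "(\<lambda>j. ?d j n) sums t n" for n
  proof (cases "n = 0")
    case True
    have "?d j 0 = 0" for j by (simp del: of_nat_Suc)
    thus ?thesis using True by (simp add: t_def)
  next
    case False
    have "?d j n = 2 * (of_int n / z) / ((of_int n / z)\<^sup>2 - (of_nat (Suc j))\<^sup>2) / z" for j
    proof -
      have "(of_int n / z)\<^sup>2 - (of_nat (Suc j))\<^sup>2 = (of_int n / z - of_nat (Suc j)) * (of_int n / z + of_nat (Suc j))"
        by (simp only: power2_eq_square square_diff_square_factored) (rule mult.commute)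
      also have "\<dots> = (- of_nat (Suc j) * z + of_int n) * (of_nat (Suc j) * z + of_int n) / z\<^sup>2"
        using z0 by (simp add: field_simps power2_eq_square del: of_nat_Suc)
      finally have den: "(of_int n / z)\<^sup>2 - (of_nat (Suc j))\<^sup>2 =
        (- of_nat (Suc j) * z + of_int n) * (of_nat (Suc j) * z + of_int n) / z\<^sup>2" .
      have gen: "1 / a + 1 / b = 2 * (c / z) / (b * a / z\<^sup>2) / z" if "a \<noteq> 0" "b \<noteq> 0" "a + b = 2 * c" for a b c
      proof -
        have "1 / a + 1 / b = (a + b) / (a * b)" using that by (simp add: field_simps)
        thus ?thesis using that z0 by (simp add: field_simps power2_eq_square)
      qed
      show ?thesis unfolding den by (rule gen[OF nz]) (simp add: algebra_simps)
    qed
    thus ?thesis using sums_divide[OF cot_partial_fractions[OF nI[OF False]], of z] False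
      by (simp add: t_def)
  qed
  have e: "(\<lambda>j. ?e j n) sums r n" for n
  proof (cases "n = 0")
    case True
    have "(\<lambda>j. 2 / z\<^sup>2 * (1 / (of_nat (Suc j))\<^sup>2)) sums (2 / z\<^sup>2 * (of_real pi ^ 2 / 6))"
      by (rule sums_mult[OF inverse_squares_sums_complex])
    thus ?thesis using True by (simp add: r_def power_mult_distrib field_simps del: of_nat_Suc)
  next
    case False
    have "?e j n = (1 / (of_int n / z + of_nat (Suc j))\<^sup>2 + 1 / (of_int n / z - of_nat (Suc j))\<^sup>2) / z\<^sup>2" for j
    proof -
      have eqs: "of_int n / z + of_nat (Suc j) = (of_nat (Suc j) * z + of_int n) / z"
        "of_int n / z - of_nat (Suc j) = (- of_nat (Suc j) * z + of_int n) / z"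
        using z0 by (simp_all add: add_divide_distrib diff_divide_distrib del: of_nat_Suc)
      have "1 / a\<^sup>2 + 1 / b\<^sup>2 = (1 / (a / z)\<^sup>2 + 1 / (b / z)\<^sup>2) / z\<^sup>2" for a b
        using z0 by (simp add: power_divide add_divide_distrib)
      thus ?thesis unfolding eqs .
    qed
    thus ?thesis
      using sums_divide[OF sums_pair_inverse_squares[OF nI[OF False]], of "z\<^sup>2"] False z0
      by (simp add: r_def diff_divide_distrib power_divide)
  qed
  have "(\<lambda>k. eis2_term z k n) summable_on (- {0})"
  proof -
    have "(\<lambda>(n, k). eis2_term z k n) summable_on UNIV \<times> (- {0})"
      using eis2_term_summable[OF z] by (subst (asm) summable_on_swap) simp
    from summable_on_SigmaD1[OF this, of n] show ?thesis by simp
  qed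
  hence "((\<lambda>k. eis2_term z k n) has_sum (\<Sum>\<^sub>\<infinity>k\<in>- {0}. eis2_term z k n)) (- {0})"
    by (rule has_sum_infsum)
  from has_sum_int_nonzero_imp_sums[OF this]
  have "(\<lambda>j. ?e j n - (?d j n - ?d j (n + 1))) sums (\<Sum>\<^sub>\<infinity>k\<in>- {0}. eis2_term z k n)"
    by (simp add: eis2_term_def algebra_simps)
  moreover have "(\<lambda>j. ?e j n - (?d j n - ?d j (n + 1))) sums (r n - (t n - t (n + 1)))"
    by (intro sums_diff d e)
  ultimately show ?thesis by (rule sums_unique2)
qed

lemma cot_tendsto_lower:
  assumes w: "Im w < 0"
  shows "(\<lambda>N. cot (of_real pi * (of_nat N * w))) \<longlonglongrightarrow> \<i>"
proof -
  define \<xi> where "\<xi> = exp (- 2 * \<i> * of_real pi * w)"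
  have \<xi>: "norm \<xi> < 1" using w by (simp add: \<xi>_def norm_exp_eq_Re mult_pos_neg)
  have p: "(\<lambda>N. \<xi> ^ N) \<longlonglongrightarrow> 0" by (rule LIMSEQ_power_zero[OF \<xi>])
  have eq: "cot (of_real pi * (of_nat N * w)) = \<i> * (1 + \<xi> ^ N) / (1 - \<xi> ^ N)" for N
  proof -
    define a where "a = exp (\<i> * (of_real pi * (of_nat N * w)))"
    have a: "a \<noteq> 0" by (simp add: a_def)
    have "\<xi> ^ N = exp (of_nat N * (- 2 * \<i> * of_real pi * w))"
      by (simp only: \<xi>_def exp_of_nat_mult)
    also have "\<dots> = exp (- (\<i> * (of_real pi * (of_nat N * w)))) ^ 2"
      by (simp add: exp_double[symmetric] algebra_simps)
    also have "\<dots> = 1 / a ^ 2"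
      by (simp add: a_def exp_minus inverse_eq_divide power_divide)
    finally have x: "\<xi> ^ N = 1 / a ^ 2" .
    have "cot (of_real pi * (of_nat N * w)) = ((a + 1 / a) / 2) / ((a - 1 / a) / (2 * \<i>))"
      unfolding cot_def by (subst cos_exp_eq, subst sin_exp_eq)
        (simp add: a_def exp_minus inverse_eq_divide)
    also have "\<dots> = \<i> * (1 + 1 / a ^ 2) / (1 - 1 / a ^ 2)"
      using a by (cases "a ^ 2 = 1") (auto simp: field_simps power2_eq_square)
    finally show ?thesis using x by simp
  qed
  have "(\<lambda>N. \<i> * (1 + \<xi> ^ N) / (1 - \<xi> ^ N)) \<longlonglongrightarrow> \<i> * (1 + 0) / (1 - 0)"
    by (intro tendsto_intros p) auto
  thus ?thesis by (simp add: eq)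
qed

lemma Im_neg_inverse_pos:
  assumes "Im z > 0" shows "Im (- 1 / z) > 0" "Im (1 / z) < 0"
proof -
  have "(Re z)\<^sup>2 + (Im z)\<^sup>2 > 0" using assms by (simp add: sum_power2_gt_zero_iff)
  thus "Im (- 1 / z) > 0" "Im (1 / z) < 0" using assms by (simp_all add: Im_divide)
qed

text \<open>With q = exp(2 pi i z) one has 1 / sin(pi k z)^2 = -4 q^k / (1 - q^k)^2, so that the
  Eisenstein series E_2 is 1 + 6 \<open>csc_series z\<close>.\<close>

definition csc_series :: "complex \<Rightarrow> complex" where
  "csc_series z = (\<Sum>k. 1 / (sin (of_real pi * (of_nat (Suc k) * z)))\<^sup>2)"

lemma infsum_csc_squared:
  assumes z: "Im z > 0"
  shows "(\<Sum>\<^sub>\<infinity>k\<in>- {0::int}. (of_real pi / sin (of_real pi * (of_int k * z)))\<^sup>2) = 2 * of_real pi ^ 2 * csc_series z"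
proof -
  let ?s = "(\<Sum>\<^sub>\<infinity>k\<in>- {0::int}. (of_real pi / sin (of_real pi * (of_int k * z)))\<^sup>2)"
  have "(\<lambda>j. 2 * of_real pi ^ 2 * (1 / (sin (of_real pi * (of_nat (Suc j) * z)))\<^sup>2)) sums ?s"
    using has_sum_int_nonzero_imp_sums[OF has_sum_infsum[OF csc_squared_summable_on[OF z]]]
    by (simp add: power_divide del: of_nat_Suc)
  hence "(\<lambda>j. 1 / (2 * of_real pi ^ 2) * (2 * of_real pi ^ 2 * (1 / (sin (of_real pi * (of_nat (Suc j) * z)))\<^sup>2)))
     sums (1 / (2 * of_real pi ^ 2) * ?s)" by (rule sums_mult)
  hence "csc_series z = 1 / (2 * of_real pi ^ 2) * ?s"
    unfolding csc_series_def by (intro sums_unique[symmetric]) simp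
  thus ?thesis by simp
qed

text \<open>In terms of E_2 this reads E_2(-1/z) = z^2 E_2(z) + 6 z / (pi i). The two sides are the
  row-wise and the column-wise value of the same absolutely convergent double series; the anomalous
  term comes from the column corrections.\<close>

theorem csc_series_inversion:
  assumes z: "Im z > 0"
  shows "2 * of_real pi ^ 2 * csc_series z = 2 * of_real pi ^ 2 * csc_series (- 1 / z) / z\<^sup>2
           + of_real pi ^ 2 / (3 * z\<^sup>2) - of_real pi ^ 2 / 3 + 2 * of_real pi * \<i> / z"
proof -
  define t where "t = (\<lambda>n::int. if n = 0 then 0 else (of_real pi * cot (of_real pi * (of_int n / z)) - z / of_int n) / z)"
  define r where "r = (\<lambda>n::int. if n = 0 then of_real pi ^ 2 / (3 * z\<^sup>2) else
                 (of_real pi / sin (of_real pi * (of_int n / z)))\<^sup>2 / z\<^sup>2 - 1 / (of_int n)\<^sup>2)"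
  have z0: "z \<noteq> 0" using z by auto
  define s where "s = 2 * of_real pi ^ 2 * csc_series z"
  define s' where "s' = 2 * of_real pi ^ 2 * csc_series (- 1 / z)"
  have swap: "(\<lambda>(n, k). eis2_term z k n) summable_on UNIV \<times> (- {0})"
    using eis2_term_summable[OF z] by (subst (asm) summable_on_swap) simp
  have "s = (\<Sum>\<^sub>\<infinity>k\<in>- {0}. \<Sum>\<^sub>\<infinity>n\<in>UNIV. eis2_term z k n)"
    unfolding s_def infsum_csc_squared[OF z, symmetric]
    by (intro infsum_cong) (use infsumI[OF eis2_term_row_sum[OF z]] in auto)
  also have "\<dots> = (\<Sum>\<^sub>\<infinity>n\<in>UNIV. \<Sum>\<^sub>\<infinity>k\<in>- {0}. eis2_term z k n)"
    by (rule infsum_swap_banach[OF eis2_term_summable[OF z]])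
  finally have "s = (\<Sum>\<^sub>\<infinity>n\<in>UNIV. r n - (t n - t (n + 1)))"
    unfolding r_def t_def eis2_term_column_sum[OF z] .
  moreover have "(\<lambda>n. r n - (t n - t (n + 1))) summable_on UNIV"
    using summable_on_Sigma_banach[OF swap]
    unfolding r_def t_def eis2_term_column_sum[OF z, symmetric] by simp
  ultimately have "((\<lambda>n. r n - (t n - t (n + 1))) has_sum s) UNIV" by simp
  from has_sum_int_imp_tendsto[OF this]
  have lim1: "(\<lambda>N. \<Sum>n\<in>{- int N..<int N}. r n - (t n - t (n + 1))) \<longlonglongrightarrow> s" .
  have t_minus: "t (- n) = - t n" for n
  proof -
    have "cot (- w) = - cot w" for w :: complex by (simp add: cot_def)
    thus ?thesis by (simp add: t_def minus_divide_left[symmetric] diff_divide_distrib add_divide_distrib)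
  qed
  have eq: "(\<Sum>n\<in>{- int N..<int N}. r n - (t n - t (n + 1))) =
      (\<Sum>n\<in>{- int N..<int N}. r n) + 2 * t (int N)" for N
  proof -
    have "(\<Sum>n\<in>{- int N..<int N}. t n - t (n + 1)) = t (- int N) - t (int N)" for N
    proof (induction N)
      case (Suc N)
      have "{- int (Suc N)..<int (Suc N)} = insert (int N) (insert (- int (Suc N)) {- int N..<int N})"
        by auto
      thus ?case using Suc by (simp add: algebra_simps)
    qed simp
    thus ?thesis using t_minus[of "int N"] by (simp add: sum_subtractf)
  qed
  \<comment> \<open>Since 1/z lies in the lower half plane, cot(pi N / z) tends to i; this produces
    the term 2 pi i / z.\<close>
  have "(\<lambda>N. 2 * t (int N)) \<longlonglongrightarrow> 2 * ((of_real pi * \<i> - 0) / z)"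
  proof -
    have "(\<lambda>N. 2 * ((of_real pi * cot (of_real pi * (of_nat N * (1 / z))) - z / of_nat N) / z))
       \<longlonglongrightarrow> 2 * ((of_real pi * \<i> - 0) / z)"
      using z0 Im_neg_inverse_pos[OF z]
      by (intro tendsto_intros cot_tendsto_lower tendsto_divide_0[OF tendsto_const] tendsto_of_nat) auto
    moreover have "\<forall>\<^sub>F N in sequentially.
        2 * ((of_real pi * cot (of_real pi * (of_nat N * (1 / z))) - z / of_nat N) / z) = 2 * t (int N)"
      using eventually_gt_at_top[of 0] by eventually_elim (simp add: t_def)
    ultimately show ?thesis by (rule Lim_transform_eventually)
  qed
  from tendsto_diff[OF lim1 this]
  have lim2: "(\<lambda>N. \<Sum>n\<in>{- int N..<int N}. r n) \<longlonglongrightarrow> s - 2 * of_real pi * \<i> / z"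
    unfolding eq by (simp add: mult.assoc)
  have "(r has_sum (s' / z\<^sup>2 - of_real pi ^ 2 / 3 + of_real pi ^ 2 / (3 * z\<^sup>2))) UNIV"
  proof -
    have "((\<lambda>n::int. (of_real pi / sin (of_real pi * (of_int n * (- 1 / z))))\<^sup>2) has_sum s') (- {0})"
      using has_sum_infsum[OF csc_squared_summable_on] infsum_csc_squared Im_neg_inverse_pos(1)[OF z]
      by (simp only: s'_def) 
    hence "((\<lambda>n::int. (of_real pi / sin (of_real pi * (of_int n / z)))\<^sup>2 * (1 / z\<^sup>2)) has_sum s' * (1 / z\<^sup>2)) (- {0})"
      by (intro has_sum_cmult_left) (simp add: power_divide)
    moreover have "((\<lambda>n::int. 1 / (of_int n)\<^sup>2) has_sum (of_real pi ^ 2 / 3 :: complex)) (- {0})"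
    proof -
      have sm: "summable (\<lambda>n. norm (1 / (of_nat (Suc n))\<^sup>2 :: complex))"
      proof -
        have "norm (1 / (of_nat (Suc n))\<^sup>2 :: complex) = 1 / (real n + 1)\<^sup>2" for n
          by (simp add: norm_divide norm_power add_ac del: of_nat_Suc)
        thus ?thesis using inverse_squares_sums by (simp add: sums_iff add_ac)
      qed
      have "((\<lambda>n::nat. 1 / (of_nat (Suc n))\<^sup>2 :: complex) has_sum (of_real pi ^ 2 / 6)) UNIV"
        using norm_summable_imp_has_sum[OF sm inverse_squares_sums_complex] .
      hence h: "((\<lambda>n::int. 1 / (of_int n)\<^sup>2 :: complex) has_sum (of_real pi ^ 2 / 6)) (range (\<lambda>n. int (Suc n)))"
          "((\<lambda>n::int. 1 / (of_int n)\<^sup>2 :: complex) has_sum (of_real pi ^ 2 / 6)) (range (\<lambda>n. - int (Suc n)))"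
        by (subst has_sum_reindex; simp add: inj_on_def o_def power2_eq_square algebra_simps)+
      have "range (\<lambda>n. int (Suc n)) \<union> range (\<lambda>n. - int (Suc n)) = - {0}"
      proof -
        have "n \<in> range (\<lambda>n. int (Suc n)) \<union> range (\<lambda>n. - int (Suc n))" if "n \<noteq> 0" for n
        proof (cases "n > 0")
          case True
          hence "n = int (Suc (nat (n - 1)))" by simp
          thus ?thesis by blast
        next
          case False
          hence "n = - int (Suc (nat (- n - 1)))" using that by simp
          thus ?thesis by blast
        qed
        thus ?thesis by auto
      qed
      moreover have "range (\<lambda>n. int (Suc n)) \<inter> range (\<lambda>n. - int (Suc n)) = {}" by auto
      ultimately show ?thesis using has_sum_Un_disjoint[OF h] by simp
    qed
    ultimately have "((\<lambda>n::int. (of_real pi / sin (of_real pi * (of_int n / z)))\<^sup>2 * (1 / z\<^sup>2) - 1 / (of_int n)\<^sup>2)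
         has_sum (s' * (1 / z\<^sup>2) - of_real pi ^ 2 / 3)) (- {0})"
      by (rule has_sum_minus)
    hence 1: "(r has_sum (s' / z\<^sup>2 - of_real pi ^ 2 / 3)) (- {0})"
      by (subst has_sum_cong[of _ _ "\<lambda>n::int. (of_real pi / sin (of_real pi * (of_int n / z)))\<^sup>2 * (1 / z\<^sup>2) - 1 / (of_int n)\<^sup>2"])
        (auto simp: r_def)
    have 2: "(r has_sum r 0) {0}" using has_sum_finite[of "{0}" r] by simp
    have "- {0} \<union> {0::int} = UNIV" by auto
    thus ?thesis using has_sum_Un_disjoint[OF 1 2] by (simp add: r_def)
  qed
  from LIMSEQ_unique[OF has_sum_int_imp_tendsto[OF this] lim2]
  have "s = s' / z\<^sup>2 - of_real pi ^ 2 / 3 + of_real pi ^ 2 / (3 * z\<^sup>2) + 2 * of_real pi * \<i> / z"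
    by (simp add: algebra_simps)
  thus ?thesis unfolding s_def s'_def by (simp add: algebra_simps)
qed

section \<open>Neighbourhoods of the cusp at infinity\<close>

lemma eventually_at_iinfinity: "eventually P at_iinfinity \<longleftrightarrow> (\<exists>b. \<forall>z. Im z > b \<longrightarrow> P z)"
proof
  assume "eventually P at_iinfinity"
  then obtain Q where Q: "eventually Q at_top" "\<And>z. Q (Im z) \<Longrightarrow> P z"
    unfolding at_iinfinity_def eventually_filtercomap by blast
  then obtain b where "\<And>y. y \<ge> b \<Longrightarrow> Q y" unfolding eventually_at_top_linorder by blast
  thus "\<exists>b. \<forall>z. Im z > b \<longrightarrow> P z" using Q(2) by (intro exI[of _ b]) auto
next
  assume "\<exists>b. \<forall>z. Im z > b \<longrightarrow> P z"
  then obtain b where "\<And>z. Im z > b \<Longrightarrow> P z" by blast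
  thus "eventually P at_iinfinity"
    unfolding at_iinfinity_def eventually_filtercomap
    by (intro exI[of _ "\<lambda>y. y > b"]) (auto simp: eventually_gt_at_top)
qed

lemma at_iinfinity_neq_bot [simp]: "at_iinfinity \<noteq> bot"
proof -
  have "\<not> eventually (\<lambda>z. False) at_iinfinity"
    unfolding eventually_at_iinfinity
    by (metis complex.sel(2) gt_ex)
  thus ?thesis by (simp add: trivial_limit_def)
qed

lemma eventually_at_iinfinity_gt: "eventually (\<lambda>z. Im z > b) at_iinfinity"
  unfolding eventually_at_iinfinity by blast

lemma eventually_at_iinfinity_upper: "eventually (\<lambda>z. z \<in> upper_half_plane) at_iinfinity"
  using eventually_at_iinfinity_gt[of 0] by (simp add: upper_half_plane_def)

lemma filterlim_Im_at_iinfinity: "filterlim Im at_top at_iinfinity"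
  unfolding at_iinfinity_def by (rule filterlim_filtercomap)

lemma filterlim_affine_at_iinfinity:
  assumes "a > 0"
  shows "filterlim (\<lambda>z. of_real a * z + of_real b) at_iinfinity at_iinfinity"
  unfolding at_iinfinity_def[of] filterlim_filtercomap_iff o_def
proof -
  have "filterlim (\<lambda>z. a * Im z) at_top at_iinfinity"
    by (rule filterlim_tendsto_pos_mult_at_top[OF tendsto_const assms filterlim_Im_at_iinfinity])
  thus "filterlim (\<lambda>z. Im (of_real a * z + of_real b)) at_top (filtercomap Im at_top)"
    by (simp add: at_iinfinity_def)
qed

lemma exp_tendsto_0_at_iinfinity:
  assumes "c > 0"
  shows "((\<lambda>z. exp (of_real pi * \<i> * of_real c * z)) \<longlongrightarrow> 0) at_iinfinity"
proof (rule tendsto_norm_zero_cancel)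
  have "filterlim (\<lambda>z. pi * c * Im z) at_top at_iinfinity"
    using assms by (intro filterlim_tendsto_pos_mult_at_top[OF tendsto_const] filterlim_Im_at_iinfinity) auto
  hence "filterlim (\<lambda>z. - (pi * c * Im z)) at_bot at_iinfinity"
    by (simp add: filterlim_uminus_at_top)
  from filterlim_compose[OF exp_at_bot this]
  show "((\<lambda>z. norm (exp (of_real pi * \<i> * of_real c * z))) \<longlongrightarrow> 0) at_iinfinity"
    by (simp add: norm_exp_eq_Re mult_ac)
qed

lemma open_upper_half_plane [simp]: "open upper_half_plane"
  unfolding upper_half_plane_def by (rule open_halfspace_Im_gt)

lemma convex_upper_half_plane [simp]: "convex upper_half_plane"
  unfolding upper_half_plane_def by (rule convex_halfspace_Im_gt)

lemma connected_upper_half_plane [simp]: "connected upper_half_plane"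
  by (rule convex_connected) simp

lemma ii_in_upper_half_plane [simp]: "\<i> \<in> upper_half_plane"
  by (simp add: upper_half_plane_def)

section \<open>Euler's product\<close>

definition euler_prod :: "complex \<Rightarrow> complex" where
  "euler_prod x = (\<Prod>m. 1 - x ^ Suc m)"

text \<open>A Lambert series for minus the logarithm of Euler's product: log(1 - x^m) is expanded
  and the sum over m is carried out first. Its terms are rational, so no branch has to be
  chosen.\<close>

definition euler_log :: "complex \<Rightarrow> complex" where
  "euler_log x = (\<Sum>k. x ^ Suc k / (of_nat (Suc k) * (1 - x ^ Suc k)))"

lemma one_minus_power_nonzero: "norm (x :: complex) < 1 \<Longrightarrow> 1 - x ^ Suc k \<noteq> 0"
  by (metis eq_iff_diff_eq_0 less_irrefl norm_one power_less_one_iff norm_ge_zero norm_power zero_less_Suc)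

text \<open>The derivative of y / (1 - y) at y = x^n is n x^(n-1) / (1 - y)^2, and n cancels against
  the denominator. Locally the terms are dominated by a geometric series, which justifies termwise
  differentiation.\<close>

lemma euler_log_deriv:
  assumes x: "norm x < 1"
  shows "(euler_log has_field_derivative (\<Sum>k. x ^ k / (1 - x ^ Suc k)\<^sup>2)) (at x)"
    and "summable (\<lambda>k. x ^ k / (1 - x ^ Suc k)\<^sup>2)"
proof -
  let ?f = "\<lambda>k (x::complex). x ^ Suc k / (of_nat (Suc k) * (1 - x ^ Suc k))"
  have "\<exists>g g'. \<forall>x \<in> ball 0 1. ((\<lambda>n. ?f n x) sums g x) \<and> ((\<lambda>n. x ^ n / (1 - x ^ Suc n)\<^sup>2) sums g' x) \<and>
      (g has_field_derivative g' x) (at x)"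
  proof (rule series_and_derivative_comparison_local)
    fix n and x :: complex assume "x \<in> ball 0 1"
    hence x: "norm x < 1" by simp
    have nz: "1 - x ^ Suc n \<noteq> 0" "(1 + of_nat n :: complex) \<noteq> 0"
      using one_minus_power_nonzero[OF x] by (simp_all del: power_Suc add: of_nat_Suc[symmetric] del: of_nat_Suc)
    have "((\<lambda>x. ?f n x) has_field_derivative
       ((of_nat (Suc n) * x ^ n) * (of_nat (Suc n) * (1 - x ^ Suc n)) - x ^ Suc n * (of_nat (Suc n) * (- (of_nat (Suc n) * x ^ n)))) /
         ((of_nat (Suc n) * (1 - x ^ Suc n)) * (of_nat (Suc n) * (1 - x ^ Suc n)))) (at x)"
      using nz by (auto intro!: derivative_eq_intros simp del: power_Suc)
    also have "((of_nat (Suc n) * x ^ n) * (of_nat (Suc n) * (1 - x ^ Suc n)) - x ^ Suc n * (of_nat (Suc n) * (- (of_nat (Suc n) * x ^ n))))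
       = of_nat (Suc n) * of_nat (Suc n) * x ^ n"
      by (simp add: algebra_simps)
    also have "of_nat (Suc n) * of_nat (Suc n) * x ^ n / ((of_nat (Suc n) * (1 - x ^ Suc n)) * (of_nat (Suc n) * (1 - x ^ Suc n)))
      = x ^ n / (1 - x ^ Suc n)\<^sup>2"
      by (simp add: power2_eq_square del: power_Suc of_nat_Suc)
    finally show "((\<lambda>x. ?f n x) has_field_derivative x ^ n / (1 - x ^ Suc n)\<^sup>2) (at x)" .
  next
    fix x :: complex assume "x \<in> ball 0 1"
    hence x: "norm x < 1" by simp
    define r where "r = (1 + norm x) / 2"
    have r: "norm x < r" "r < 1" "0 < r" using x by (auto simp: r_def)
       (metis add_pos_nonneg norm_ge_zero zero_less_one)
    have "norm (?f n y) \<le> r ^ Suc n / (1 - r)" if "y \<in> ball x (r - norm x)" for n y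
    proof -
      have "norm (y - x) < r - norm x" using that by (simp add: dist_norm norm_minus_commute)
      hence y: "norm y < r" using norm_triangle_ineq2[of y x] by linarith
      have a: "norm y ^ Suc n \<le> r ^ Suc n" using y by (intro power_mono) auto
      have "r ^ Suc n \<le> r ^ 1" using r by (intro power_decreasing) auto
      hence "1 - r \<le> 1 - norm y ^ Suc n" using a by simp
      also have "\<dots> \<le> norm (1 - y ^ Suc n)"
        by (metis norm_one norm_power norm_triangle_ineq2)
      finally have "1 - r \<le> norm (1 - y ^ Suc n)" .
      hence "1 * (1 - r) \<le> real (Suc n) * norm (1 - y ^ Suc n)" using r by (intro mult_mono) auto
      hence "norm y ^ Suc n / (real (Suc n) * norm (1 - y ^ Suc n)) \<le> r ^ Suc n / (1 - r)"
        using a r by (intro frac_le) auto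
      thus ?thesis by (simp only: norm_divide norm_mult norm_power norm_of_nat)
    qed
    moreover have "summable (\<lambda>n. r ^ Suc n / (1 - r))"
      using r by (intro summable_divide) (subst summable_Suc_iff, simp)
    ultimately show "\<exists>d h. 0 < d \<and> summable h \<and> (\<forall>\<^sub>F n in sequentially. \<forall>y\<in>ball x d \<inter> ball 0 1. norm (?f n y) \<le> h n)"
      using r by (intro exI[of _ "r - norm x"] exI[of _ "\<lambda>n. r ^ Suc n / (1 - r)"] conjI always_eventually) auto
  qed auto
  then obtain g g' where gg: "\<forall>x \<in> ball 0 1. ((\<lambda>n. ?f n x) sums g x) \<and>
      ((\<lambda>n. x ^ n / (1 - x ^ Suc n)\<^sup>2) sums g' x) \<and> (g has_field_derivative g' x) (at x)"
    by blast
  have g: "(\<lambda>n. ?f n x) sums g x" "(\<lambda>n. x ^ n / (1 - x ^ Suc n)\<^sup>2) sums g' x"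
      "(g has_field_derivative g' x) (at x)" if "norm x < 1" for x
    using bspec[OF gg, of x] that by (simp_all del: power_Suc of_nat_Suc)
  have "(euler_log has_field_derivative g' x) (at x)"
  proof (rule has_field_derivative_transform_within_open[OF g(3)[OF x], of "ball 0 1"])
    show "g y = euler_log y" if "y \<in> ball 0 1" for y
      using that sums_unique[OF g(1)[of y]] unfolding euler_log_def by simp
  qed (use x in auto)
  thus "(euler_log has_field_derivative (\<Sum>k. x ^ k / (1 - x ^ Suc k)\<^sup>2)) (at x)"
    using sums_unique[OF g(2)[OF x]] by simp
  show "summable (\<lambda>k. x ^ k / (1 - x ^ Suc k)\<^sup>2)"
    using g(2)[OF x] by (rule sums_summable)
qed

text \<open>The double series of x^(m k) / k converges absolutely. Summed over k it gives - log(1 -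
  x^m), summed over m a geometric series, hence the terms of \<open>euler_log\<close>.\<close>

lemma euler_prod_has_prod:
  assumes x: "norm x < 1"
  shows "(\<lambda>m. 1 - x ^ Suc m) has_prod exp (- euler_log x)"
proof -
  define r where "r = norm x"
  have r: "0 \<le> r" "r < 1" using x by (auto simp: r_def)
  let ?a = "\<lambda>(m, k). x ^ (Suc m * Suc k) / of_nat (Suc k) :: complex"
  have geo: "(\<lambda>n. r ^ n) summable_on UNIV"
    using r by (intro norm_summable_imp_summable_on) (simp add: summable_geometric)
  have "(\<lambda>(m, k). r ^ m * r ^ k) summable_on (UNIV \<times> UNIV)"
  proof (rule summable_on_SigmaI[where g = "\<lambda>m. r ^ m * infsum (\<lambda>n. r ^ n) UNIV"])
    fix m :: nat
    show "((\<lambda>n. case (m, n) of (m, n) \<Rightarrow> r ^ m * r ^ n) has_sum r ^ m * infsum (\<lambda>n. r ^ n) UNIV) UNIV"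
      using has_sum_cmult_right[OF has_sum_infsum[OF geo], of "r ^ m"] by simp
  next
    show "(\<lambda>m. r ^ m * infsum (\<lambda>n. r ^ n) UNIV) summable_on UNIV"
      by (rule summable_on_cmult_left[OF geo])
  qed (use r in simp)
  hence "(\<lambda>p. norm (?a p)) summable_on (UNIV \<times> UNIV)"
  proof (rule summable_on_comparison_test)
    fix p :: "nat \<times> nat"
    obtain m k where p: "p = (m, k)" by fastforce
    have "norm (?a p) = r ^ (Suc m * Suc k) / real (Suc k)"
      by (simp only: p prod.case norm_divide norm_power norm_of_nat r_def)
    also have "\<dots> \<le> r ^ (Suc m * Suc k) / 1"
      using r by (intro divide_left_mono) auto
    also have "\<dots> \<le> r ^ (m + k)"
      using r by (simp only: div_by_1, intro power_decreasing) auto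
    finally show "norm (?a p) \<le> (case p of (m, k) \<Rightarrow> r ^ m * r ^ k)"
      by (simp add: p power_add)
  qed auto
  hence S: "?a summable_on (UNIV \<times> UNIV)" by (rule abs_summable_summable)
  have nx: "norm (x ^ Suc m) < 1" for m
    using r power_less_one_iff[of r "Suc m"] by (simp only: norm_power r_def) simp
  have row: "(\<Sum>\<^sub>\<infinity>k. ?a (m, k)) = - Ln (1 - x ^ Suc m)" for m
  proof -
    have "(\<lambda>n. - ((x ^ Suc m) ^ n) / of_nat n) sums ln (1 - x ^ Suc m)"
      using Ln_series'[of "- (x ^ Suc m)"] nx[of m] by (simp del: power_Suc)
    hence "(\<lambda>n. - ((x ^ Suc m) ^ Suc n) / of_nat (Suc n)) sums ln (1 - x ^ Suc m)"
      by (subst sums_Suc_iff) (simp del: power_Suc)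
    hence s: "(\<lambda>n. ?a (m, n)) sums - Ln (1 - x ^ Suc m)"
      using sums_minus by (fastforce simp only: prod.case power_mult minus_divide_left minus_minus)
    have "(\<lambda>n. ?a (m, n)) summable_on UNIV"
      using summable_on_SigmaD1[of "\<lambda>m n. ?a (m, n)" UNIV "\<lambda>_. UNIV" m] S by simp
    from has_sum_imp_sums[OF has_sum_infsum[OF this]] s show ?thesis
      by (rule sums_unique2)
  qed
  have col: "(\<Sum>\<^sub>\<infinity>m. ?a (m, k)) = x ^ Suc k / (of_nat (Suc k) * (1 - x ^ Suc k))" for k
  proof -
    have "(\<lambda>m. (x ^ Suc k) * (x ^ Suc k) ^ m / of_nat (Suc k)) sums (x ^ Suc k * (1 / (1 - x ^ Suc k)) / of_nat (Suc k))"
      by (intro sums_divide sums_mult geometric_sums nx)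
    moreover have "?a (m, k) = (x ^ Suc k) * (x ^ Suc k) ^ m / of_nat (Suc k)" for m
    proof -
      have "x ^ (Suc m * Suc k) = (x ^ Suc k) ^ Suc m" by (metis mult.commute power_mult)
      thus ?thesis by (simp only: prod.case power_Suc[of "x ^ Suc k" m])
    qed
    ultimately have s: "(\<lambda>m. ?a (m, k)) sums (x ^ Suc k / (of_nat (Suc k) * (1 - x ^ Suc k)))"
      by (simp add: mult_ac del: of_nat_Suc power_Suc)
    have "(\<lambda>(k, m). ?a (m, k)) summable_on (UNIV \<times> UNIV)"
      using S by (subst (asm) summable_on_swap) (simp add: case_prod_unfold)
    hence "(\<lambda>m. ?a (m, k)) summable_on UNIV"
      using summable_on_SigmaD1[of "\<lambda>k m. ?a (m, k)" UNIV "\<lambda>_. UNIV" k] by simp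
    from has_sum_imp_sums[OF has_sum_infsum[OF this]] s show ?thesis
      by (rule sums_unique2)
  qed
  have S2: "(\<lambda>(m, k). ?a (m, k)) summable_on (UNIV \<times> UNIV)"
    using S by simp
  have "(\<lambda>m. \<Sum>\<^sub>\<infinity>k. ?a (m, k)) summable_on UNIV"
    using summable_on_Sigma_banach[of "\<lambda>m k. ?a (m, k)" UNIV "\<lambda>_. UNIV"] S2 by simp
  hence 1: "((\<lambda>m. - Ln (1 - x ^ Suc m)) has_sum (\<Sum>\<^sub>\<infinity>m. \<Sum>\<^sub>\<infinity>k. ?a (m, k))) UNIV"
    unfolding row by (rule has_sum_infsum)
  have eq: "(\<Sum>\<^sub>\<infinity>m. \<Sum>\<^sub>\<infinity>k. ?a (m, k)) = (\<Sum>\<^sub>\<infinity>k. \<Sum>\<^sub>\<infinity>m. ?a (m, k))"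
    using infsum_swap_banach[of "\<lambda>m k. ?a (m, k)" UNIV UNIV] S2 by simp
  have "(\<lambda>(k, m). ?a (m, k)) summable_on (UNIV \<times> UNIV)"
    using S by (subst (asm) summable_on_swap) (simp add: case_prod_unfold)
  hence "(\<lambda>k. \<Sum>\<^sub>\<infinity>m. ?a (m, k)) summable_on UNIV"
    using summable_on_Sigma_banach[of "\<lambda>k m. ?a (m, k)" UNIV "\<lambda>_. UNIV"] by simp
  hence "((\<lambda>k. x ^ Suc k / (of_nat (Suc k) * (1 - x ^ Suc k))) has_sum (\<Sum>\<^sub>\<infinity>k. \<Sum>\<^sub>\<infinity>m. ?a (m, k))) UNIV"
    unfolding col by (rule has_sum_infsum)
  from sums_unique[OF has_sum_imp_sums[OF this], symmetric]
  have "euler_log x = (\<Sum>\<^sub>\<infinity>k. \<Sum>\<^sub>\<infinity>m. ?a (m, k))"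
    unfolding euler_log_def .
  hence "(\<lambda>m. - Ln (1 - x ^ Suc m)) sums euler_log x"
    using has_sum_imp_sums[OF 1] eq by simp
  hence "(\<lambda>m. Ln (1 - x ^ Suc m)) sums (- euler_log x)"
    using sums_minus by fastforce
  from sums_imp_has_prod_exp[OF this]
  show ?thesis
    using one_minus_power_nonzero[OF x] by (simp add: has_prod_def del: power_Suc)
qed

lemma euler_prod_eq_exp: "norm x < 1 \<Longrightarrow> euler_prod x = exp (- euler_log x)"
  unfolding euler_prod_def by (rule has_prod_unique[OF euler_prod_has_prod, symmetric])

lemma euler_prod_nonzero: "norm x < 1 \<Longrightarrow> euler_prod x \<noteq> 0"
  by (simp add: euler_prod_eq_exp)

lemma euler_prod_LIMSEQ:
  assumes "norm x < 1"
  shows "(\<lambda>n. \<Prod>m<n. 1 - x ^ Suc m) \<longlonglongrightarrow> euler_prod x"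
  using has_prod_imp_tendsto'[OF euler_prod_has_prod[OF assms]] by (simp add: euler_prod_eq_exp[OF assms])

lemma euler_prod_tendsto_0: "euler_prod \<midarrow>0\<rightarrow> 1"
proof -
  have "isCont euler_log 0"
    using euler_log_deriv(1)[of 0] by (intro DERIV_isCont) auto
  hence "((\<lambda>x. exp (- euler_log x)) \<longlongrightarrow> exp (- euler_log 0)) (at 0)"
    by (intro tendsto_intros) (simp add: isCont_def)
  moreover have "euler_log 0 = 0" by (simp add: euler_log_def)
  moreover have "\<forall>\<^sub>F x in at 0. exp (- euler_log x) = euler_prod x"
    using eventually_at_ball[of 1 0 UNIV] by (auto simp: euler_prod_eq_exp elim!: eventually_mono)
  ultimately show ?thesis
    using Lim_transform_eventually by fastforce
qed

lemma euler_prod_split: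
  fixes x :: complex
  assumes x: "norm x < 1"
  shows "(\<lambda>n. \<Prod>m<n. 1 - x ^ (2 * m + 1)) \<longlonglongrightarrow> euler_prod x / euler_prod (x\<^sup>2)"
proof -
  have x2: "norm (x\<^sup>2) < 1" using x by (simp add: norm_power power_less_one_iff abs_square_less_1)
  have "(\<lambda>n. \<Prod>m<2*n. 1 - x ^ Suc m) \<longlonglongrightarrow> euler_prod x"
    by (rule filterlim_compose[OF euler_prod_LIMSEQ[OF x]])
      (auto intro!: filterlim_subseq simp: strict_mono_def)
  from tendsto_divide[OF this euler_prod_LIMSEQ[OF x2] euler_prod_nonzero[OF x2]]
  have "(\<lambda>n. (\<Prod>m<2*n. 1 - x ^ Suc m) / (\<Prod>m<n. 1 - (x\<^sup>2) ^ Suc m)) \<longlonglongrightarrow> euler_prod x / euler_prod (x\<^sup>2)" .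
  moreover have "(\<Prod>m<2*n. 1 - x ^ Suc m) = (\<Prod>m<n. 1 - x ^ (2 * m + 1)) * (\<Prod>m<n. 1 - (x\<^sup>2) ^ Suc m)" for n
  proof (induction n)
    case (Suc n)
    have "{..<2 * Suc n} = insert (2*n) (insert (2*n+1) {..<2*n})" by auto
    hence "(\<Prod>m<2*Suc n. 1 - x ^ Suc m) = (1 - x ^ (2*n+1)) * ((1 - x ^ (2*n+2)) * (\<Prod>m<2*n. 1 - x ^ Suc m))"
      by simp
    also have "x ^ (2*n+2) = (x\<^sup>2) ^ Suc n" by (simp only: power_mult[symmetric]) simp
    finally have "(\<Prod>m<2*Suc n. 1 - x ^ Suc m) =
      (1 - x ^ (2*n+1)) * ((1 - (x\<^sup>2) ^ Suc n) * (\<Prod>m<2*n. 1 - x ^ Suc m))" .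
    thus ?case unfolding Suc.IH by (simp only: prod.lessThan_Suc mult_ac)
  qed simp
  moreover have "(\<Prod>m<n. 1 - (x\<^sup>2) ^ Suc m) \<noteq> 0" for n
    using one_minus_power_nonzero[OF x2] by (simp del: power_Suc)
  ultimately show ?thesis by simp
qed

text \<open>By \<open>euler_prod_split\<close> the quotient of Euler's products at x and x^2
  collects the odd exponents. The odd factors at x and at -x multiply to 1 - x^(2(2m+1)), the odd
  factors at x^2.\<close>

lemma euler_prod_duplication:
  fixes x :: complex
  assumes x: "norm x < 1"
  shows "euler_prod (- x) * euler_prod x * euler_prod (x ^ 4) = euler_prod (x\<^sup>2) ^ 3"
proof -
  have x2: "norm (x\<^sup>2) < 1" using x by (simp add: norm_power power_less_one_iff abs_square_less_1)
  have x4: "(x\<^sup>2)\<^sup>2 = x ^ 4" by simp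
  have n4: "norm (x ^ 4) < 1" using x by (simp add: norm_power power_less_one_iff)
  have "(\<lambda>n. (\<Prod>m<n. 1 - x ^ (2 * m + 1)) * (\<Prod>m<n. 1 - (- x) ^ (2 * m + 1))) \<longlonglongrightarrow>
     (euler_prod x / euler_prod (x\<^sup>2)) * (euler_prod (- x) / euler_prod (x\<^sup>2))"
    using tendsto_mult[OF euler_prod_split[OF x] euler_prod_split[of "- x"]] x by simp
  moreover have "(\<Prod>m<n. 1 - x ^ (2 * m + 1)) * (\<Prod>m<n. 1 - (- x) ^ (2 * m + 1)) = (\<Prod>m<n. 1 - (x\<^sup>2) ^ (2 * m + 1))" for n
    unfolding prod.distrib[symmetric]
  proof (intro prod.cong refl)
    fix m
    define y where "y = x ^ (2 * m + 1)"
    have "(- x) ^ (2 * m + 1) = - y" unfolding y_def by (rule power_minus_odd) simp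
    moreover have "(x\<^sup>2) ^ (2 * m + 1) = y\<^sup>2" unfolding y_def by (simp only: power_mult[symmetric] mult.commute)
    moreover have "(1 - y) * (1 - (- y)) = 1 - y\<^sup>2" by (simp add: power2_eq_square algebra_simps)
    ultimately show "(1 - x ^ (2 * m + 1)) * (1 - (- x) ^ (2 * m + 1)) = 1 - (x\<^sup>2) ^ (2 * m + 1)"
      by (simp only: y_def)
  qed
  ultimately have "(\<lambda>n. \<Prod>m<n. 1 - (x\<^sup>2) ^ (2 * m + 1)) \<longlonglongrightarrow>
     (euler_prod x / euler_prod (x\<^sup>2)) * (euler_prod (- x) / euler_prod (x\<^sup>2))" by simp
  from LIMSEQ_unique[OF this euler_prod_split[OF x2]]
  have "(euler_prod x / euler_prod (x\<^sup>2)) * (euler_prod (- x) / euler_prod (x\<^sup>2)) = euler_prod (x\<^sup>2) / euler_prod (x ^ 4)"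
    unfolding x4 .
  thus ?thesis
    using euler_prod_nonzero[OF x2] euler_prod_nonzero[OF n4]
    by (simp add: field_simps power3_eq_cube)
qed

section \<open>The Dedekind eta function\<close>

lemma norm_exp_ii_upper_simps:
  assumes "z \<in> upper_half_plane"
  shows "norm (exp (2 * of_real pi * \<i> * z)) < 1" "norm (exp (of_real pi * \<i> * z)) < 1"
  using assms by (simp_all add: upper_half_plane_def norm_exp_eq_Re)

lemma eta_eq_euler_prod:
  "eta z = exp (of_real pi * \<i> * z / 12) * euler_prod (exp (2 * of_real pi * \<i> * z))"
proof -
  have "exp (2 * of_real pi * \<i> * z) = exp (of_real pi * \<i> * z) ^ 2"
    unfolding exp_double[symmetric] by (simp add: mult.assoc)
  hence "exp (of_real pi * \<i> * z) ^ (2 * Suc m) = exp (2 * of_real pi * \<i> * z) ^ Suc m" for m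
    by (simp only: power_mult)
  thus ?thesis by (simp only: eta_def euler_prod_def)
qed

text \<open>An explicit holomorphic logarithm of \<open>eta\<close>; its derivative is pi i / 12
  times E_2.\<close>

definition eta_log :: "complex \<Rightarrow> complex" where
  "eta_log z = of_real pi * \<i> * z / 12 - euler_log (exp (2 * of_real pi * \<i> * z))"

lemma eta_eq_exp: "z \<in> upper_half_plane \<Longrightarrow> eta z = exp (eta_log z)"
  by (simp only: eta_eq_euler_prod eta_log_def euler_prod_eq_exp norm_exp_ii_upper_simps
      diff_conv_add_uminus exp_add)

lemma eta_nonzero: "z \<in> upper_half_plane \<Longrightarrow> eta z \<noteq> 0"
  by (simp add: eta_eq_exp)

lemma csc_series_eq:
  assumes z: "z \<in> upper_half_plane"
  defines "x \<equiv> exp (2 * of_real pi * \<i> * z)"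
  shows "(\<Sum>k. x ^ k / (1 - x ^ Suc k)\<^sup>2) * x = - csc_series z / 4"
proof -
  have x: "norm x < 1" using norm_exp_ii_upper_simps[OF z] by (simp add: x_def)
  have eq: "x ^ k / (1 - x ^ Suc k)\<^sup>2 * x = - (1/4) * (1 / (sin (of_real pi * (of_nat (Suc k) * z)))\<^sup>2)" for k
  proof -
    define a where "a = exp (\<i> * (of_real pi * (of_nat (Suc k) * z)))"
    have a: "a \<noteq> 0" by (simp add: a_def)
    have xa: "x ^ Suc k = a\<^sup>2"
    proof -
      have "x ^ Suc k = exp (of_nat (Suc k) * (2 * of_real pi * \<i> * z))"
        by (simp only: x_def exp_of_nat_mult)
      also have "\<dots> = exp (2 * (\<i> * (of_real pi * (of_nat (Suc k) * z))))" by (simp add: mult_ac)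
      also have "\<dots> = a\<^sup>2" unfolding a_def by (rule exp_double)
      finally show ?thesis .
    qed
    have nz: "1 - a\<^sup>2 \<noteq> 0" using one_minus_power_nonzero[OF x, of k] unfolding xa .
    have "sin (of_real pi * (of_nat (Suc k) * z)) = (a - 1 / a) / (2 * \<i>)"
      by (subst sin_exp_eq) (simp add: a_def exp_minus inverse_eq_divide)
    hence "(sin (of_real pi * (of_nat (Suc k) * z)))\<^sup>2 = ((a - 1 / a) / (2 * \<i>))\<^sup>2"
      by (simp only:)
    also have "\<dots> = - ((1 - a\<^sup>2)\<^sup>2 / (4 * a\<^sup>2))"
      using a by (simp add: power2_eq_square field_simps)
    finally have "(sin (of_real pi * (of_nat (Suc k) * z)))\<^sup>2 = - ((1 - a\<^sup>2)\<^sup>2 / (4 * a\<^sup>2))" .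
    moreover have "x ^ k / (1 - x ^ Suc k)\<^sup>2 * x = a\<^sup>2 / (1 - a\<^sup>2)\<^sup>2"
      unfolding xa[symmetric] by simp
    moreover have "a\<^sup>2 / (1 - a\<^sup>2)\<^sup>2 = - (1/4) * (1 / (- ((1 - a\<^sup>2)\<^sup>2 / (4 * a\<^sup>2))))"
      using a nz by simp
    ultimately show ?thesis by (simp only:)
  qed
  have "(\<lambda>k. x ^ k / (1 - x ^ Suc k)\<^sup>2 * x) sums ((\<Sum>k. x ^ k / (1 - x ^ Suc k)\<^sup>2) * x)"
    by (intro sums_mult2 summable_sums euler_log_deriv(2) x)
  hence "(\<lambda>k. - 4 * (- (1/4) * (1 / (sin (of_real pi * (of_nat (Suc k) * z)))\<^sup>2))) sums
     (- 4 * ((\<Sum>k. x ^ k / (1 - x ^ Suc k)\<^sup>2) * x))"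
    unfolding eq by (rule sums_mult)
  hence "csc_series z = - 4 * ((\<Sum>k. x ^ k / (1 - x ^ Suc k)\<^sup>2) * x)"
    unfolding csc_series_def by (intro sums_unique[symmetric]) simp
  thus ?thesis by simp
qed

lemma eta_log_deriv:
  assumes z: "z \<in> upper_half_plane"
  shows "(eta_log has_field_derivative (of_real pi * \<i> / 12 + of_real pi * \<i> / 2 * csc_series z)) (at z)"
proof -
  let ?x = "exp (2 * of_real pi * \<i> * z)"
  have x: "norm ?x < 1" by (rule norm_exp_ii_upper_simps[OF z])
  have "((\<lambda>z. exp (2 * of_real pi * \<i> * z)) has_field_derivative (?x * (2 * of_real pi * \<i>))) (at z)"
    by (auto intro!: derivative_eq_intros)
  from DERIV_chain2[OF euler_log_deriv(1)[OF x] this]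
  have 1: "((\<lambda>z. euler_log (exp (2 * of_real pi * \<i> * z))) has_field_derivative
     (\<Sum>k. ?x ^ k / (1 - ?x ^ Suc k)\<^sup>2) * (?x * (2 * of_real pi * \<i>))) (at z)" .
  have "(\<Sum>k. ?x ^ k / (1 - ?x ^ Suc k)\<^sup>2) * (?x * (2 * of_real pi * \<i>)) = (- csc_series z / 4) * (2 * of_real pi * \<i>)"
    unfolding csc_series_eq[OF z, symmetric] by (simp only: mult.assoc)
  with 1 have "((\<lambda>z. euler_log (exp (2 * of_real pi * \<i> * z))) has_field_derivative
     (- csc_series z / 4) * (2 * of_real pi * \<i>)) (at z)" by (simp only:)
  thus ?thesis unfolding eta_log_def by (auto intro!: derivative_eq_intros simp: mult_ac)
qed

lemma eta_holomorphic: "eta holomorphic_on upper_half_plane"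
proof -
  have "eta_log holomorphic_on upper_half_plane"
    unfolding holomorphic_on_open[OF open_upper_half_plane] using eta_log_deriv by blast
  hence "(\<lambda>z. exp (eta_log z)) holomorphic_on upper_half_plane"
    by (intro holomorphic_intros)
  thus ?thesis
    by (rule holomorphic_transform) (simp add: eta_eq_exp)
qed

lemma neg_inverse_in_upper: "z \<in> upper_half_plane \<Longrightarrow> - 1 / z \<in> upper_half_plane"
  unfolding upper_half_plane_def by (simp add: Im_neg_inverse_pos(1) del: divide_minus_left)

text \<open>By the inversion of E_2, log eta(-1/z) - log eta(z) - (Log z) / 2 has derivative zero.
  It is constant on the convex half plane, and K is the exponential of that constant.\<close>

theorem eta_inversion:
  obtains K where "K \<noteq> 0" "\<And>z. z \<in> upper_half_plane \<Longrightarrow> eta (- 1 / z) = K * z powr (1/2) * eta z"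
proof -
  let ?B = "\<lambda>z. eta_log (- 1 / z) - eta_log z - Ln z / 2"
  have D: "(?B has_field_derivative 0) (at z within upper_half_plane)" if z: "z \<in> upper_half_plane" for z
  proof -
    have z0: "z \<noteq> 0" and zn: "z \<notin> \<real>\<^sub>\<le>\<^sub>0"
      using z by (auto simp: upper_half_plane_def complex_nonpos_Reals_iff)
    have 1: "((\<lambda>z. - 1 / z) has_field_derivative (1 / z\<^sup>2)) (at z)"
      using z0 by (auto intro!: derivative_eq_intros simp: power2_eq_square)
    note 2 = DERIV_chain2[OF eta_log_deriv[OF neg_inverse_in_upper[OF z]] 1]
    have 3: "((\<lambda>z. Ln z / 2) has_field_derivative (1 / z / 2)) (at z)"
      using DERIV_cdivide[OF has_field_derivative_Ln[OF zn], of 2] by (simp add: inverse_eq_divide)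
    have "(?B has_field_derivative
      ((of_real pi * \<i> / 12 + of_real pi * \<i> / 2 * csc_series (- 1 / z)) * (1 / z\<^sup>2)
        - (of_real pi * \<i> / 12 + of_real pi * \<i> / 2 * csc_series z) - 1 / z / 2)) (at z)"
      by (intro DERIV_diff 2 3 eta_log_deriv z)
    moreover have "(of_real pi * \<i> / 12 + of_real pi * \<i> / 2 * csc_series (- 1 / z)) * (1 / z\<^sup>2)
        - (of_real pi * \<i> / 12 + of_real pi * \<i> / 2 * csc_series z) - 1 / z / 2 = 0"
    proof -
      define p :: complex where "p = of_real pi"
      have p: "p \<noteq> 0" by (simp add: p_def)
      define c c' y where "c = csc_series z" and "c' = csc_series (- 1 / z)" and "y = 1 / z"
      have "2 * p ^ 2 * c = 2 * p ^ 2 * c' * y\<^sup>2 + p ^ 2 / 3 * y\<^sup>2 - p ^ 2 / 3 + 2 * p * \<i> * y"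
        using csc_series_inversion[of z] z
        by (simp add: upper_half_plane_def p_def c_def c'_def y_def power_divide)
      hence "p * (2 * p * c) = p * (2 * p * c' * y\<^sup>2 + p / 3 * y\<^sup>2 - p / 3 + 2 * \<i> * y)"
        by (simp add: power2_eq_square algebra_simps)
      hence "2 * p * c = 2 * p * c' * y\<^sup>2 + p / 3 * y\<^sup>2 - p / 3 + 2 * \<i> * y"
        using p by (simp only: mult_cancel_left) simp
      hence "\<i> / 4 * (2 * p * c) = \<i> / 4 * (2 * p * c' * y\<^sup>2 + p / 3 * y\<^sup>2 - p / 3 + 2 * \<i> * y)"
        by (simp only:)
      hence "p * \<i> / 2 * c = p * \<i> / 2 * c' * y\<^sup>2 + p * \<i> / 12 * y\<^sup>2 - p * \<i> / 12 - y / 2"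
        by (simp add: algebra_simps)
      moreover have "1 / z\<^sup>2 = y\<^sup>2" by (simp add: y_def power_divide)
      ultimately show ?thesis
        unfolding p_def[symmetric] c_def[symmetric] c'_def[symmetric] y_def[symmetric]
        by (simp add: algebra_simps)
    qed
    ultimately have "(?B has_field_derivative 0) (at z)" by (simp only:)
    thus ?thesis by (rule has_field_derivative_at_within)
  qed
  then obtain C where C: "\<And>z. z \<in> upper_half_plane \<Longrightarrow> ?B z = C"
    using has_field_derivative_zero_constant[OF convex_upper_half_plane D] by blast
  show thesis
  proof (rule that[of "exp C"])
    fix z assume z: "z \<in> upper_half_plane"
    have "z \<noteq> 0" using z by (auto simp: upper_half_plane_def)
    have "eta_log (- 1 / z) = C + 1/2 * Ln z + eta_log z" using C[OF z] by (simp add: algebra_simps)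
    thus "eta (- 1 / z) = exp C * z powr (1/2) * eta z"
      using \<open>z \<noteq> 0\<close> by (simp only: eta_eq_exp[OF z] eta_eq_exp[OF neg_inverse_in_upper[OF z]] exp_add powr_def if_False)
  qed simp
qed

lemma eta_plus_1: "eta (z + 1) = exp (of_real pi * \<i> / 12) * eta z"
proof -
  have "exp (2 * of_real pi * \<i> * (z + 1)) = exp (2 * of_real pi * \<i> * z) * exp (2 * of_real pi * \<i>)"
    by (simp only: distrib_left exp_add mult_1_right)
  also have "exp (2 * of_real pi * \<i>) = 1" by (rule exp_two_pi_i)
  finally show ?thesis
    by (simp add: eta_eq_euler_prod distrib_left add_divide_distrib exp_add)
qed

lemma eta_at_iinfinity: "((\<lambda>z. eta z / exp (of_real pi * \<i> * z / 12)) \<longlongrightarrow> 1) at_iinfinity"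
proof -
  have "((\<lambda>z. exp (2 * of_real pi * \<i> * z)) \<longlongrightarrow> 0) at_iinfinity"
    using exp_tendsto_0_at_iinfinity[of 2] by (simp add: mult_ac)
  hence "filterlim (\<lambda>z. exp (2 * of_real pi * \<i> * z)) (at 0) at_iinfinity"
    by (simp add: filterlim_at)
  from filterlim_compose[OF euler_prod_tendsto_0 this] show ?thesis
    by (simp add: eta_eq_euler_prod)
qed

text \<open>For x = exp(pi i z) the arguments (z + 1)/2, z/2, 2z and z belong to -x, x, x^4 and x^2.
  This removes the shifted argument (z + 1)/2, in which Jacobi's product is naturally
  expressed.\<close>

lemma eta_duplication:
  assumes z: "z \<in> upper_half_plane"
  shows "eta ((z + 1) / 2) * eta (z / 2) * eta (2 * z) = exp (of_real pi * \<i> / 24) * eta z ^ 3"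
proof -
  define x where "x = exp (of_real pi * \<i> * z)"
  have "norm x < 1" using norm_exp_ii_upper_simps[OF z] by (simp add: x_def)
  note dup = euler_prod_duplication[OF this]
  have "2 * of_real pi * \<i> * ((z + 1) / 2) = of_real pi * \<i> * z + of_real pi * \<i>"
    by (simp add: algebra_simps)
  hence x1: "exp (2 * of_real pi * \<i> * ((z + 1) / 2)) = - x"
    by (simp only: exp_add exp_pi_i x_def) simp
  have x2: "exp (2 * of_real pi * \<i> * (z / 2)) = x" by (simp add: x_def mult_ac)
  have x3: "exp (2 * of_real pi * \<i> * (2 * z)) = x ^ 4"
    unfolding x_def using exp_of_nat_mult[of 4 "of_real pi * \<i> * z"] by (simp add: mult_ac)
  have x4: "exp (2 * of_real pi * \<i> * z) = x\<^sup>2"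
    unfolding x_def using exp_of_nat_mult[of 2 "of_real pi * \<i> * z"] by (simp add: mult_ac)
  have e3: "exp a ^ 3 = exp (3 * a)" for a :: complex
    using exp_of_nat_mult[of 3 a] by simp
  have "eta ((z + 1) / 2) * eta (z / 2) * eta (2 * z) =
     (exp (of_real pi * \<i> * ((z + 1) / 2) / 12) * exp (of_real pi * \<i> * (z / 2) / 12) * exp (of_real pi * \<i> * (2 * z) / 12)) *
     (euler_prod (- x) * euler_prod x * euler_prod (x ^ 4))"
    unfolding eta_eq_euler_prod x1 x2 x3 by (simp add: mult_ac)
  also have "exp (of_real pi * \<i> * ((z + 1) / 2) / 12) * exp (of_real pi * \<i> * (z / 2) / 12) * exp (of_real pi * \<i> * (2 * z) / 12)
     = exp (of_real pi * \<i> / 24) * exp (of_real pi * \<i> * z / 12) ^ 3"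
    unfolding e3 exp_add[symmetric] by (rule arg_cong[where f = exp]) (simp add: field_simps)
  finally show ?thesis
    unfolding dup by (simp add: eta_eq_euler_prod x4 power_mult_distrib)
qed

section \<open>Theta series as eta quotients\<close>

section \<open>Jacobi's product for the theta series\<close>

text \<open>The symbol (q; q)_n for q = x^2; keeping x avoids square roots of q in the exponents j^2
  of the theta series.\<close>

definition qpoch :: "complex \<Rightarrow> nat \<Rightarrow> complex" where
  "qpoch x n = (\<Prod>m<n. 1 - (x\<^sup>2) ^ Suc m)"

text \<open>The Gaussian binomial coefficient for q = x^2. The value 0 for k > M makes Pascal's rule
  valid at the border k = M.\<close>

definition qbinom :: "complex \<Rightarrow> nat \<Rightarrow> nat \<Rightarrow> complex" where
  "qbinom x M k = (if k \<le> M then qpoch x M / (qpoch x k * qpoch x (M - k)) else 0)"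

lemma norm_square_less_1: "norm (x :: complex) < 1 \<Longrightarrow> norm (x\<^sup>2) < 1"
  by (simp add: norm_power power_less_one_iff abs_square_less_1)

lemma qpoch_nonzero: "norm x < 1 \<Longrightarrow> qpoch x n \<noteq> 0"
  unfolding qpoch_def using one_minus_power_nonzero[OF norm_square_less_1] by (simp del: power_Suc)

lemma qpoch_Suc: "qpoch x (Suc n) = qpoch x n * (1 - (x\<^sup>2) ^ Suc n)"
  by (simp add: qpoch_def)

lemma qbinom_0: "norm x < 1 \<Longrightarrow> qbinom x M 0 = 1"
  using qpoch_nonzero[of x M] by (simp add: qbinom_def) (simp add: qpoch_def)

text \<open>Pascal's rule. With a = q^(k+1) and b = q^(M-k) and a common denominator it is the
  identity 1 - a b = (1 - b) + b (1 - a).\<close>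

lemma qbinom_Suc:
  assumes x: "norm x < 1" and k: "k \<le> M"
  shows "qbinom x (Suc M) (Suc k) = qbinom x M (Suc k) + (x\<^sup>2) ^ (M - k) * qbinom x M k"
proof (cases "k = M")
  case True
  thus ?thesis using qpoch_nonzero[OF x] by (simp add: qbinom_def)
next
  case False
  then obtain d where d: "M = Suc (k + d)" using k less_imp_Suc_add le_neq_implies_less by blast
  define A B a b where "A = qpoch x k" and "B = qpoch x d" and "a = (x\<^sup>2) ^ Suc k" and "b = (x\<^sup>2) ^ Suc d"
  have nz: "A \<noteq> 0" "B \<noteq> 0" "1 - a \<noteq> 0" "1 - b \<noteq> 0"
    unfolding A_def B_def a_def b_def
    using qpoch_nonzero[OF x] one_minus_power_nonzero[OF norm_square_less_1[OF x]] by blast+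
  define C where "C = qpoch x M"
  have ab: "(x\<^sup>2) ^ Suc M = a * b"
    by (simp only: a_def b_def d power_add[symmetric] add_Suc add_Suc_right)
  have dk: "Suc M - Suc k = Suc d" "M - Suc k = d" "M - k = Suc d" "Suc k \<le> Suc M" "Suc k \<le> M" "k \<le> M"
    using d by auto
  have 1: "qbinom x (Suc M) (Suc k) = C * (1 - a * b) / ((A * (1 - a)) * (B * (1 - b)))"
    unfolding qbinom_def using dk by (simp only: qpoch_Suc ab if_True) (simp only: A_def B_def a_def b_def C_def)
  have 2: "qbinom x M (Suc k) = C / ((A * (1 - a)) * B)"
    unfolding qbinom_def using dk by (simp only: qpoch_Suc if_True) (simp only: A_def B_def a_def b_def C_def)
  have 3: "qbinom x M k = C / (A * (B * (1 - b)))"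
    unfolding qbinom_def using dk by (simp only: qpoch_Suc if_True) (simp only: A_def B_def a_def b_def C_def)
  have 4: "(x\<^sup>2) ^ (M - k) = b" using d by (simp add: b_def)
  have "C / ((A * (1 - a)) * B) = C * (1 - b) / ((A * (1 - a)) * (B * (1 - b)))"
    using nz by simp
  moreover have "b * (C / (A * (B * (1 - b)))) = b * C * (1 - a) / ((A * (1 - a)) * (B * (1 - b)))"
    using nz by simp
  moreover have "C * (1 - a * b) = C * (1 - b) + b * C * (1 - a)"
    by (simp add: algebra_simps)
  ultimately show ?thesis unfolding 1 2 3 4 by (simp only: add_divide_distrib)
qed

lemma q_binomial_theorem:
  assumes x: "norm x < 1"
  shows "(\<Prod>j<M. w + x ^ (2 * j)) = (\<Sum>k\<le>M. x ^ (k * (k - 1)) * qbinom x M k * w ^ (M - k))"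
proof (induction M)
  case 0
  show ?case using qbinom_0[OF x] by simp
next
  case (Suc M)
  let ?t = "\<lambda>M k. x ^ (k * (k - 1)) * qbinom x M k * w ^ (M - k)"
  have e: "x ^ (Suc k * k) * (x\<^sup>2) ^ (M - k) = x ^ (k * (k - 1)) * x ^ (2 * M)" if le: "k \<le> M" for k
  proof -
    obtain d where d: "M = k + d" using le_Suc_ex[OF le] by blast
    have "Suc k * k + 2 * (M - k) = k * (k - 1) + 2 * M" unfolding d by (cases k) (simp_all add: algebra_simps)
    thus ?thesis by (simp only: power_mult[symmetric] power_add[symmetric])
  qed
  have "(\<Prod>j<Suc M. w + x ^ (2 * j)) = (\<Sum>k\<le>M. ?t M k) * w + (\<Sum>k\<le>M. ?t M k) * x ^ (2 * M)"
    by (simp only: prod.lessThan_Suc Suc.IH distrib_left)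
  also have "(\<Sum>k\<le>M. ?t M k) * w = (\<Sum>k\<le>M. x ^ (k * (k - 1)) * qbinom x M k * w ^ (Suc M - k))"
    unfolding sum_distrib_right by (intro sum.cong refl) (simp add: Suc_diff_le)
  also have "\<dots> = (\<Sum>k\<le>Suc M. x ^ (k * (k - 1)) * qbinom x M k * w ^ (Suc M - k))"
  proof -
    have "qbinom x M (Suc M) = 0" by (simp add: qbinom_def)
    thus ?thesis by (simp only: sum.atMost_Suc mult_zero_right mult_zero_left add_0_right)
  qed
  also have "\<dots> = w ^ Suc M + (\<Sum>k\<le>M. x ^ (Suc k * k) * qbinom x M (Suc k) * w ^ (M - k))"
    by (simp only: sum.atMost_Suc_shift qbinom_0[OF x] diff_Suc_Suc diff_Suc_1) simp
  also have "(\<Sum>k\<le>M. ?t M k) * x ^ (2 * M) =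
      (\<Sum>k\<le>M. x ^ (Suc k * k) * ((x\<^sup>2) ^ (M - k) * qbinom x M k) * w ^ (M - k))"
    unfolding sum_distrib_right
  proof (intro sum.cong refl)
    fix k assume "k \<in> {..M}"
    hence "x ^ (Suc k * k) * ((x\<^sup>2) ^ (M - k) * qbinom x M k) * w ^ (M - k) =
        (x ^ (k * (k - 1)) * x ^ (2 * M)) * qbinom x M k * w ^ (M - k)"
      using e[of k] by (simp only: atMost_iff mult.assoc[symmetric])
    thus "?t M k * x ^ (2 * M) = x ^ (Suc k * k) * ((x\<^sup>2) ^ (M - k) * qbinom x M k) * w ^ (M - k)"
      by (simp only: mult_ac)
  qed
  also have "(w ^ Suc M + (\<Sum>k\<le>M. x ^ (Suc k * k) * qbinom x M (Suc k) * w ^ (M - k))) +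
       (\<Sum>k\<le>M. x ^ (Suc k * k) * ((x\<^sup>2) ^ (M - k) * qbinom x M k) * w ^ (M - k)) =
     w ^ Suc M + (\<Sum>k\<le>M. x ^ (Suc k * k) * qbinom x (Suc M) (Suc k) * w ^ (M - k))"
  proof -
    have "x ^ (Suc k * k) * qbinom x M (Suc k) * w ^ (M - k) +
        x ^ (Suc k * k) * ((x\<^sup>2) ^ (M - k) * qbinom x M k) * w ^ (M - k) =
        x ^ (Suc k * k) * qbinom x (Suc M) (Suc k) * w ^ (M - k)" if "k \<in> {..M}" for k
      using that by (simp only: qbinom_Suc[OF x] atMost_iff distrib_left distrib_right)
    thus ?thesis
      unfolding add.assoc sum.distrib[symmetric]
      by (intro arg_cong[where f = "(+) (w ^ Suc M)"] sum.cong refl)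
  qed
  also have "\<dots> = (\<Sum>k\<le>Suc M. ?t (Suc M) k)"
    by (simp only: sum.atMost_Suc_shift qbinom_0[OF x] diff_Suc_Suc diff_Suc_1) simp
  finally show ?case .
qed

lemma sum_atMost_double_centered:
  fixes f :: "nat \<Rightarrow> 'a :: comm_monoid_add"
  shows "(\<Sum>k\<le>2 * n. f k) = f n + (\<Sum>j<n. f (n + Suc j) + f (n - Suc j))"
proof (induction n arbitrary: f)
  case (Suc n)
  have "(\<Sum>k\<le>2 * Suc n. f k) = f 0 + (\<Sum>k\<le>2 * n. f (Suc k)) + f (2 * n + 2)"
    using sum.atMost_Suc_shift[of f "2 * n"] by (simp add: add_ac)
  also have "(\<Sum>k\<le>2 * n. f (Suc k)) = f (Suc n) + (\<Sum>j<n. f (Suc (n + Suc j)) + f (Suc (n - Suc j)))"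
    by (rule Suc)
  also have "(\<Sum>j<n. f (Suc (n + Suc j)) + f (Suc (n - Suc j))) =
      (\<Sum>j<n. f (Suc n + Suc j) + f (Suc n - Suc j))"
    by (intro sum.cong refl) (simp add: Suc_diff_Suc)
  finally show ?case by (simp add: add_ac mult_2)
qed simp

text \<open>The q-binomial theorem with M = 2n and w = x^(2n-1). After a power of x is taken out,
  the factors with j < n and those with j >= n give the same product of 1 + x^(2m+1), and the terms
  k = n + j and k = n - j agree. The common monomial Z is cancelled at the end.\<close>

lemma finite_triple_product:
  assumes x: "norm x < 1" "x \<noteq> 0" and n: "n > 0"
  shows "(\<Prod>m<n. 1 + x ^ (2 * m + 1)) ^ 2 =
     qbinom x (2 * n) n + 2 * (\<Sum>j<n. x ^ (Suc j)\<^sup>2 * qbinom x (2 * n) (n + Suc j))"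
proof -
  let ?w = "x ^ (2 * n - 1)"
  define Z where "Z = x ^ (n * (n - 1) + (2 * n - 1) * n)"
  have Z: "Z \<noteq> 0" using x by (simp add: Z_def)
  have "(\<Prod>j<2*n. ?w + x ^ (2 * j)) = (\<Prod>j<n. ?w + x ^ (2 * j)) * (\<Prod>j<n. ?w + x ^ (2 * (n + j)))"
    using prod.atLeastLessThan_concat[of 0 n "2*n" "\<lambda>j. ?w + x ^ (2 * j)"]
      prod.shift_bounds_nat_ivl[of "\<lambda>j. ?w + x ^ (2 * j)" 0 n n]
    by (simp add: atLeast0LessThan mult_2 add.commute)
  also have "(\<Prod>j<n. ?w + x ^ (2 * j)) = (\<Prod>j<n. ?w + x ^ (2 * (n - Suc j)))"
    by (rule prod.nat_diff_reindex[symmetric])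
  also have "\<dots> = (\<Prod>j<n. x ^ (2 * (n - Suc j)) * (1 + x ^ (2 * j + 1)))"
  proof (intro prod.cong refl)
    fix j assume "j \<in> {..<n}"
    hence "2 * n - 1 = 2 * (n - Suc j) + (2 * j + 1)" by auto
    thus "?w + x ^ (2 * (n - Suc j)) = x ^ (2 * (n - Suc j)) * (1 + x ^ (2 * j + 1))"
      by (simp only: distrib_left power_add mult_1_right mult_1_left mult_ac add_ac)
  qed
  also have "\<dots> = (\<Prod>j<n. x ^ (2 * (n - Suc j))) * (\<Prod>j<n. 1 + x ^ (2 * j + 1))"
    by (rule prod.distrib)
  also have "(\<Prod>j<n. x ^ (2 * (n - Suc j))) = (\<Prod>j<n. x ^ (2 * j))"
    by (rule prod.nat_diff_reindex)
  also have "\<dots> = x ^ (n * (n - 1))"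
  proof -
    have "(\<Sum>j<n. 2 * j) = n * (n - 1)"
    proof (induction n)
      case (Suc n) thus ?case by (cases n) auto
    qed simp
    thus ?thesis by (simp only: power_sum[symmetric])
  qed
  also have "(\<Prod>j<n. ?w + x ^ (2 * (n + j))) = (\<Prod>j<n. ?w * (1 + x ^ (2 * j + 1)))"
  proof (intro prod.cong refl)
    fix j
    have "2 * (n + j) = (2 * n - 1) + (2 * j + 1)" using n by auto
    thus "?w + x ^ (2 * (n + j)) = ?w * (1 + x ^ (2 * j + 1))"
      by (simp only: distrib_left power_add mult_1_right)
  qed
  also have "\<dots> = ?w ^ n * (\<Prod>j<n. 1 + x ^ (2 * j + 1))"
    by (simp only: prod.distrib prod_constant card_lessThan)
  finally have L: "(\<Prod>j<2*n. ?w + x ^ (2 * j)) = Z * (\<Prod>m<n. 1 + x ^ (2 * m + 1)) ^ 2"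
    by (simp only: Z_def power_add power_mult[symmetric] power2_eq_square mult_ac)
  let ?f = "\<lambda>k. x ^ (k * (k - 1)) * qbinom x (2 * n) k * ?w ^ (2 * n - k)"
  \<comment> \<open>\<open>e1\<close> and \<open>e2\<close> complete the square around k = n; the
    case distinctions keep the truncated differences exact.\<close>
  have e1: "(n + j) * (n + j - 1) + (2 * n - 1) * (n - j) = n * (n - 1) + (2 * n - 1) * n + j\<^sup>2"
    if le: "j \<le> n" for j
  proof (cases j)
    case 0 thus ?thesis by simp
  next
    case (Suc j')
    obtain i where "n = Suc j' + i" using le_Suc_ex[OF le] Suc by blast
    thus ?thesis using Suc by (simp add: algebra_simps power2_eq_square)
  qed
  have e2: "(n - j) * (n - j - 1) + (2 * n - 1) * (n + j) = n * (n - 1) + (2 * n - 1) * n + j\<^sup>2"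
    if le: "j \<le> n" for j
  proof -
    obtain i where i: "n = j + i" using le_Suc_ex[OF le] by blast
    show ?thesis
    proof (cases i)
      case 0
      then obtain j' where "j = Suc j'" using i n by (cases j) auto
      thus ?thesis using i 0 by (simp add: algebra_simps power2_eq_square)
    next
      case (Suc i')
      thus ?thesis using i by (simp add: algebra_simps power2_eq_square)
    qed
  qed
  have f1: "?f (n + j) = Z * (x ^ j\<^sup>2 * qbinom x (2 * n) (n + j))" if "j \<le> n" for j
  proof -
    have "2 * n - (n + j) = n - j" by simp
    hence "?f (n + j) = (x ^ ((n + j) * (n + j - 1)) * ?w ^ (n - j)) * qbinom x (2 * n) (n + j)"
      by (simp only: mult_ac)
    hence "?f (n + j) = x ^ ((n + j) * (n + j - 1) + (2 * n - 1) * (n - j)) * qbinom x (2 * n) (n + j)"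
      by (simp only: power_add power_mult)
    thus ?thesis unfolding e1[OF that] by (simp only: Z_def power_add mult_ac)
  qed
  have f2: "?f (n - j) = Z * (x ^ j\<^sup>2 * qbinom x (2 * n) (n + j))" if "j \<le> n" for j
  proof -
    have a: "2 * n - (n - j) = n + j" using that by simp
    have b: "qbinom x (2 * n) (n - j) = qbinom x (2 * n) (n + j)"
      using that by (simp add: qbinom_def a mult_2 mult.commute)
    have "?f (n - j) = (x ^ ((n - j) * (n - j - 1)) * ?w ^ (n + j)) * qbinom x (2 * n) (n + j)"
      unfolding a b by (simp only: mult_ac)
    hence "?f (n - j) = x ^ ((n - j) * (n - j - 1) + (2 * n - 1) * (n + j)) * qbinom x (2 * n) (n + j)"
      by (simp only: power_add power_mult)
    thus ?thesis unfolding e2[OF that] by (simp only: Z_def power_add mult_ac)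
  qed
  have "Z * (\<Prod>m<n. 1 + x ^ (2 * m + 1)) ^ 2 = (\<Sum>k\<le>2*n. ?f k)"
    unfolding L[symmetric] by (rule q_binomial_theorem[OF x(1)])
  also have "\<dots> = ?f n + (\<Sum>j<n. ?f (n + Suc j) + ?f (n - Suc j))"
    by (rule sum_atMost_double_centered)
  also have "?f n = Z * qbinom x (2 * n) n" using f1[of 0] by simp
  also have "(\<Sum>j<n. ?f (n + Suc j) + ?f (n - Suc j)) =
      (\<Sum>j<n. Z * (2 * (x ^ (Suc j)\<^sup>2 * qbinom x (2 * n) (n + Suc j))))"
  proof (intro sum.cong refl)
    fix j assume "j \<in> {..<n}"
    hence j: "Suc j \<le> n" by simp
    show "?f (n + Suc j) + ?f (n - Suc j) = Z * (2 * (x ^ (Suc j)\<^sup>2 * qbinom x (2 * n) (n + Suc j)))"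
      unfolding f1[OF j] f2[OF j] by simp
  qed
  also have "\<dots> = Z * (2 * (\<Sum>j<n. x ^ (Suc j)\<^sup>2 * qbinom x (2 * n) (n + Suc j)))"
    by (simp only: sum_distrib_left)
  finally have "Z * (\<Prod>m<n. 1 + x ^ (2 * m + 1)) ^ 2 =
    Z * (qbinom x (2 * n) n + 2 * (\<Sum>j<n. x ^ (Suc j)\<^sup>2 * qbinom x (2 * n) (n + Suc j)))"
    by (simp only: distrib_left)
  with Z show ?thesis by (simp only: mult_cancel_left) simp
qed

lemma qpoch_LIMSEQ: "norm x < 1 \<Longrightarrow> qpoch x \<longlonglongrightarrow> euler_prod (x\<^sup>2)"
  unfolding qpoch_def using euler_prod_LIMSEQ[OF norm_square_less_1] .

lemma summable_square_powers:
  assumes "norm (x :: complex) < 1"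
  shows "summable (\<lambda>j. norm (x ^ (Suc j)\<^sup>2))"
proof (rule summable_comparison_test)
  have "norm (norm (x ^ (Suc j)\<^sup>2)) \<le> norm x ^ j" for j
  proof -
    have "norm x ^ (Suc j)\<^sup>2 \<le> norm x ^ j"
      using assms by (intro power_decreasing) (auto simp: power2_eq_square)
    thus ?thesis by (simp add: norm_power)
  qed
  thus "\<exists>N. \<forall>j\<ge>N. norm (norm (x ^ (Suc j)\<^sup>2)) \<le> norm x ^ j" by blast
  show "summable (\<lambda>j. norm x ^ j)" using assms by (simp add: summable_geometric)
qed

text \<open>The limit of the finite identity, exchanged with the sum by Tannery's theorem: the
  Gaussian binomials are uniformly bounded, since \<open>qpoch\<close> converges to a nonzero limit,
  and tend to the reciprocal of Euler's product at x^2.\<close>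

theorem triple_product:
  assumes x: "norm x < 1" "x \<noteq> 0"
  shows "1 + 2 * (\<Sum>j. x ^ (Suc j)\<^sup>2) = euler_prod (- x) ^ 2 / euler_prod (x\<^sup>2)"
proof -
  define E where "E = euler_prod (x\<^sup>2)"
  have E: "E \<noteq> 0" unfolding E_def by (rule euler_prod_nonzero[OF norm_square_less_1[OF x(1)]])
  note P = qpoch_LIMSEQ[OF x(1), folded E_def]
  have "(\<lambda>n. inverse (qpoch x n)) \<longlonglongrightarrow> inverse E" by (rule tendsto_inverse[OF P E])
  then obtain B1 where B1: "\<And>n. norm (inverse (qpoch x n)) \<le> B1" "B1 > 0"
    using Bseq_def convergent_imp_Bseq convergentI by metis
  obtain B2 where B2: "\<And>n. norm (qpoch x n) \<le> B2" "B2 > 0"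
    using P Bseq_def convergent_imp_Bseq convergentI by metis
  \<comment> \<open>Filling up with zeros turns the finite sums into series over a fixed index set,
    the form that Tannery's theorem needs.\<close>
  define a where "a = (\<lambda>j n. if j < n then x ^ (Suc j)\<^sup>2 * qbinom x (2 * n) (n + Suc j) else 0)"
  have qb: "qbinom x (2 * n) (n + j) = qpoch x (2 * n) * inverse (qpoch x (n + j)) * inverse (qpoch x (n - j))" if "j \<le> n" for n j
    using that by (simp add: qbinom_def divide_inverse mult_2)
  have sh: "(\<lambda>n. qpoch x (2 * n) * inverse (qpoch x (n + j)) * inverse (qpoch x (n - j))) \<longlonglongrightarrow> E * inverse E * inverse E" for j
  proof (intro tendsto_mult tendsto_inverse E)
    show "(\<lambda>n. qpoch x (2 * n)) \<longlonglongrightarrow> E"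
      by (rule filterlim_compose[OF P]) (auto intro!: filterlim_subseq simp: strict_mono_def)
    show "(\<lambda>n. qpoch x (n + j)) \<longlonglongrightarrow> E" using P by (rule LIMSEQ_ignore_initial_segment)
    show "(\<lambda>n. qpoch x (n - j)) \<longlonglongrightarrow> E"
      by (rule filterlim_compose[OF P filterlim_minus_const_nat_at_top])
  qed
  have "((\<lambda>n. suminf (\<lambda>j. a j n)) \<longlongrightarrow> suminf (\<lambda>j. x ^ (Suc j)\<^sup>2 * inverse E)) sequentially"
  proof (rule tannerys_theorem[THEN conjunct2, THEN conjunct2])
    fix j
    have "(\<lambda>n. x ^ (Suc j)\<^sup>2 * (qpoch x (2 * n) * inverse (qpoch x (n + Suc j)) * inverse (qpoch x (n - Suc j)))) \<longlonglongrightarrow>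
        x ^ (Suc j)\<^sup>2 * (E * inverse E * inverse E)"
      by (intro tendsto_mult tendsto_const sh)
    moreover have "\<forall>\<^sub>F n in sequentially. x ^ (Suc j)\<^sup>2 * (qpoch x (2 * n) * inverse (qpoch x (n + Suc j)) * inverse (qpoch x (n - Suc j))) = a j n"
      using eventually_gt_at_top[of j] by eventually_elim (simp only: a_def if_True qb[OF Suc_leI])
    ultimately have "(\<lambda>n. a j n) \<longlonglongrightarrow> x ^ (Suc j)\<^sup>2 * (E * inverse E * inverse E)"
      by (rule Lim_transform_eventually)
    thus "(\<lambda>n. a j n) \<longlonglongrightarrow> x ^ (Suc j)\<^sup>2 * inverse E" using E by simp
  next
    have "norm (a j n) \<le> norm (x ^ (Suc j)\<^sup>2) * (B2 * B1 * B1)" for j n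
    proof (cases "j < n")
      case True
      have "norm (qpoch x (2 * n) * inverse (qpoch x (n + Suc j)) * inverse (qpoch x (n - Suc j))) \<le> B2 * B1 * B1"
        unfolding norm_mult using B1 B2 by (intro mult_mono) (auto intro: order.strict_implies_order)
      hence "norm (x ^ (Suc j)\<^sup>2) * norm (qpoch x (2 * n) * inverse (qpoch x (n + Suc j)) * inverse (qpoch x (n - Suc j)))
          \<le> norm (x ^ (Suc j)\<^sup>2) * (B2 * B1 * B1)" by (rule mult_left_mono) simp
      thus ?thesis using True by (simp only: a_def if_True qb[OF Suc_leI] norm_mult)
    next
      case False thus ?thesis using B1 B2 by (simp add: a_def)
    qed
    thus "\<forall>\<^sub>F (j, n) in sequentially \<times>\<^sub>F sequentially. norm (a j n) \<le> norm (x ^ (Suc j)\<^sup>2) * (B2 * B1 * B1)"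
      by (intro always_eventually) auto
    show "summable (\<lambda>j. norm (x ^ (Suc j)\<^sup>2) * (B2 * B1 * B1))"
      by (intro summable_mult2 summable_square_powers x)
  qed simp
  moreover have "suminf (\<lambda>j. x ^ (Suc j)\<^sup>2 * inverse E) = (\<Sum>j. x ^ (Suc j)\<^sup>2) * inverse E"
    by (rule suminf_mult2[symmetric, OF summable_norm_cancel[OF summable_square_powers[OF x(1)]]])
  moreover have "suminf (\<lambda>j. a j n) = (\<Sum>j<n. x ^ (Suc j)\<^sup>2 * qbinom x (2 * n) (n + Suc j))" for n
    by (subst suminf_finite[of "{..<n}"]) (auto simp: a_def)
  ultimately have s: "(\<lambda>n. \<Sum>j<n. x ^ (Suc j)\<^sup>2 * qbinom x (2 * n) (n + Suc j)) \<longlonglongrightarrow> (\<Sum>j. x ^ (Suc j)\<^sup>2) * inverse E"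
    by simp
  have "(\<lambda>n. qbinom x (2 * n) n) \<longlonglongrightarrow> E * inverse E * inverse E"
    using sh[of 0] qb[of 0] by simp
  hence "(\<lambda>n. qbinom x (2 * n) n + 2 * (\<Sum>j<n. x ^ (Suc j)\<^sup>2 * qbinom x (2 * n) (n + Suc j))) \<longlonglongrightarrow>
      E * inverse E * inverse E + 2 * ((\<Sum>j. x ^ (Suc j)\<^sup>2) * inverse E)"
    by (intro tendsto_add tendsto_mult tendsto_const s)
  moreover have "\<forall>\<^sub>F n in sequentially. qbinom x (2 * n) n + 2 * (\<Sum>j<n. x ^ (Suc j)\<^sup>2 * qbinom x (2 * n) (n + Suc j)) =
      (\<Prod>m<n. 1 + x ^ (2 * m + 1)) ^ 2"
    using eventually_gt_at_top[of 0] by eventually_elim (simp only: finite_triple_product[OF x])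
  ultimately have 1: "(\<lambda>n. (\<Prod>m<n. 1 + x ^ (2 * m + 1)) ^ 2) \<longlonglongrightarrow>
      E * inverse E * inverse E + 2 * ((\<Sum>j. x ^ (Suc j)\<^sup>2) * inverse E)"
    by (rule Lim_transform_eventually)
  have "(\<lambda>n. (\<Prod>m<n. 1 - (- x) ^ (2 * m + 1)) ^ 2) \<longlonglongrightarrow> (euler_prod (- x) / euler_prod ((- x)\<^sup>2)) ^ 2"
    using x by (intro tendsto_power euler_prod_split) simp
  moreover have "(- x) ^ (2 * m + 1) = - (x ^ (2 * m + 1))" for m by (rule power_minus_odd) simp
  ultimately have "(\<lambda>n. (\<Prod>m<n. 1 + x ^ (2 * m + 1)) ^ 2) \<longlonglongrightarrow> (euler_prod (- x) / E) ^ 2"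
    by (simp add: E_def)
  from LIMSEQ_unique[OF 1 this]
  have "E * (E * inverse E * inverse E + 2 * ((\<Sum>j. x ^ (Suc j)\<^sup>2) * inverse E)) = E * (euler_prod (- x) / E) ^ 2"
    by simp
  moreover have "E * (E * inverse E * inverse E + 2 * ((\<Sum>j. x ^ (Suc j)\<^sup>2) * inverse E)) = 1 + 2 * (\<Sum>j. x ^ (Suc j)\<^sup>2)"
    using E by (simp add: distrib_left)
  moreover have "E * (euler_prod (- x) / E) ^ 2 = euler_prod (- x) ^ 2 / E"
    using E by (simp add: power2_eq_square)
  ultimately show ?thesis by (simp only: E_def)
qed

definition jacobi_theta :: "complex \<Rightarrow> complex" where
  "jacobi_theta z = (\<Sum>\<^sub>\<infinity>n::int. exp (of_real pi * \<i> * z * (of_int n)\<^sup>2))"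

lemma exp_square_eq_power:
  "exp (of_real pi * \<i> * z * (of_int n)\<^sup>2) = exp (of_real pi * \<i> * z) ^ (nat \<bar>n\<bar>)\<^sup>2"
proof -
  have "(of_int n :: complex)\<^sup>2 = of_nat ((nat \<bar>n\<bar>)\<^sup>2)"
    by (cases "n \<ge> 0") (auto simp: of_nat_nat)
  hence "of_real pi * \<i> * z * (of_int n)\<^sup>2 = of_nat ((nat \<bar>n\<bar>)\<^sup>2) * (of_real pi * \<i> * z)"
    by (simp only: mult.commute)
  thus ?thesis by (simp only: exp_of_nat_mult)
qed

lemma jacobi_theta_abs_summable:
  assumes z: "z \<in> upper_half_plane"
  shows "(\<lambda>n::int. norm (exp (of_real pi * \<i> * z * (of_int n)\<^sup>2))) summable_on UNIV"
proof (rule summable_on_int_split)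
  let ?x = "exp (of_real pi * \<i> * z)"
  have x: "norm ?x < 1" by (rule norm_exp_ii_upper_simps[OF z])
  note s = summable_square_powers[OF x]
  have "summable (\<lambda>k. norm (?x ^ k\<^sup>2))"
    using s by (subst summable_Suc_iff[symmetric])
  hence "summable (\<lambda>k. norm (?x ^ (nat \<bar>int k\<bar>)\<^sup>2))" by simp
  thus "(\<lambda>k. norm (exp (of_real pi * \<i> * z * (of_int (int k))\<^sup>2))) summable_on UNIV"
    unfolding exp_square_eq_power by (intro norm_summable_imp_summable_on) simp
  have nk: "nat \<bar>- int k - 1\<bar> = Suc k" for k by simp
  thus "(\<lambda>k. norm (exp (of_real pi * \<i> * z * (of_int (- int k - 1))\<^sup>2))) summable_on UNIV"
    unfolding exp_square_eq_power nk using s by (intro norm_summable_imp_summable_on) (simp only: real_norm_def abs_norm_cancel)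
qed

text \<open>Both \<open>eta\<close> values belong to the Euler products at -x and x^2 with x =
  exp(pi i z); with z + 1 in the denominator their exponential prefactors cancel exactly.\<close>

theorem jacobi_theta_eq_eta:
  assumes z: "z \<in> upper_half_plane"
  shows "jacobi_theta z = eta ((z + 1) / 2) ^ 2 / eta (z + 1)"
proof -
  define x where "x = exp (of_real pi * \<i> * z)"
  have x: "norm x < 1" "x \<noteq> 0" using norm_exp_ii_upper_simps[OF z] by (simp_all add: x_def)
  let ?T = "\<lambda>n::int. exp (of_real pi * \<i> * z * (of_int n)\<^sup>2)"
  have S: "?T summable_on UNIV" by (rule abs_summable_summable[OF jacobi_theta_abs_summable[OF z]])
  have S': "?T summable_on - {0}" by (rule summable_on_subset_banach[OF S]) simp
  have "(\<lambda>j. ?T (int (Suc j)) + ?T (- int (Suc j))) sums infsum ?T (- {0})"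
    by (rule has_sum_int_nonzero_imp_sums[OF has_sum_infsum[OF S']])
  moreover have "?T (int (Suc j)) + ?T (- int (Suc j)) = 2 * x ^ (Suc j)\<^sup>2" for j
    unfolding exp_square_eq_power x_def by (simp del: power_Suc of_nat_Suc add: nat_int)
  ultimately have "infsum ?T (- {0}) = 2 * (\<Sum>j. x ^ (Suc j)\<^sup>2)"
    using suminf_mult[OF summable_norm_cancel[OF summable_square_powers[OF x(1)]], of 2]
    by (simp add: sums_iff)
  moreover have "infsum ?T UNIV = infsum ?T {0} + infsum ?T (- {0})"
    using infsum_Un_disjoint[of ?T "{0}" "- {0}"] S' by simp
  ultimately have "jacobi_theta z = euler_prod (- x) ^ 2 / euler_prod (x\<^sup>2)"
    using triple_product[OF x] by (simp add: jacobi_theta_def)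
  moreover have "eta ((z + 1) / 2) = exp (of_real pi * \<i> * (z + 1) / 24) * euler_prod (- x)"
  proof -
    have "2 * of_real pi * \<i> * ((z + 1) / 2) = of_real pi * \<i> * z + of_real pi * \<i>"
      by (simp add: algebra_simps)
    hence "exp (2 * of_real pi * \<i> * ((z + 1) / 2)) = - x"
      by (simp only: exp_add exp_pi_i x_def) simp
    thus ?thesis by (simp add: eta_eq_euler_prod)
  qed
  moreover have "eta (z + 1) = exp (of_real pi * \<i> * (z + 1) / 12) * euler_prod (x\<^sup>2)"
  proof -
    have "exp (2 * of_real pi * \<i> * (z + 1)) = exp (2 * of_real pi * \<i> * z) * exp (2 * of_real pi * \<i>)"
      by (simp only: distrib_left exp_add mult_1_right)
    also have "\<dots> = x\<^sup>2"
      unfolding x_def using exp_of_nat_mult[of 2 "of_real pi * \<i> * z"] exp_two_pi_i by (simp add: mult_ac)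
    finally show ?thesis by (simp add: eta_eq_euler_prod)
  qed
  moreover have "exp (of_real pi * \<i> * (z + 1) / 24) ^ 2 = exp (of_real pi * \<i> * (z + 1) / 12)"
    unfolding exp_double[symmetric] by (rule arg_cong[where f = exp]) (simp add: field_simps)
  ultimately show ?thesis by (simp add: power_mult_distrib)
qed

section \<open>Transformation laws under the theta group\<close>

section \<open>Matrices of size two and the factor of automorphy\<close>

lemma mat2_nth [simp]:
  "mat2 a b c d $ 1 $ 1 = a" "mat2 a b c d $ 1 $ 2 = b" "mat2 a b c d $ 2 $ 1 = c" "mat2 a b c d $ 2 $ 2 = d"
  by (simp_all add: mat2_def)

lemma mat2_eta: "mat2 (A$1$1) (A$1$2) (A$2$1) (A$2$2) = A"
  by (simp add: vec_eq_iff forall_2)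

lemma mat2_eq_iff: "mat2 a b c d = mat2 a' b' c' d' \<longleftrightarrow> a = a' \<and> b = b' \<and> c = c' \<and> d = d'"
  by (auto simp: vec_eq_iff forall_2)

lemma mat2_mult: "mat2 a b c d ** mat2 a' b' c' d' =
    mat2 (a * a' + b * c') (a * b' + b * d') (c * a' + d * c') (c * b' + d * d')"
  by (simp add: vec_eq_iff forall_2 matrix_matrix_mult_def sum_2)

lemma det_mat2: "det (mat2 a b c d) = a * d - b * c"
  by (simp add: det_2)

lemma mat_1_eq_mat2: "mat 1 = mat2 1 0 0 1"
  by (simp add: vec_eq_iff forall_2 mat_def)

lemma scaleR_mat2: "r *\<^sub>R mat2 a b c d = mat2 (r * a) (r * b) (r * c) (r * d)"
  by (simp add: vec_eq_iff forall_2)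

text \<open>The factor of automorphy before the power is taken: it satisfies the cocycle identity
  exactly, \<open>aut_factor\<close> only up to constants.\<close>

definition jac :: "real^2^2 \<Rightarrow> complex \<Rightarrow> complex" where
  "jac A z = of_real (A$2$1) * z + of_real (A$2$2)"

lemma aut_factor_jac: "aut_factor w A z = jac A z powr of_real w"
  by (simp add: aut_factor_def jac_def)

lemma jac_mat2: "jac (mat2 a b c d) z = of_real c * z + of_real d"
  by (simp add: jac_def)

lemma act_mat2: "act (mat2 a b c d) z = (of_real a * z + of_real b) / (of_real c * z + of_real d)"
  by (simp add: act_def moebius_def)

lemma real_comb_nonzero:
  assumes "z \<in> upper_half_plane" "c \<noteq> 0 \<or> d \<noteq> 0"
  shows "of_real c * z + of_real d \<noteq> 0"
proof
  assume "of_real c * z + of_real d = 0"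
  hence "Im (of_real c * z + of_real d) = 0" "Re (of_real c * z + of_real d) = 0" by simp_all
  thus False using assms by (auto simp: upper_half_plane_def)
qed

lemma det_nonzero_row: "det (A :: real^2^2) \<noteq> 0 \<Longrightarrow> A$2$1 \<noteq> 0 \<or> A$2$2 \<noteq> 0"
  by (auto simp: det_2)

lemma jac_nonzero: "z \<in> upper_half_plane \<Longrightarrow> det A \<noteq> 0 \<Longrightarrow> jac A z \<noteq> 0"
  unfolding jac_def by (intro real_comb_nonzero det_nonzero_row)

lemma aut_factor_nonzero: "z \<in> upper_half_plane \<Longrightarrow> det A \<noteq> 0 \<Longrightarrow> aut_factor w A z \<noteq> 0"
  by (simp add: aut_factor_jac jac_nonzero)

lemma Im_act:
  assumes z: "z \<in> upper_half_plane" and A: "det A \<noteq> 0"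
  shows "Im (act A z) = det A * Im z / (norm (jac A z))\<^sup>2"
proof -
  have j: "jac A z \<noteq> 0" using jac_nonzero[OF z A] .
  have "act A z = (of_real (A$1$1) * z + of_real (A$1$2)) / jac A z"
    by (simp add: act_def moebius_def jac_def)
  hence "act A z = (of_real (A$1$1) * z + of_real (A$1$2)) * cnj (jac A z) / (norm (jac A z))\<^sup>2"
    using complex_div_cnj by metis
  hence "Im (act A z) = Im ((of_real (A$1$1) * z + of_real (A$1$2)) * cnj (jac A z)) / (norm (jac A z))\<^sup>2"
    by (metis Im_complex_of_real Im_divide_of_real of_real_power)
  also have "Im ((of_real (A$1$1) * z + of_real (A$1$2)) * cnj (jac A z)) = det A * Im z"
    by (simp add: jac_def det_2 algebra_simps)
  finally show ?thesis .
qed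

lemma act_in_upper: "z \<in> upper_half_plane \<Longrightarrow> det A > 0 \<Longrightarrow> act A z \<in> upper_half_plane"
  using Im_act[of z A] jac_nonzero[of z A] by (simp add: upper_half_plane_def)

lemma jac_mult:
  assumes "z \<in> upper_half_plane" "det B \<noteq> 0"
  shows "jac (A ** B) z = jac A (act B z) * jac B z"
proof -
  have "jac B z \<noteq> 0" by (rule jac_nonzero[OF assms])
  thus ?thesis
    by (simp add: jac_def act_def moebius_def matrix_matrix_mult_def sum_2 field_simps)
qed

lemma act_mult:
  assumes z: "z \<in> upper_half_plane" "det A > 0" "det B > 0"
  shows "act (A ** B) z = act A (act B z)"
proof -
  have 1: "jac B z \<noteq> 0" using assms by (intro jac_nonzero) auto
  have 2: "jac A (act B z) \<noteq> 0" using assms by (intro jac_nonzero act_in_upper) auto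
  have "act (A ** B) z = (of_real ((A ** B)$1$1) * z + of_real ((A ** B)$1$2)) / jac (A ** B) z"
    by (simp add: act_def moebius_def jac_def)
  also have "of_real ((A ** B)$1$1) * z + of_real ((A ** B)$1$2) =
      (of_real (A$1$1) * act B z + of_real (A$1$2)) * jac B z"
    using 1 by (simp add: jac_def act_def moebius_def matrix_matrix_mult_def sum_2 field_simps)
  also have "jac (A ** B) z = jac A (act B z) * jac B z"
    using assms by (intro jac_mult) auto
  also have "(of_real (A$1$1) * act B z + of_real (A$1$2)) * jac B z / (jac A (act B z) * jac B z) = act A (act B z)"
    using 1 by (simp add: act_def[of A] moebius_def jac_def[of A])
  finally show ?thesis .
qed

lemma act_mat_1 [simp]: "act (mat 1) z = z"
  by (simp add: mat_1_eq_mat2 act_mat2)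

lemma jac_mat_1 [simp]: "jac (mat 1) z = 1"
  by (simp add: mat_1_eq_mat2 jac_mat2)

lemma act_scaleR: "r \<noteq> 0 \<Longrightarrow> act (r *\<^sub>R A) z = act A z"
  by (simp add: act_def moebius_def mult.assoc distrib_left[symmetric])

lemma jac_scaleR: "jac (r *\<^sub>R A) z = of_real r * jac A z"
  by (simp add: jac_def algebra_simps)

lemma act_uminus: "act (- A) z = act A z"
  using act_scaleR[of "-1" A z] by simp

lemma det_scaleR_2: "det (r *\<^sub>R A :: real^2^2) = r\<^sup>2 * det A"
  by (simp add: det_2 power2_eq_square algebra_simps)

lemma powr_of_real_mult:
  fixes z :: complex
  assumes "r > 0" "z \<noteq> 0"
  shows "(of_real r * z) powr w = of_real r powr w * z powr w"
  using assms by (simp add: powr_def Ln_times_of_real Ln_of_real distrib_left exp_add)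

lemma continuous_on_act:
  assumes "det A > 0"
  shows "continuous_on upper_half_plane (act A)"
  unfolding act_def moebius_def using assms det_nonzero_row[of A]
  by (intro continuous_intros ballI real_comb_nonzero) auto

text \<open>If the lower left entry is nonzero, \<open>jac\<close> has nonzero imaginary part and
  avoids the cut; otherwise it is constant and may even lie on the cut.\<close>

lemma continuous_on_Ln_jac:
  assumes "det A \<noteq> 0"
  shows "continuous_on upper_half_plane (\<lambda>z. Ln (jac A z))"
proof (cases "A$2$1 = 0")
  case True thus ?thesis by (simp add: jac_def)
next
  case False
  have "jac A z \<notin> \<real>\<^sub>\<le>\<^sub>0" if "z \<in> upper_half_plane" for z
    using that False by (auto simp: jac_def complex_nonpos_Reals_iff upper_half_plane_def)
  thus ?thesis by (intro continuous_intros) (auto simp: jac_def intro!: continuous_intros)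
qed

text \<open>The principal branch turns the cocycle identity of \<open>jac\<close> into one up to a constant:
  the defect of the logarithms is continuous with values in \<open>2\<pi>i\<int>\<close>.\<close>

lemma aut_factor_mult:
  assumes A: "det A > 0" and B: "det B > 0"
  obtains \<kappa> where "\<kappa> \<noteq> 0"
    "\<And>z. z \<in> upper_half_plane \<Longrightarrow> aut_factor w A (act B z) * aut_factor w B z = \<kappa> * aut_factor w (A ** B) z"
proof -
  let ?u = "\<lambda>z. Ln (jac A (act B z)) + Ln (jac B z) - Ln (jac (A ** B) z)"
  have AB: "det (A ** B) > 0" using A B by (simp add: det_mul)
  have cont: "continuous_on upper_half_plane ?u"
  proof (intro continuous_on_add continuous_on_diff)
    show "continuous_on upper_half_plane (\<lambda>z. Ln (jac A (act B z)))"
      using continuous_on_compose2[OF continuous_on_Ln_jac[of A] continuous_on_act[OF B]] A act_in_upper[OF _ B]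
      by auto
  qed (use A B AB in \<open>auto intro!: continuous_on_Ln_jac\<close>)
  have nz: "jac A (act B z) \<noteq> 0" "jac B z \<noteq> 0" "jac (A ** B) z \<noteq> 0" if "z \<in> upper_half_plane" for z
    using that A B AB act_in_upper[OF that B] jac_nonzero[of _ A] jac_nonzero[of _ B] jac_nonzero[of _ "A ** B"]
    by auto
  have e: "exp (?u z) = 1" if z: "z \<in> upper_half_plane" for z
    using nz[OF z] jac_mult[OF z, of B A] B by (simp add: exp_add exp_diff)
  have "?u constant_on upper_half_plane"
  proof (rule continuous_discrete_range_constant[OF connected_upper_half_plane cont])
    fix x assume x: "x \<in> upper_half_plane"
    have "2 * pi \<le> norm (?u y - ?u x)" if y: "y \<in> upper_half_plane" "?u y \<noteq> ?u x" for y
    proof -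
      have "exp (?u y - ?u x) = 1" using e[OF x] e[OF y(1)] by (simp add: exp_diff)
      then obtain n :: int where n: "Re (?u y - ?u x) = 0" "Im (?u y - ?u x) = of_int (2 * n) * pi"
        unfolding exp_eq_1 by blast
      have "n \<noteq> 0"
      proof
        assume "n = 0"
        hence "?u y - ?u x = 0" using n by (intro complex_eqI) simp_all
        thus False using y by simp
      qed
      hence "1 \<le> \<bar>real_of_int n\<bar>" by linarith
      hence "2 * pi * 1 \<le> 2 * pi * \<bar>real_of_int n\<bar>" by (intro mult_left_mono) auto
      also have "\<dots> = \<bar>Im (?u y - ?u x)\<bar>" unfolding n(2) by (simp add: abs_mult)
      also have "\<dots> \<le> norm (?u y - ?u x)" by (rule abs_Im_le_cmod)
      finally show ?thesis by simp
    qed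
    thus "\<exists>e>0. \<forall>y. y \<in> upper_half_plane \<and> ?u y \<noteq> ?u x \<longrightarrow> e \<le> norm (?u y - ?u x)"
      by (intro exI[of _ "2 * pi"]) auto
  qed
  then obtain u0 where u0: "\<And>z. z \<in> upper_half_plane \<Longrightarrow> ?u z = u0"
    unfolding constant_on_def by blast
  show thesis
  proof (rule that[of "exp (of_real w * u0)"])
    fix z assume z: "z \<in> upper_half_plane"
    have "Ln (jac A (act B z)) + Ln (jac B z) = u0 + Ln (jac (A ** B) z)"
      using u0[OF z] by (simp add: algebra_simps)
    hence "exp (of_real w * (Ln (jac A (act B z)) + Ln (jac B z))) = exp (of_real w * (u0 + Ln (jac (A ** B) z)))"
      by (simp only:)
    thus "aut_factor w A (act B z) * aut_factor w B z = exp (of_real w * u0) * aut_factor w (A ** B) z"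
      using nz[OF z] by (simp add: aut_factor_jac powr_def distrib_left exp_add)
  qed simp
qed

text \<open>The free constant absorbs both multiplier and branch defect, so the relation is closed
  under products and inverses. Two functions are allowed since an Atkin-Lehner matrix permutes the
  factors of \<open>g1\<close> rather than fixing each.\<close>

definition transf :: "real \<Rightarrow> (complex \<Rightarrow> complex) \<Rightarrow> real^2^2 \<Rightarrow> (complex \<Rightarrow> complex) \<Rightarrow> bool" where
  "transf w f A g \<longleftrightarrow> (\<exists>\<kappa>. \<kappa> \<noteq> 0 \<and> (\<forall>z\<in>upper_half_plane. f (act A z) = \<kappa> * aut_factor w A z * g z))"

lemma transfI:
  assumes "\<kappa> \<noteq> 0" "\<And>z. z \<in> upper_half_plane \<Longrightarrow> f (act A z) = \<kappa> * aut_factor w A z * g z"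
  shows "transf w f A g"
  using assms unfolding transf_def by blast

lemma transf_mult:
  assumes "transf w f A g" "transf w g B h" and A: "det A > 0" and B: "det B > 0"
  shows "transf w f (A ** B) h"
proof -
  obtain \<alpha> where \<alpha>: "\<alpha> \<noteq> 0" "\<And>z. z \<in> upper_half_plane \<Longrightarrow> f (act A z) = \<alpha> * aut_factor w A z * g z"
    using assms(1) unfolding transf_def by blast
  obtain \<beta> where \<beta>: "\<beta> \<noteq> 0" "\<And>z. z \<in> upper_half_plane \<Longrightarrow> g (act B z) = \<beta> * aut_factor w B z * h z"
    using assms(2) unfolding transf_def by blast
  obtain \<kappa> where \<kappa>: "\<kappa> \<noteq> 0" "\<And>z. z \<in> upper_half_plane \<Longrightarrow>
      aut_factor w A (act B z) * aut_factor w B z = \<kappa> * aut_factor w (A ** B) z"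
    using aut_factor_mult[OF A B] by blast
  show ?thesis
  proof (rule transfI[of "\<alpha> * \<beta> * \<kappa>"])
    fix z assume z: "z \<in> upper_half_plane"
    have "f (act (A ** B) z) = \<alpha> * aut_factor w A (act B z) * (\<beta> * aut_factor w B z * h z)"
      using act_mult[OF z A B] \<alpha>(2)[OF act_in_upper[OF z B]] \<beta>(2)[OF z] by simp
    also have "\<dots> = \<alpha> * \<beta> * (aut_factor w A (act B z) * aut_factor w B z) * h z" by (simp only: mult_ac)
    finally show "f (act (A ** B) z) = \<alpha> * \<beta> * \<kappa> * aut_factor w (A ** B) z * h z"
      unfolding \<kappa>(2)[OF z] by (simp only: mult_ac)
  qed (use \<alpha> \<beta> \<kappa> in auto)
qed

lemma transf_inverse:
  assumes "transf w f A g" and A: "det A > 0" and B: "det B > 0" and AB: "A ** B = mat 1"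
  shows "transf w g B f"
proof -
  obtain \<alpha> where \<alpha>: "\<alpha> \<noteq> 0" "\<And>z. z \<in> upper_half_plane \<Longrightarrow> f (act A z) = \<alpha> * aut_factor w A z * g z"
    using assms(1) unfolding transf_def by blast
  obtain \<kappa> where \<kappa>: "\<kappa> \<noteq> 0" "\<And>z. z \<in> upper_half_plane \<Longrightarrow>
      aut_factor w A (act B z) * aut_factor w B z = \<kappa> * aut_factor w (A ** B) z"
    using aut_factor_mult[OF A B] by blast
  show ?thesis
  proof (rule transfI[of "1 / (\<alpha> * \<kappa>)"])
    fix z assume z: "z \<in> upper_half_plane"
    have "f z = \<alpha> * aut_factor w A (act B z) * g (act B z)"
      using act_mult[OF z A B] \<alpha>(2)[OF act_in_upper[OF z B]] AB by simp
    hence "f z * aut_factor w B z = \<alpha> * (aut_factor w A (act B z) * aut_factor w B z) * g (act B z)"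
      by (simp only: mult_ac)
    hence "f z * aut_factor w B z = \<alpha> * \<kappa> * g (act B z)"
      unfolding \<kappa>(2)[OF z] AB by (simp add: aut_factor_jac)
    thus "g (act B z) = 1 / (\<alpha> * \<kappa>) * aut_factor w B z * f z"
      using \<alpha>(1) \<kappa>(1) by (simp add: field_simps)
  qed (use \<alpha> \<kappa> in auto)
qed

lemma aut_factor_add: "aut_factor (v + w) A z = aut_factor v A z * aut_factor w A z"
  by (simp add: aut_factor_def powr_add)

lemma aut_factor_0: "z \<in> upper_half_plane \<Longrightarrow> det A \<noteq> 0 \<Longrightarrow> aut_factor 0 A z = 1"
  using jac_nonzero by (simp add: aut_factor_jac powr_def)

lemma transf_prod:
  assumes "finite I" "\<And>i. i \<in> I \<Longrightarrow> transf w (f i) A (g i)" "det A \<noteq> 0"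
  shows "transf (real (card I) * w) (\<lambda>z. \<Prod>i\<in>I. f i z) A (\<lambda>z. \<Prod>i\<in>I. g i z)"
  using assms(1,2)
proof (induction I rule: finite_induct)
  case empty
  show ?case using aut_factor_0[OF _ assms(3)] by (intro transfI[of 1]) auto
next
  case (insert i I)
  obtain \<alpha> where \<alpha>: "\<alpha> \<noteq> 0" "\<And>z. z \<in> upper_half_plane \<Longrightarrow> f i (act A z) = \<alpha> * aut_factor w A z * g i z"
    using insert.prems[of i] unfolding transf_def by blast
  have "transf (real (card I) * w) (\<lambda>z. \<Prod>i\<in>I. f i z) A (\<lambda>z. \<Prod>i\<in>I. g i z)"
    using insert by blast
  then obtain \<beta> where \<beta>: "\<beta> \<noteq> 0" "\<And>z. z \<in> upper_half_plane \<Longrightarrow>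
      (\<Prod>i\<in>I. f i (act A z)) = \<beta> * aut_factor (real (card I) * w) A z * (\<Prod>i\<in>I. g i z)"
    unfolding transf_def by blast
  have w: "real (card (insert i I)) * w = w + real (card I) * w"
    using insert by (simp add: distrib_right)
  show ?case unfolding w
  proof (rule transfI[of "\<alpha> * \<beta>"])
    fix z assume z: "z \<in> upper_half_plane"
    show "(\<Prod>i\<in>insert i I. f i (act A z)) = \<alpha> * \<beta> * aut_factor (w + real (card I) * w) A z * (\<Prod>i\<in>insert i I. g i z)"
      using insert \<alpha>(2)[OF z] \<beta>(2)[OF z] by (simp add: aut_factor_add mult_ac)
  qed (use \<alpha> \<beta> in auto)
qed

section \<open>The theta group\<close>

text \<open>The rules are left multiplication by (0, -1; 1, 0), by (1, 2; 0, 1) and by the inverse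
  of the latter, so transformation laws follow from the generators by rule induction.\<close>

inductive theta_group :: "int \<Rightarrow> int \<Rightarrow> int \<Rightarrow> int \<Rightarrow> bool" where
  one: "theta_group 1 0 0 1"
| S: "theta_group a b c d \<Longrightarrow> theta_group (- c) (- d) a b"
| T: "theta_group a b c d \<Longrightarrow> theta_group (a + 2 * c) (b + 2 * d) c d"
| T_inv: "theta_group a b c d \<Longrightarrow> theta_group (a - 2 * c) (b - 2 * d) c d"

lemma theta_group_minus: "theta_group a b c d \<Longrightarrow> theta_group (- a) (- b) (- c) (- d)"
  using theta_group.S theta_group.S by fastforce

lemma theta_group_S_rev:
  assumes "theta_group (- c) (- d) a b" shows "theta_group a b c d"
  using theta_group_minus[OF theta_group.S[OF assms]] by simp

lemma theta_group_upper: "theta_group 1 (2 * k) 0 1"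
proof (induction k rule: int_induct[of _ 0])
  case base show ?case using theta_group.one by simp
next
  case (step1 i) thus ?case using theta_group.T[of 1 "2 * i" 0 1] by (simp add: distrib_left)
next
  case (step2 i) thus ?case using theta_group.T_inv[of 1 "2 * i" 0 1] by (simp add: right_diff_distrib)
qed

lemma theta_groupI:
  fixes a b c d :: int
  assumes "a * d - b * c = 1" "(even b \<and> even c) \<or> (even a \<and> even d)"
  shows "theta_group a b c d"
  using assms
proof (induction "nat (\<bar>a\<bar> + \<bar>c\<bar>)" arbitrary: a b c d rule: less_induct)
  case less
  have step: "theta_group a b c d"
    if ac: "\<bar>c\<bar> < \<bar>a\<bar>" "a * d - b * c = 1" "(even b \<and> even c) \<or> (even a \<and> even d)"
      and IH: "\<And>a' b'. \<bar>a'\<bar> < \<bar>a\<bar> \<Longrightarrow> a' * d - b' * c = 1 \<Longrightarrow> (even b' \<and> even c) \<or> (even a' \<and> even d) \<Longrightarrow> theta_group a' b' c d"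
    for a b c d :: int
  proof (cases "c = 0")
    case True
    hence ad: "a * d = 1" using ac by simp
    hence "odd a" by (metis dvd_mult2 odd_one)
    hence "even b" using ac by auto
    then obtain k where k: "b = 2 * k" by (elim evenE)
    from ad have "(a = 1 \<and> d = 1) \<or> (a = - 1 \<and> d = - 1)" by (simp add: zmult_eq_1_iff)
    thus ?thesis
      using theta_group_upper[of k] theta_group_minus[OF theta_group_upper[of "- k"]] True k by auto
  next
    case False
    show ?thesis
    proof (cases "a * c > 0")
      case True
      hence "\<bar>a - 2 * c\<bar> < \<bar>a\<bar>" using ac False by (auto simp: zero_less_mult_iff)
      hence "theta_group (a - 2 * c) (b - 2 * d) c d"
        using ac by (intro IH) (auto simp: algebra_simps)
      from theta_group.T[OF this] show ?thesis by simp
    next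
      case 2: False
      have "a \<noteq> 0" using ac by auto
      hence "\<bar>a + 2 * c\<bar> < \<bar>a\<bar>" using ac False 2 by (auto simp: not_less mult_le_0_iff)
      hence "theta_group (a + 2 * c) (b + 2 * d) c d"
        using ac by (intro IH) (auto simp: algebra_simps)
      from theta_group.T_inv[OF this] show ?thesis by simp
    qed
  qed
  have "\<bar>a\<bar> \<noteq> \<bar>c\<bar>"
  proof
    assume "\<bar>a\<bar> = \<bar>c\<bar>"
    hence "even a \<longleftrightarrow> even c" by (metis even_abs_add_iff dvd_add_right_iff abs_dvd_iff dvd_abs_iff)
    moreover have "odd (a * d - b * c)" using less.prems(1) by simp
    ultimately show False using less.prems(2) by auto
  qed
  then consider "\<bar>c\<bar> < \<bar>a\<bar>" | "\<bar>a\<bar> < \<bar>c\<bar>" by linarith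
  thus ?case
  proof cases
    case 1
    show ?thesis
      by (rule step[OF 1 less.prems]) (use less.hyps 1 in auto)
  next
    case 2
    have "theta_group (- c) (- d) a b"
    proof (rule step)
      fix a' b' assume a': "\<bar>a'\<bar> < \<bar>- c\<bar>" "a' * b - b' * a = 1" "(even b' \<and> even a) \<or> (even a' \<and> even b)"
      show "theta_group a' b' a b" using a' by (intro less.hyps) auto
    qed (use 2 less.prems in \<open>auto simp: algebra_simps\<close>)
    thus ?thesis by (rule theta_group_S_rev)
  qed
qed

lemma theta_group_invariants:
  assumes "theta_group a b c d"
  shows "a * d - b * c = 1" "(even b \<and> even c \<and> odd a \<and> odd d) \<or> (even a \<and> even d \<and> odd b \<and> odd c)"
  using assms by (induction) (auto simp: algebra_simps)

section \<open>Theta series and Weber's function under the theta group\<close>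

text \<open>Weber's function f, with product q^(-1/48) times the 1 + q^(n - 1/2) for n >= 1, where q
  = exp(2 pi i z).\<close>

definition weber :: "complex \<Rightarrow> complex" where
  "weber z = eta z ^ 2 / (eta (z / 2) * eta (2 * z))"

lemma upper_scale: "z \<in> upper_half_plane \<Longrightarrow> z / 2 \<in> upper_half_plane" "z \<in> upper_half_plane \<Longrightarrow> 2 * z \<in> upper_half_plane"
  by (simp_all add: upper_half_plane_def)

lemma upper_add_real: "z \<in> upper_half_plane \<Longrightarrow> Im w = 0 \<Longrightarrow> z + w \<in> upper_half_plane"
  by (simp add: upper_half_plane_def)

lemma upper_mult_of_nat: "z \<in> upper_half_plane \<Longrightarrow> 0 < e \<Longrightarrow> of_nat e * z \<in> upper_half_plane"
  by (simp add: upper_half_plane_def)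

lemma upper_nonzero: "z \<in> upper_half_plane \<Longrightarrow> z \<noteq> 0"
  by (auto simp: upper_half_plane_def)

lemma weber_nonzero: "z \<in> upper_half_plane \<Longrightarrow> weber z \<noteq> 0"
  by (simp add: weber_def eta_nonzero upper_scale)

lemma holomorphic_on_eta_scale:
  assumes "c > 0"
  shows "(\<lambda>z. eta (of_real c * z)) holomorphic_on upper_half_plane"
  using assms by (intro holomorphic_on_compose_gen[OF _ eta_holomorphic, unfolded o_def] holomorphic_intros)
    (auto simp: upper_half_plane_def)

lemma weber_holomorphic: "weber holomorphic_on upper_half_plane"
  unfolding weber_def[abs_def]
  using holomorphic_on_eta_scale[of "1/2"] holomorphic_on_eta_scale[of 2] eta_holomorphic
  by (intro holomorphic_intros) (auto simp: eta_nonzero upper_scale)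

text \<open>The duplication formula rewrites eta((z + 1)/2) as exp(pi i / 24) f(z) eta(z); its
  square carries the phase exp(pi i / 12) of eta(z + 1), so the phases cancel. This reduces theta to
  f and eta.\<close>

lemma jacobi_theta_eq_weber:
  assumes z: "z \<in> upper_half_plane"
  shows "jacobi_theta z = weber z ^ 2 * eta z"
proof -
  define c where "c = exp (of_real pi * \<i> / 24)"
  have c2: "exp (of_real pi * \<i> / 12) = c\<^sup>2"
    unfolding c_def exp_double[symmetric] by (simp add: mult.commute)
  have c: "c \<noteq> 0" by (simp add: c_def)
  have nz: "eta z \<noteq> 0" "eta (z / 2) \<noteq> 0" "eta (2 * z) \<noteq> 0"
    using z by (simp_all add: eta_nonzero upper_scale)
  have "eta ((z + 1) / 2) = c * eta z ^ 3 / (eta (z / 2) * eta (2 * z))"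
    using eta_duplication[OF z] nz by (simp add: c_def field_simps)
  also have "\<dots> = c * (weber z * eta z)"
    by (simp add: weber_def power2_eq_square power3_eq_cube)
  finally have "jacobi_theta z = (c * (weber z * eta z)) ^ 2 / (c\<^sup>2 * eta z)"
    unfolding jacobi_theta_eq_eta[OF z] eta_plus_1 c2 by simp
  thus ?thesis using c nz by (simp add: power2_eq_square)
qed

lemma jacobi_theta_nonzero: "z \<in> upper_half_plane \<Longrightarrow> jacobi_theta z \<noteq> 0"
  by (simp add: jacobi_theta_eq_weber weber_nonzero eta_nonzero)

lemma jacobi_theta_holomorphic: "jacobi_theta holomorphic_on upper_half_plane"
  by (rule holomorphic_transform[of "\<lambda>z. weber z ^ 2 * eta z"])
    (auto intro!: holomorphic_intros weber_holomorphic eta_holomorphic simp: jacobi_theta_eq_weber)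

lemma eta_add_nat: "eta (z + of_nat n) = exp (of_real pi * \<i> / 12) ^ n * eta z"
proof (induction n)
  case (Suc n)
  have "eta (z + of_nat (Suc n)) = eta ((z + of_nat n) + 1)" by (simp add: add_ac)
  thus ?case unfolding eta_plus_1 Suc by simp
qed simp

text \<open>Inversion exchanges the arguments z/2 and 2z; the factors 2^(1/2) and (1/2)^(1/2) that
  the principal power splits off cancel.\<close>

lemma weber_S:
  assumes z: "z \<in> upper_half_plane"
  shows "weber (- 1 / z) = weber z"
proof -
  obtain K where K: "K \<noteq> 0" "\<And>z. z \<in> upper_half_plane \<Longrightarrow> eta (- 1 / z) = K * z powr (1/2) * eta z"
    using eta_inversion by blast
  have z0: "z \<noteq> 0" by (rule upper_nonzero[OF z])
  have 1: "eta (- 1 / z / 2) = K * (2 powr (1/2) * z powr (1/2)) * eta (2 * z)"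
    using K(2)[OF upper_scale(2)[OF z]] powr_of_real_mult[of 2 z "1/2"] z0 by (simp add: mult.commute)
  have 2: "eta (2 * (- 1 / z)) = K * ((1/2) powr (1/2) * z powr (1/2)) * eta (z / 2)"
    using K(2)[OF upper_scale(1)[OF z]] powr_of_real_mult[of "1/2" z "1/2"] z0 by simp
  have "(2 powr (1/2) :: complex) * ((1/2) powr (1/2)) = 1"
    using powr_of_real_mult[of 2 "1/2 :: complex" "1/2"] by simp
  hence "(K * (2 powr (1/2) * z powr (1/2)) * eta (2 * z)) * (K * ((1/2) powr (1/2) * z powr (1/2)) * eta (z / 2)) =
      (K * z powr (1/2)) ^ 2 * (eta (2 * z) * eta (z / 2))"
    by (simp add: power2_eq_square mult_ac)
  hence "weber (- 1 / z) = (K * z powr (1/2) * eta z) ^ 2 / ((K * z powr (1/2)) ^ 2 * (eta (2 * z) * eta (z / 2)))"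
    unfolding weber_def K(2)[OF z] 1 2 by (simp only:)
  thus ?thesis using K(1) z0 by (simp add: weber_def power_mult_distrib mult_ac)
qed

text \<open>The shifts of z, z/2 and 2z by 2, 1 and 4 give the exponent 2 * 2 - 1 - 4 = -1 of exp(pi
  i / 12).\<close>

lemma weber_T:
  assumes z: "z \<in> upper_half_plane"
  shows "weber (z + 2) = exp (- of_real pi * \<i> / 12) * weber z"
proof -
  define c where "c = exp (of_real pi * \<i> / 12)"
  have c: "c \<noteq> 0" by (simp add: c_def)
  have e: "exp (- of_real pi * \<i> / 12) = 1 / c" by (simp add: c_def exp_minus inverse_eq_divide)
  have h: "(z + 2) / 2 = z / 2 + 1" "2 * (z + 2) = 2 * z + of_nat 4" by simp_all
  have "eta (z + 2) = c ^ 2 * eta z" "eta ((z + 2) / 2) = c * eta (z / 2)" "eta (2 * (z + 2)) = c ^ 4 * eta (2 * z)"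
    using eta_add_nat[of z 2] eta_plus_1[of "z / 2"] eta_add_nat[of "2 * z" 4] unfolding h by (simp_all add: c_def)
  hence "weber (z + 2) = (c ^ 2 * eta z) ^ 2 / (c * eta (z / 2) * (c ^ 4 * eta (2 * z)))"
    unfolding weber_def by (simp only:)
  thus ?thesis unfolding e using c by (simp add: weber_def power_mult_distrib power2_eq_square eval_nat_numeral)
qed

text \<open>Determines modulo 24 the exponent P in f(gamma z) = exp(-pi i / 12)^P f(z). The first
  two clauses, one for each parity type of the theta group, fix P modulo 8; they are doubled to
  avoid halving. The last fixes P modulo 3.\<close>

definition weber_exponent :: "int \<Rightarrow> int \<Rightarrow> int \<Rightarrow> int \<Rightarrow> int \<Rightarrow> bool" where
  "weber_exponent a b c d P \<longleftrightarrow>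
     (even b \<and> even c \<longrightarrow> [2 * P = d * (b - c)] (mod 16)) \<and>
     (even a \<and> even d \<longrightarrow> [2 * P = c * (a + d)] (mod 16)) \<and>
     [P = 2 * a * b + a * c + b * d + 2 * a\<^sup>2 * b * d] (mod 3)"

text \<open>Allows d (b - c) to be exchanged for a (b - c), and likewise for the other parity type,
  as the inversion requires. After halving, 4 must divide (u' - v')(x' - y'). The first factor is
  always even; if the second is odd, x' y' is even and the determinant equation makes the first
  divisible by 4.\<close>

lemma sixteen_dvd:
  fixes u v x y :: int
  assumes "odd u" "odd v" "even x" "even y" "u * v = 1 + x * y"
  shows "16 dvd (u - v) * (x - y)"
proof -
  obtain u' v' x' y' where e: "u = 2 * u' + 1" "v = 2 * v' + 1" "x = 2 * x'" "y = 2 * y'"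
    using assms(1-4) by (elim evenE oddE) blast
  have eq: "2 * (u' * v') + u' + v' = 2 * (x' * y')"
    using assms(5) unfolding e by (simp add: algebra_simps)
  hence "even (u' + v')" by presburger
  then obtain k where k: "u' - v' = 2 * k" by (metis evenE even_diff)
  have "4 dvd (u' - v') * (x' - y')"
  proof (cases "even (x' - y')")
    case True
    thus ?thesis unfolding k using mult_dvd_mono[of 2 "2 * k" 2 "x' - y'"] by simp
  next
    case False
    hence "even (x' * y')" by auto
    then obtain t where t: "x' * y' = 2 * t" by (elim evenE)
    have v': "v' = u' - 2 * k" using k by simp
    have "even (u' * (u' + 1))" by simp
    then obtain r where r: "u' * (u' + 1) = 2 * r" by (elim evenE)
    have "2 * (u' * (u' + 1)) - 4 * u' * k - 2 * k = 4 * t"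
      using eq t unfolding v' by (simp add: algebra_simps)
    hence "k = 2 * (r - u' * k - t)" unfolding r by simp
    hence "u' - v' = 4 * (r - u' * k - t)" using k by simp
    hence "4 dvd u' - v'" by simp
    thus ?thesis by simp
  qed
  then obtain m where "(u' - v') * (x' - y') = 4 * m" by (elim dvdE)
  hence "(u - v) * (x - y) = 16 * m" unfolding e by (simp add: algebra_simps)
  thus ?thesis by simp
qed

text \<open>The cubic clause is unchanged by the inversion and grows by 1 under translation by 2.
  Only residues modulo 3 matter, so this is an enumeration of the matrices of determinant 1 over the
  field with three elements.\<close>

lemma weber_exponent_mod_3:
  fixes a b c d :: int
  assumes "a * d - b * c = 1"
  shows "[2 * (- c) * (- d) + (- c) * a + (- d) * b + 2 * (- c)\<^sup>2 * (- d) * b =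
            2 * a * b + a * c + b * d + 2 * a\<^sup>2 * b * d] (mod 3)"
    and "[2 * (a + 2 * c) * (b + 2 * d) + (a + 2 * c) * c + (b + 2 * d) * d + 2 * (a + 2 * c)\<^sup>2 * (b + 2 * d) * d =
            2 * a * b + a * c + b * d + 2 * a\<^sup>2 * b * d + 1] (mod 3)"
proof -
  let ?p = "\<lambda>a b c d :: int. 2 * a * b + a * c + b * d + 2 * a\<^sup>2 * b * d"
  let ?S = "\<lambda>a b c d :: int. 2 * c * d - c * a - d * b - 2 * c\<^sup>2 * d * b"
  let ?T = "\<lambda>a b c d :: int. 2 * (a + 2 * c) * (b + 2 * d) + (a + 2 * c) * c + (b + 2 * d) * d +
    2 * (a + 2 * c)\<^sup>2 * (b + 2 * d) * d"
  have key: "\<forall>a\<in>{0,1,2}. \<forall>b\<in>{0,1,2}. \<forall>c\<in>{0,1,2}. \<forall>d\<in>{0,1,2}. (a * d - b * c) mod 3 = 1 \<longrightarrow>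
      ?S a b c d mod 3 = ?p a b c d mod 3 \<and> ?T a b c d mod 3 = (?p a b c d + 1) mod 3"
    by simp
  define a' b' c' d' where "a' = a mod 3" and "b' = b mod 3" and "c' = c mod 3" and "d' = d mod 3"
  have r: "a' \<in> {0,1,2}" "b' \<in> {0,1,2}" "c' \<in> {0,1,2}" "d' \<in> {0,1,2}"
    unfolding a'_def b'_def c'_def d'_def by auto
  have m: "[a' = a] (mod 3)" "[b' = b] (mod 3)" "[c' = c] (mod 3)" "[d' = d] (mod 3)"
    by (simp_all add: a'_def b'_def c'_def d'_def cong_def)
  have "[a' * d' - b' * c' = a * d - b * c] (mod 3)"
    by (intro cong_diff cong_mult m)
  hence "(a' * d' - b' * c') mod 3 = 1" using assms by (simp add: cong_def)
  hence k: "[?S a' b' c' d' = ?p a' b' c' d'] (mod 3)" "[?T a' b' c' d' = ?p a' b' c' d' + 1] (mod 3)"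
    using key r unfolding cong_def by blast+
  have p: "[?p a' b' c' d' = ?p a b c d] (mod 3)"
    by (intro m cong_add cong_mult cong_pow cong_refl)
  have S: "[?S a' b' c' d' = ?S a b c d] (mod 3)"
    by (intro m cong_diff cong_mult cong_pow cong_refl)
  have T: "[?T a' b' c' d' = ?T a b c d] (mod 3)"
    by (intro m cong_add cong_mult cong_pow cong_refl)
  have "[?S a b c d = ?p a b c d] (mod 3)"
    using p S k(1) by (meson cong_sym cong_trans)
  thus "[2 * (- c) * (- d) + (- c) * a + (- d) * b + 2 * (- c)\<^sup>2 * (- d) * b =
            2 * a * b + a * c + b * d + 2 * a\<^sup>2 * b * d] (mod 3)"
    by simp
  show "[?T a b c d = ?p a b c d + 1] (mod 3)"
    using cong_add[OF p cong_refl[of 1]] T k(2) by (meson cong_sym cong_trans)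
qed

lemma two_odd_square_cong: "odd d \<Longrightarrow> [2 * d * d = 2] (mod 16)" for d :: int
proof -
  assume "odd d"
  then obtain k where k: "d = 2 * k + 1" by (elim oddE)
  have "even (k * (k + 1))" by simp
  then obtain r where r: "k * (k + 1) = 2 * r" by (elim evenE)
  have "2 * d * d - 2 = 8 * (k * (k + 1))" unfolding k by (simp add: algebra_simps)
  hence "2 * d * d - 2 = 16 * r" unfolding r by simp
  thus ?thesis by (simp add: cong_iff_dvd_diff)
qed

lemma weber_exponent_S:
  assumes "theta_group a b c d" "weber_exponent a b c d P"
  shows "weber_exponent (- c) (- d) a b P"
proof -
  note inv = theta_group_invariants[OF assms(1)]
  have "[2 * P = b * (- d - a)] (mod 16)" if "even d" "even a"
  proof -
    have "odd b" "odd c" using inv(2) that by auto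
    hence "16 dvd (b - (- c)) * (a - (- d))"
      using that inv(1) by (intro sixteen_dvd) (auto simp: algebra_simps)
    moreover have "c * (a + d) - b * (- d - a) = (b - (- c)) * (a - (- d))" by (simp add: algebra_simps)
    ultimately have "[c * (a + d) = b * (- d - a)] (mod 16)" by (simp add: cong_iff_dvd_diff)
    moreover have "[2 * P = c * (a + d)] (mod 16)" using assms(2) that by (simp add: weber_exponent_def)
    ultimately show ?thesis using cong_trans by blast
  qed
  moreover have "[2 * P = a * (- c + b)] (mod 16)" if "even c" "even b"
  proof -
    have "odd a" "odd d" using inv(2) that by auto
    hence "16 dvd (a - d) * (b - c)"
      using that inv(1) by (intro sixteen_dvd) (auto simp: algebra_simps)
    hence "16 dvd d * (b - c) - a * (- c + b)"
      by (subst dvd_minus_iff[symmetric]) (simp add: algebra_simps)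
    hence "[d * (b - c) = a * (- c + b)] (mod 16)" by (simp add: cong_iff_dvd_diff)
    moreover have "[2 * P = d * (b - c)] (mod 16)" using assms(2) that by (simp add: weber_exponent_def)
    ultimately show ?thesis using cong_trans by blast
  qed
  moreover have "[P = 2 * (- c) * (- d) + (- c) * a + (- d) * b + 2 * (- c)\<^sup>2 * (- d) * b] (mod 3)"
    using assms(2) weber_exponent_mod_3(1)[OF inv(1)] unfolding weber_exponent_def by (meson cong_sym cong_trans)
  ultimately show ?thesis unfolding weber_exponent_def by auto
qed

text \<open>The doubled exponent changes by 2 d^2 or 2 c^2 with an odd entry, and twice an odd
  square is 2 modulo 16.\<close>

lemma weber_exponent_T:
  assumes "theta_group a b c d"
  shows "weber_exponent (a + 2 * c) (b + 2 * d) c d (P + 1) \<longleftrightarrow> weber_exponent a b c d P"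
proof -
  note inv = theta_group_invariants[OF assms]
  have 1: "[2 * (P + 1) = d * (b + 2 * d - c)] (mod 16) \<longleftrightarrow> [2 * P = d * (b - c)] (mod 16)" if "even b" "even c"
  proof -
    have "[2 * d * d = 2] (mod 16)" using inv(2) that by (intro two_odd_square_cong) auto
    then obtain m where m: "2 * d * d = 2 + 16 * m" by (metis cong_iff_lin cong_sym)
    have eq: "2 * (P + 1) - d * (b + 2 * d - c) = (2 * P - d * (b - c)) + 16 * (- m)"
      using m by (simp add: algebra_simps)
    show ?thesis unfolding cong_iff_dvd_diff eq by (rule dvd_add_left_iff) simp
  qed
  have 2: "[2 * (P + 1) = c * (a + 2 * c + d)] (mod 16) \<longleftrightarrow> [2 * P = c * (a + d)] (mod 16)" if "even a" "even d"
  proof -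
    have "[2 * c * c = 2] (mod 16)" using inv(2) that by (intro two_odd_square_cong) auto
    then obtain m where m: "2 * c * c = 2 + 16 * m" by (metis cong_iff_lin cong_sym)
    have eq: "2 * (P + 1) - c * (a + 2 * c + d) = (2 * P - c * (a + d)) + 16 * (- m)"
      using m by (simp add: algebra_simps)
    show ?thesis unfolding cong_iff_dvd_diff eq by (rule dvd_add_left_iff) simp
  qed
  have 3: "[P + 1 = 2 * (a + 2 * c) * (b + 2 * d) + (a + 2 * c) * c + (b + 2 * d) * d + 2 * (a + 2 * c)\<^sup>2 * (b + 2 * d) * d] (mod 3)
      \<longleftrightarrow> [P = 2 * a * b + a * c + b * d + 2 * a\<^sup>2 * b * d] (mod 3)"
    using weber_exponent_mod_3(2)[OF inv(1)] cong_add_rcancel[of P 1 "2 * a * b + a * c + b * d + 2 * a\<^sup>2 * b * d" 3]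
    by (meson cong_sym cong_trans)
  show ?thesis unfolding weber_exponent_def using 1 2 3 by auto
qed

definition int_mat :: "int \<Rightarrow> int \<Rightarrow> int \<Rightarrow> int \<Rightarrow> real^2^2" where
  "int_mat a b c d = mat2 (of_int a) (of_int b) (of_int c) (of_int d)"

lemma det_int_mat: "det (int_mat a b c d) = of_int (a * d - b * c)"
  by (simp add: int_mat_def det_mat2)

lemma int_mat_mult: "int_mat a b c d ** int_mat a' b' c' d' =
    int_mat (a * a' + b * c') (a * b' + b * d') (c * a' + d * c') (c * b' + d * d')"
  by (simp add: int_mat_def mat2_mult)

lemma theta_group_mat_S: "int_mat (- c) (- d) a b = int_mat 0 (- 1) 1 0 ** int_mat a b c d"
  by (simp add: int_mat_mult)

lemma theta_group_mat_T: "int_mat (a + 2 * c) (b + 2 * d) c d = int_mat 1 2 0 1 ** int_mat a b c d"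
  "int_mat (a - 2 * c) (b - 2 * d) c d = int_mat 1 (- 2) 0 1 ** int_mat a b c d"
  by (simp_all add: int_mat_mult)

lemma act_S: "act (int_mat 0 (- 1) 1 0) z = - 1 / z"
  by (simp add: int_mat_def act_mat2)

lemma aut_factor_S: "aut_factor w (int_mat 0 (- 1) 1 0) z = z powr of_real w"
  by (simp add: int_mat_def aut_factor_def)

lemma aut_factor_T: "aut_factor w (int_mat 1 b 0 1) z = 1"
  by (simp add: int_mat_def aut_factor_def)

lemma act_T: "act (int_mat 1 b 0 1) z = z + of_int b"
  by (simp add: int_mat_def act_mat2)

theorem weber_theta_group:
  assumes "theta_group a b c d"
  obtains P where "weber_exponent a b c d P"
    "\<And>z. z \<in> upper_half_plane \<Longrightarrow> weber (act (int_mat a b c d) z) = exp (- of_real pi * \<i> / 12) powi P * weber z"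
proof -
  define \<zeta> where "\<zeta> = exp (- of_real pi * \<i> / 12)"
  have \<zeta>: "\<zeta> \<noteq> 0" by (simp add: \<zeta>_def)
  have "\<exists>P. weber_exponent a b c d P \<and> (\<forall>z\<in>upper_half_plane. weber (act (int_mat a b c d) z) = \<zeta> powi P * weber z)"
    using assms
  proof induction
    case one
    show ?case by (rule exI[of _ 0]) (simp add: weber_exponent_def act_T)
  next
    case (S a b c d)
    then obtain P where P: "weber_exponent a b c d P"
      "\<And>z. z \<in> upper_half_plane \<Longrightarrow> weber (act (int_mat a b c d) z) = \<zeta> powi P * weber z" by blast
    have det: "det (int_mat a b c d) > 0" using theta_group_invariants(1)[OF S.hyps] by (simp add: det_int_mat)
    have "weber (act (int_mat (- c) (- d) a b) z) = \<zeta> powi P * weber z" if z: "z \<in> upper_half_plane" for z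
      unfolding theta_group_mat_S using z det act_in_upper[OF z det]
      by (simp add: act_mult det_int_mat act_S weber_S P del: divide_minus_left)
    thus ?case using weber_exponent_S[OF S.hyps P(1)] by blast
  next
    case (T a b c d)
    then obtain P where P: "weber_exponent a b c d P"
      "\<And>z. z \<in> upper_half_plane \<Longrightarrow> weber (act (int_mat a b c d) z) = \<zeta> powi P * weber z" by blast
    have det: "det (int_mat a b c d) > 0" using theta_group_invariants(1)[OF T.hyps] by (simp add: det_int_mat)
    have "weber (act (int_mat (a + 2 * c) (b + 2 * d) c d) z) = \<zeta> powi (P + 1) * weber z" if z: "z \<in> upper_half_plane" for z
    proof -
      have "weber (act (int_mat a b c d) z + 2) = \<zeta> * weber (act (int_mat a b c d) z)"
        unfolding \<zeta>_def by (rule weber_T[OF act_in_upper[OF z det]])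
      thus ?thesis
        unfolding theta_group_mat_T using z det \<zeta> by (simp add: act_mult det_int_mat act_T P power_int_add)
    qed
    thus ?case using weber_exponent_T[OF T.hyps, of P] P(1) by blast
  next
    case (T_inv a b c d)
    then obtain P where P: "weber_exponent a b c d P"
      "\<And>z. z \<in> upper_half_plane \<Longrightarrow> weber (act (int_mat a b c d) z) = \<zeta> powi P * weber z" by blast
    have det: "det (int_mat a b c d) > 0" using theta_group_invariants(1)[OF T_inv.hyps] by (simp add: det_int_mat)
    have "weber (act (int_mat (a - 2 * c) (b - 2 * d) c d) z) = \<zeta> powi (P - 1) * weber z" if z: "z \<in> upper_half_plane" for z
    proof -
      define w where "w = act (int_mat a b c d) z"
      have w: "w \<in> upper_half_plane" "w - 2 \<in> upper_half_plane"
        using act_in_upper[OF z det] by (auto simp: w_def upper_half_plane_def)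
      have "weber w = \<zeta> * weber (w - 2)" using weber_T[OF w(2)] by (simp add: \<zeta>_def)
      hence "\<zeta> * weber (w - 2) = \<zeta> * (\<zeta> powi (P - 1) * weber z)"
        using P(2)[OF z] \<zeta> by (simp add: w_def power_int_diff)
      hence "weber (w - 2) = \<zeta> powi (P - 1) * weber z" using \<zeta> by simp
      thus ?thesis unfolding theta_group_mat_T using z det by (simp add: act_mult det_int_mat act_T w_def)
    qed
    moreover have "weber_exponent (a - 2 * c) (b - 2 * d) c d (P - 1)"
      using weber_exponent_T[OF theta_group.T_inv[OF T_inv.hyps], of "P - 1"] P(1) by simp
    ultimately show ?case by blast
  qed
  thus thesis using that unfolding \<zeta>_def by blast
qed

lemma jacobi_theta_T:
  assumes "z \<in> upper_half_plane"
  shows "jacobi_theta (z + 2) = jacobi_theta z"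
proof -
  have "exp (- of_real pi * \<i> / 12) ^ 2 * exp (of_real pi * \<i> / 12) ^ 2 = (1 :: complex)"
    unfolding power_mult_distrib[symmetric] exp_add[symmetric] by simp
  thus ?thesis
    using assms upper_add_real[OF assms, of 2] eta_add_nat[of z 2]
    by (simp add: jacobi_theta_eq_weber weber_T power_mult_distrib)
qed

theorem jacobi_theta_theta_group:
  assumes "theta_group a b c d"
  shows "transf (1/2) jacobi_theta (int_mat a b c d) jacobi_theta"
  using assms
proof induction
  case one
  show ?case by (rule transfI[of 1]) (simp_all add: act_mat2 aut_factor_def int_mat_def)
next
  case (S a b c d)
  obtain K where K: "K \<noteq> 0" "\<And>z. z \<in> upper_half_plane \<Longrightarrow> eta (- 1 / z) = K * z powr (1/2) * eta z"
    using eta_inversion by blast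
  have "transf (1/2) jacobi_theta (int_mat 0 (- 1) 1 0) jacobi_theta"
  proof (rule transfI[OF K(1)])
    fix z assume z: "z \<in> upper_half_plane"
    show "jacobi_theta (act (int_mat 0 (- 1) 1 0) z) = K * aut_factor (1/2) (int_mat 0 (- 1) 1 0) z * jacobi_theta z"
      using K(2)[OF z] z neg_inverse_in_upper[OF z]
      by (simp add: act_S jacobi_theta_eq_weber weber_S aut_factor_S mult_ac del: divide_minus_left)
  qed
  from transf_mult[OF this S.IH] show ?case
    unfolding theta_group_mat_S using theta_group_invariants(1)[OF S.hyps] by (simp add: det_int_mat)
next
  case (T a b c d)
  have "transf (1/2) jacobi_theta (int_mat 1 2 0 1) jacobi_theta"
    by (rule transfI[of 1]) (simp_all add: act_T aut_factor_T jacobi_theta_T)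
  from transf_mult[OF this T.IH] show ?case
    unfolding theta_group_mat_T using theta_group_invariants(1)[OF T.hyps] by (simp add: det_int_mat)
next
  case (T_inv a b c d)
  have "jacobi_theta (z - 2) = jacobi_theta z" if "z \<in> upper_half_plane" for z
    using jacobi_theta_T[of "z - 2"] that by (simp add: upper_half_plane_def)
  hence "transf (1/2) jacobi_theta (int_mat 1 (- 2) 0 1) jacobi_theta"
    by (intro transfI[of 1]) (simp_all add: act_T aut_factor_T)
  from transf_mult[OF this T_inv.IH] show ?case
    unfolding theta_group_mat_T using theta_group_invariants(1)[OF T_inv.hyps] by (simp add: det_int_mat)
qed

section \<open>Behaviour of \<open>g1\<close> and \<open>g2\<close> under the Atkin-Lehner
  group\<close>

section \<open>Product formulas for \<open>g\<^sub>1\<close> and \<open>g\<^sub>2\<close>\<close>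

lemma finite_divisors: "N > 0 \<Longrightarrow> finite (divisors N)"
  unfolding divisors_def by (rule finite_divisors_nat)

lemma divisors_pos: "N > 0 \<Longrightarrow> e \<in> divisors N \<Longrightarrow> e > 0"
  unfolding divisors_def by (auto intro: Nat.gr0I)

text \<open>The exponential of a sum of squares factors along an orthogonal sum of lattices;
  absolute summability of each factor allows the sum over the product set to be split.\<close>

lemma g1_eq_prod:
  assumes N: "N > 0" and z: "z \<in> upper_half_plane"
  shows "g1 N z = (\<Prod>e\<in>divisors N. jacobi_theta (of_nat e * z))"
proof -
  let ?f = "\<lambda>x::real. exp (of_real pi * \<i> * z * of_real (x\<^sup>2))"
  let ?B = "\<lambda>d::nat. range (\<lambda>n::int. sqrt (real d) * of_int n)"
  have inj: "inj (\<lambda>n::int. sqrt (real e) * of_int n)" if "e \<in> divisors N" for e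
    using divisors_pos[OF N that] by (auto simp: inj_on_def)
  have eq: "?f (sqrt (real e) * of_int n) = exp (of_real pi * \<i> * (of_nat e * z) * (of_int n)\<^sup>2)" for e n
    by (simp add: power_mult_distrib mult_ac)
  have "exp (of_real pi * \<i> * z * of_real (\<Sum>i\<in>divisors N. (x i)\<^sup>2)) = (\<Prod>i\<in>divisors N. ?f (x i))" for x :: "nat \<Rightarrow> real"
    by (simp add: exp_sum[symmetric] finite_divisors[OF N] sum_distrib_left)
  hence "g1 N z = (\<Sum>\<^sub>\<infinity>x\<in>Pi\<^sub>E (divisors N) ?B. \<Prod>i\<in>divisors N. ?f (x i))"
    by (simp add: g1_def theta_series_def C_lattice_def)
  also have "\<dots> = (\<Prod>e\<in>divisors N. infsum ?f (?B e))"
  proof (rule infsum_prod_PiE_abs[OF finite_divisors[OF N]])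
    fix e assume e: "e \<in> divisors N"
    show "(\<lambda>x. norm (?f x)) summable_on ?B e"
      unfolding summable_on_reindex[OF inj[OF e]] o_def eq
      by (rule jacobi_theta_abs_summable[OF upper_mult_of_nat[OF z divisors_pos[OF N e]]])
  qed
  also have "\<dots> = (\<Prod>e\<in>divisors N. jacobi_theta (of_nat e * z))"
    by (intro prod.cong refl) (simp only: infsum_reindex[OF inj] o_def eq jacobi_theta_def)
  finally show ?thesis .
qed

lemma g1_nonzero: "N > 0 \<Longrightarrow> z \<in> upper_half_plane \<Longrightarrow> g1 N z \<noteq> 0"
  by (simp add: g1_eq_prod finite_divisors jacobi_theta_nonzero upper_mult_of_nat divisors_pos)

lemma holomorphic_on_scale_nat:
  assumes "f holomorphic_on upper_half_plane" "e > 0"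
  shows "(\<lambda>z. f (of_nat e * z)) holomorphic_on upper_half_plane"
  using assms by (intro holomorphic_on_compose_gen[OF _ assms(1), unfolded o_def] holomorphic_intros)
    (auto simp: upper_half_plane_def)

lemma g1_holomorphic:
  assumes "N > 0" shows "g1 N holomorphic_on upper_half_plane"
  by (rule holomorphic_transform[of "\<lambda>z. \<Prod>e\<in>divisors N. jacobi_theta (of_nat e * z)"])
    (auto intro!: holomorphic_on_prod holomorphic_on_scale_nat jacobi_theta_holomorphic
      simp: g1_eq_prod assms dest: divisors_pos[OF assms])

definition weber_prod :: "nat \<Rightarrow> complex \<Rightarrow> complex" where
  "weber_prod N z = (\<Prod>e\<in>divisors N. weber (of_nat e * z))"

lemma weber_prod_nonzero: "N > 0 \<Longrightarrow> z \<in> upper_half_plane \<Longrightarrow> weber_prod N z \<noteq> 0"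
  by (simp add: weber_prod_def finite_divisors weber_nonzero upper_mult_of_nat divisors_pos)

lemma weber_prod_holomorphic: "N > 0 \<Longrightarrow> weber_prod N holomorphic_on upper_half_plane"
  unfolding weber_prod_def[abs_def]
  by (intro holomorphic_on_prod holomorphic_on_scale_nat weber_holomorphic) (auto simp: divisors_pos)

lemma divisors_double:
  assumes "odd M" "M > 0"
  shows "divisors (2 * M) = divisors M \<union> (*) 2 ` divisors M" "divisors M \<inter> (*) 2 ` divisors M = {}"
proof -
  have "e dvd M \<or> (\<exists>d. e = 2 * d \<and> d dvd M)" if "e dvd 2 * M" for e
  proof (cases "even e")
    case True
    then obtain d where "e = 2 * d" by (elim evenE)
    thus ?thesis using that by auto
  next
    case False
    hence "coprime e 2" by simp
    thus ?thesis using that by (simp add: coprime_dvd_mult_right_iff)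
  qed
  thus "divisors (2 * M) = divisors M \<union> (*) 2 ` divisors M"
    by (auto simp: divisors_def)
  show "divisors M \<inter> (*) 2 ` divisors M = {}"
    using assms by (auto simp: divisors_def)
qed

text \<open>The two formulas for \<open>g2\<close> agree in terms of f: if N = 2M, then M is odd
  because N is squarefree, the divisors of N are e and 2e for e | M, and in f(ez) f(2ez) one factor
  eta(ez) and one factor eta(2ez) cancel. The integral exponent s turns the complex power into an
  ordinary one.\<close>

lemma g2_eq:
  assumes N: "N > 0" and s: "s_const N = real s" and sq: "squarefree N" and z: "z \<in> upper_half_plane"
  shows "g2 N z = inverse (weber_prod N z) ^ s"
proof -
  have nz: "eta (of_nat e * z) \<noteq> 0" "eta (of_nat e * (z / 2)) \<noteq> 0" "eta (of_nat e * (2 * z)) \<noteq> 0"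
      "eta (of_nat e * (4 * z)) \<noteq> 0" if "e > 0" for e
    using z that by (auto intro!: eta_nonzero upper_mult_of_nat simp: upper_half_plane_def)
  have w: "weber (of_nat e * z) = eta (of_nat e * z) ^ 2 / (eta (of_nat e * (z / 2)) * eta (of_nat e * (2 * z)))" for e
    by (simp add: weber_def mult_ac)
  have w2: "weber (of_nat (2 * e) * z) = eta (of_nat e * (2 * z)) ^ 2 / (eta (of_nat e * z) * eta (of_nat e * (4 * z)))" for e
    by (simp add: weber_def mult_ac)
  have base: "(if odd N then eta_prod N (z / 2) * eta_prod N (2 * z) / (eta_prod N z)\<^sup>2
      else eta_prod (N div 2) (z / 2) * eta_prod (N div 2) (4 * z) /
             (eta_prod (N div 2) z * eta_prod (N div 2) (2 * z))) = inverse (weber_prod N z)"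
  proof (cases "odd N")
    case True
    have "inverse (weber_prod N z) = (\<Prod>e\<in>divisors N. eta (of_nat e * (z / 2)) * eta (of_nat e * (2 * z)) / eta (of_nat e * z) ^ 2)"
      unfolding weber_prod_def prod_inversef[symmetric] w by simp
    also have "\<dots> = eta_prod N (z / 2) * eta_prod N (2 * z) / (eta_prod N z)\<^sup>2"
      by (simp add: eta_prod_def prod.distrib prod_dividef prod_power_distrib)
    finally show ?thesis using True by simp
  next
    case False
    then obtain M where M: "N = 2 * M" by (metis evenE)
    have "odd M"
    proof
      assume "even M"
      hence "2\<^sup>2 dvd N" unfolding M by auto
      from squarefreeD[OF sq this] show False by simp
    qed
    have M0: "M > 0" using N M by simp
    have fin: "finite (divisors M)" by (rule finite_divisors[OF M0])
    have "weber_prod N z = (\<Prod>e\<in>divisors M. weber (of_nat e * z)) * (\<Prod>e\<in>(*) 2 ` divisors M. weber (of_nat e * z))"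
      unfolding weber_prod_def M divisors_double(1)[OF \<open>odd M\<close> M0]
      by (rule prod.union_disjoint) (use fin divisors_double(2)[OF \<open>odd M\<close> M0] in auto)
    also have "(\<Prod>e\<in>(*) 2 ` divisors M. weber (of_nat e * z)) = (\<Prod>e\<in>divisors M. weber (of_nat (2 * e) * z))"
      by (subst prod.reindex) (auto simp: inj_on_def)
    finally have "weber_prod N z = (\<Prod>e\<in>divisors M. weber (of_nat e * z) * weber (of_nat (2 * e) * z))"
      by (simp only: prod.distrib)
    also have "\<dots> = (\<Prod>e\<in>divisors M. eta (of_nat e * z) * eta (of_nat e * (2 * z)) / (eta (of_nat e * (z / 2)) * eta (of_nat e * (4 * z))))"
    proof (intro prod.cong refl)
      fix e assume "e \<in> divisors M"
      hence "e > 0" by (rule divisors_pos[OF M0])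
      from nz[OF this] show "weber (of_nat e * z) * weber (of_nat (2 * e) * z) =
          eta (of_nat e * z) * eta (of_nat e * (2 * z)) / (eta (of_nat e * (z / 2)) * eta (of_nat e * (4 * z)))"
        unfolding w w2 by (simp only: power2_eq_square) (simp add: field_simps)
    qed
    finally have "inverse (weber_prod N z) = eta_prod M (z / 2) * eta_prod M (4 * z) / (eta_prod M z * eta_prod M (2 * z))"
      by (simp add: eta_prod_def prod.distrib prod_dividef)
    thus ?thesis by (simp add: M)
  qed
  have nz: "inverse (weber_prod N z) \<noteq> 0" using weber_prod_nonzero[OF N z] by simp
  have "g2 N z = (if odd N then eta_prod N (z / 2) * eta_prod N (2 * z) / (eta_prod N z)\<^sup>2
      else eta_prod (N div 2) (z / 2) * eta_prod (N div 2) (4 * z) /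
             (eta_prod (N div 2) z * eta_prod (N div 2) (2 * z))) powr of_real (s_const N)"
    by (simp add: g2_def)
  also have "\<dots> = inverse (weber_prod N z) powr of_nat s"
    unfolding base s by simp
  also have "\<dots> = inverse (weber_prod N z) ^ s"
    using nz by (intro powr_nat') auto
  finally show ?thesis .
qed

section \<open>Action of the Atkin-Lehner involutions\<close>

lemma matrix_mult_scaleR_right: "A ** (r *\<^sub>R B) = r *\<^sub>R (A ** B)" for A B :: "real^2^2"
  by (simp add: vec_eq_iff forall_2 matrix_matrix_mult_def sum_2 algebra_simps)

text \<open>Moves the scaling by e past W: the behaviour of f(e z) under W becomes that of f under
  gamma. The scalar t is positive, so it can be pulled out of the principal power.\<close>

lemma scale_act:
  assumes eq: "int_mat (int e) 0 0 1 ** W = t *\<^sub>R (\<gamma> ** int_mat (int e') 0 0 1)"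
    and t: "t > 0" and e: "e > 0" "e' > 0" and det: "det W > 0" "det \<gamma> > 0"
  shows "z \<in> upper_half_plane \<Longrightarrow> of_nat e * act W z = act \<gamma> (of_nat e' * z)"
    and "transf w f \<gamma> f \<Longrightarrow> transf w (\<lambda>z. f (of_nat e * z)) W (\<lambda>z. f (of_nat e' * z))"
proof -
  have D: "act (int_mat (int k) 0 0 1) z = of_nat k * z" "jac (int_mat (int k) 0 0 1) z = 1" "det (int_mat (int k) 0 0 1) = real k" for k z
    by (simp_all add: int_mat_def act_mat2 jac_mat2 det_mat2)
  have pos: "det (int_mat (int e) 0 0 1) > 0" "det (int_mat (int e') 0 0 1) > 0" using e by (simp_all add: D)
  show A: "of_nat e * act W z = act \<gamma> (of_nat e' * z)" if z: "z \<in> upper_half_plane" for z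
  proof -
    have "of_nat e * act W z = act (int_mat (int e) 0 0 1 ** W) z"
      using act_mult[OF z pos(1) det(1)] by (simp add: D)
    also have "\<dots> = act \<gamma> (of_nat e' * z)"
      unfolding eq using t act_mult[OF z det(2) pos(2)] by (simp add: D act_scaleR)
    finally show ?thesis .
  qed
  assume "transf w f \<gamma> f"
  then obtain \<alpha> where \<alpha>: "\<alpha> \<noteq> 0" "\<And>z. z \<in> upper_half_plane \<Longrightarrow> f (act \<gamma> z) = \<alpha> * aut_factor w \<gamma> z * f z"
    unfolding transf_def by blast
  show "transf w (\<lambda>z. f (of_nat e * z)) W (\<lambda>z. f (of_nat e' * z))"
  proof (rule transfI[of "\<alpha> * of_real (1 / t) powr of_real w"])
    fix z assume z: "z \<in> upper_half_plane"
    have "jac W z = jac (int_mat (int e) 0 0 1 ** W) z"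
      using jac_mult[OF z, of W] det by (simp add: D)
    also have "\<dots> = of_real t * jac \<gamma> (of_nat e' * z)"
      unfolding eq jac_scaleR using jac_mult[OF z, of "int_mat (int e') 0 0 1" \<gamma>] pos by (simp add: D)
    finally have j: "jac \<gamma> (of_nat e' * z) = of_real (1 / t) * jac W z" using t by simp
    have "aut_factor w \<gamma> (of_nat e' * z) = of_real (1 / t) powr of_real w * aut_factor w W z"
      unfolding aut_factor_jac j using t det jac_nonzero[OF z, of W] by (intro powr_of_real_mult) auto
    thus "f (of_nat e * act W z) = \<alpha> * of_real (1 / t) powr of_real w * aut_factor w W z * f (of_nat e' * z)"
      unfolding A[OF z] \<alpha>(2)[OF upper_mult_of_nat[OF z e(2)]] by (simp add: mult_ac)
  qed (use \<alpha> t in auto)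
qed

text \<open>The elements of \<open>\<onehalf>\<Gamma>\<^sub>0(4N)+\<close> coming from Atkin--Lehner involutions of level \<open>m\<close>;
  for \<open>m = 1\<close> these are the elements of \<open>\<onehalf>\<Gamma>\<^sub>0(4N)\<close>.\<close>

definition al_mat :: "nat \<Rightarrow> nat \<Rightarrow> int \<Rightarrow> int \<Rightarrow> int \<Rightarrow> int \<Rightarrow> real^2^2" where
  "al_mat N m a b c d = (1 / sqrt (real m)) *\<^sub>R int_mat (int m * a) (2 * b) (2 * int N * c) (int m * d)"

lemma det_al_mat:
  assumes "m > 0" "int m * a * (int m * d) - b * (4 * int N * c) = int m"
  shows "det (al_mat N m a b c d) = 1"
proof -
  have "int m * a * (int m * d) - (2 * b) * (2 * int N * c) = int m" using assms(2) by simp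
  thus ?thesis
    using assms(1) by (simp only: al_mat_def det_scaleR_2 det_int_mat) (simp add: power_divide)
qed

text \<open>For a divisor \<open>u\<close> of the squarefree \<open>N\<close>, \<open>e \<mapsto> al_perm u e\<close> is the involution of the divisors
  of \<open>N\<close> complementing the part dividing \<open>u\<close>.\<close>

definition al_perm :: "nat \<Rightarrow> nat \<Rightarrow> nat" where
  "al_perm u e = (u div gcd e u) * (e div gcd e u)"

lemma squarefree_cofactor_coprime:
  assumes "squarefree (N :: nat)" "N = u * v" shows "coprime u v"
proof (rule coprimeI)
  fix c assume "c dvd u" "c dvd v"
  hence "c\<^sup>2 dvd N" unfolding assms(2) power2_eq_square by (rule mult_dvd_mono)
  thus "is_unit c" by (rule squarefreeD[OF assms(1)])
qed

text \<open>With g = gcd(e, u) the level factors as N = g * u1 * e2 * v2, where e = g e2 and u = g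
  u1. The involution exchanges g and u1 and keeps e2 and v2.\<close>

lemma divisor_split:
  assumes sq: "squarefree N" and N: "N > 0" "N = u * v" and e: "e dvd N"
  obtains u1 e2 v2 where "u = gcd e u * u1" "e = gcd e u * e2" "v = e2 * v2" "al_perm u e = u1 * e2"
    "gcd (al_perm u e) u = u1" "al_perm u (al_perm u e) = e" "al_perm u e dvd N"
    "N div e = u1 * v2" "N div al_perm u e = gcd e u * v2"
proof -
  define g where "g = gcd e u"
  have pos: "u > 0" "v > 0" "e > 0" using N e by (auto intro: Nat.gr0I)
  have g: "g > 0" using pos by (simp add: g_def)
  obtain u1 where u1: "u = g * u1" unfolding g_def by (meson dvdE gcd_dvd2)
  obtain e2 where e2: "e = g * e2" unfolding g_def by (meson dvdE gcd_dvd1)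
  have uv: "coprime u v" by (rule squarefree_cofactor_coprime[OF sq N(2)])
  have "coprime e2 u1"
  proof -
    have "g * 1 = g * gcd e2 u1" unfolding gcd_mult_distrib_nat e2[symmetric] u1[symmetric] by (simp add: g_def)
    hence "gcd e2 u1 = 1" using g by simp
    thus ?thesis by (simp add: coprime_iff_gcd_eq_1)
  qed
  have "g * e2 dvd g * (u1 * v)" using e N u1 e2 by (simp add: mult.assoc)
  hence "e2 dvd u1 * v" using g by simp
  hence "e2 dvd v" using \<open>coprime e2 u1\<close> by (simp add: coprime_dvd_mult_right_iff)
  then obtain v2 where v2: "v = e2 * v2" by (elim dvdE)
  have p: "al_perm u e = u1 * e2"
    using g u1 e2 unfolding al_perm_def g_def[symmetric] by simp
  have "coprime u e2" using uv unfolding v2 by simp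
  hence ce: "gcd e2 g = 1" unfolding u1 by (simp add: coprime_commute coprime_iff_gcd_eq_1[symmetric])
  have gp: "gcd (al_perm u e) u = u1"
  proof -
    have "u1 * gcd e2 g = gcd (u1 * e2) (u1 * g)" by (rule gcd_mult_distrib_nat)
    thus ?thesis unfolding p ce using u1 by (simp add: mult.commute)
  qed
  have u10: "u1 > 0" using pos u1 by (auto intro: Nat.gr0I)
  have e20: "e2 > 0" using pos e2 by (auto intro: Nat.gr0I)
  have "al_perm u (al_perm u e) = (u div u1) * (al_perm u e div u1)"
    by (simp only: al_perm_def[of u "al_perm u e"] gp)
  moreover have "u div u1 = g" unfolding u1 using u10 by simp
  moreover have "al_perm u e div u1 = e2" unfolding p using u10 by simp
  ultimately have pp: "al_perm u (al_perm u e) = e" unfolding e2 by (simp only:)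
  show thesis
  proof (rule that[of u1 e2 v2])
    show "u = gcd e u * u1" using u1 unfolding g_def .
    show "e = gcd e u * e2" using e2 unfolding g_def .
    have "N = (u1 * e2) * (g * v2)" unfolding N(2) u1 v2 by (simp add: mult_ac)
    thus "al_perm u e dvd N" unfolding p by (rule dvdI)
    have "N = e * (u1 * v2)" unfolding N u1 v2 e2 by (simp add: mult_ac)
    thus "N div e = u1 * v2" using pos by simp
    have "N = (u1 * e2) * (g * v2)" unfolding N u1 v2 by (simp add: mult_ac)
    thus "N div al_perm u e = gcd e u * v2" unfolding p g_def using u10 e20 by simp
  qed (use v2 p gp pp in auto)
qed

lemma bij_betw_al_perm:
  assumes "squarefree N" "N > 0" "u dvd N"
  shows "bij_betw (al_perm u) (divisors N) (divisors N)"
proof -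
  obtain v where v: "N = u * v" using assms(3) by (elim dvdE)
  have "al_perm u e dvd N \<and> al_perm u (al_perm u e) = e" if "e dvd N" for e
    using divisor_split[OF assms(1,2) v that] by metis
  thus ?thesis
    by (intro bij_betw_byWitness[where f' = "al_perm u"]) (auto simp: divisors_def)
qed

lemma bij_betw_div:
  assumes "N > 0"
  shows "bij_betw (\<lambda>e. N div e) (divisors N) (divisors N)"
proof (rule bij_betw_byWitness[where f' = "\<lambda>e. N div e"])
  show "\<forall>e\<in>divisors N. N div (N div e) = e" "\<forall>e\<in>divisors N. N div (N div e) = e"
    using assms by (auto simp: divisors_def elim!: dvdE)
  show "(\<lambda>e. N div e) ` divisors N \<subseteq> divisors N" "(\<lambda>e. N div e) ` divisors N \<subseteq> divisors N"
    by (auto simp: divisors_def div_dvd_iff_mult dvd_div_eq_mult elim!: dvdE)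
qed

text \<open>If 3 does not divide sigma(N), then s sigma(N) = 24 forces 3 | s. Otherwise the last
  assumption supplies a prime p that is -1 modulo 3, and the divisors e and p e cancel in pairs
  modulo 3.\<close>

locale square_free_level =
  fixes N s :: nat
  assumes N_pos: "N > 0" and squarefree_N: "squarefree N"
    and s_const_N: "s_const N = real s"
    and s_sigma: "s * \<Sum>(divisors N) = 24"
    and three_dvd_sigma: "3 dvd \<Sum>(divisors N) \<Longrightarrow> \<exists>p. prime p \<and> p mod 3 = 2 \<and> p dvd N"
begin

lemma g2_eq': "z \<in> upper_half_plane \<Longrightarrow> g2 N z = inverse (weber_prod N z) ^ s"
  by (rule g2_eq[OF N_pos s_const_N squarefree_N])

text \<open>For \<open>e | N\<close> and \<open>W = al_mat N (\<kappa>\<^sup>2u) a b c d\<close>, the matrix \<open>(e, 0; 0, 1) W\<close> is a positive multiple of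
  \<open>\<gamma> (al_perm u e, 0; 0, 1)\<close> with \<open>\<gamma>\<close> in the theta group; the entries of \<open>\<gamma>\<close> are as follows.\<close>

context
  fixes u v \<kappa> \<kappa>' :: nat and a b c d :: int
  assumes N_eq: "N = u * v" and kk: "\<kappa> * \<kappa>' = 2"
    and det: "int \<kappa> ^ 2 * int u * a * d - int \<kappa>' ^ 2 * int v * b * c = 1"
begin

definition gA :: "nat \<Rightarrow> int" where "gA e = int (\<kappa> * gcd e u) * a"
definition gB :: "nat \<Rightarrow> int" where "gB e = int (\<kappa>' * (e div gcd e u)) * b"
definition gC :: "nat \<Rightarrow> int" where "gC e = int (\<kappa>' * (v div (e div gcd e u))) * c"
definition gD :: "nat \<Rightarrow> int" where "gD e = int (\<kappa> * (u div gcd e u)) * d"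

lemma uv_pos: "u > 0" "v > 0" "\<kappa> > 0" "\<kappa>' > 0"
  using N_pos N_eq kk by (auto intro: Nat.gr0I)

text \<open>In 4N = (\<open>\<kappa>\<close>^2 u)(\<open>\<kappa>'\<close>^2 v) the factor 4 belongs
  either to the level of the involution or to its cofactor. Correspondingly the matrices
  (\<open>gA\<close>, \<open>gB\<close>; \<open>gC\<close>, \<open>gD\<close>) have even diagonal or
  even off-diagonal entries.\<close>

lemma kappa_cases: "(\<kappa> = 1 \<and> \<kappa>' = 2) \<or> (\<kappa> = 2 \<and> \<kappa>' = 1)"
proof -
  have "\<kappa> dvd 2" using kk by (metis dvd_triv_left)
  hence "\<kappa> \<le> 2" by (rule dvd_imp_le) simp
  hence "\<kappa> = 0 \<or> \<kappa> = 1 \<or> \<kappa> = 2" by linarith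
  thus ?thesis using kk by auto
qed

text \<open>The products of entries occurring in \<open>weber_exponent\<close> modulo 16 are
  constants times \<open>al_perm u e\<close>, N/e and N / \<open>al_perm u e\<close>. Each of these
  runs through all divisors with e, so the sums over e become multiples of sigma(N).\<close>

lemma al_entries:
  assumes "e dvd N"
  shows "gA e * gD e - gB e * gC e = 1"
    and "theta_group (gA e) (gB e) (gC e) (gD e)"
    and "gB e * gD e = 2 * b * d * int (al_perm u e)"
    and "gC e * gD e = 2 * c * d * int (N div e)"
    and "gA e * gC e = 2 * a * c * int (N div al_perm u e)"
    and "int_mat (int e) 0 0 1 ** al_mat N (\<kappa>\<^sup>2 * u) a b c d =
      (real (\<kappa> * gcd e u) / sqrt (real (\<kappa>\<^sup>2 * u))) *\<^sub>R (int_mat (gA e) (gB e) (gC e) (gD e) ** int_mat (int (al_perm u e)) 0 0 1)"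
    and "al_perm u e > 0"
proof -
  define g where "g = gcd e u"
  obtain u1 e2 v2 where w: "u = g * u1" "e = g * e2" "v = e2 * v2" "al_perm u e = u1 * e2"
      "N div e = u1 * v2" "N div al_perm u e = g * v2"
    using divisor_split[OF squarefree_N N_pos N_eq assms] unfolding g_def by metis
  have pos: "g > 0" "u1 > 0" "e2 > 0" "v2 > 0"
    using uv_pos w assms N_pos by (auto intro!: Nat.gr0I)
  have kz: "int \<kappa> * int \<kappa>' = 2" using kk by (metis of_nat_mult of_nat_numeral)
  have A: "gA e = int \<kappa> * int g * a" by (simp add: gA_def g_def)
  have B: "gB e = int \<kappa>' * int e2 * b" unfolding gB_def g_def[symmetric] using w pos by simp
  have C: "gC e = int \<kappa>' * int v2 * c" unfolding gC_def g_def[symmetric] using w pos by simp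
  have D: "gD e = int \<kappa> * int u1 * d" unfolding gD_def g_def[symmetric] using w pos by simp
  show dt: "gA e * gD e - gB e * gC e = 1"
  proof -
    have "int \<kappa> ^ 2 * int (g * u1) * a * d - int \<kappa>' ^ 2 * int (e2 * v2) * b * c = 1"
      using det by (simp only: w(1,3))
    thus ?thesis unfolding A B C D by (simp add: power2_eq_square mult_ac)
  qed
  show "theta_group (gA e) (gB e) (gC e) (gD e)"
  proof (rule theta_groupI[OF dt])
    show "even (gB e) \<and> even (gC e) \<or> even (gA e) \<and> even (gD e)"
      unfolding A B C D using kappa_cases by auto
  qed
  have "gB e * gD e = (int \<kappa> * int \<kappa>') * b * d * int (u1 * e2)" by (simp add: B D)
  thus "gB e * gD e = 2 * b * d * int (al_perm u e)" unfolding kz w(4) .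
  have "gC e * gD e = (int \<kappa> * int \<kappa>') * c * d * int (u1 * v2)" by (simp add: C D)
  thus "gC e * gD e = 2 * c * d * int (N div e)" unfolding kz w(5) .
  have "gA e * gC e = (int \<kappa> * int \<kappa>') * a * c * int (g * v2)" by (simp add: A C)
  thus "gA e * gC e = 2 * a * c * int (N div al_perm u e)" unfolding kz w(6) .
  show "al_perm u e > 0" using w pos by simp
  have kr: "real \<kappa> * real \<kappa>' = 2" using kk by (metis of_nat_mult of_nat_numeral)
  have 1: "int_mat (int e) 0 0 1 ** int_mat (int (\<kappa>\<^sup>2 * u) * a) (2 * b) (2 * int N * c) (int (\<kappa>\<^sup>2 * u) * d) =
     real (\<kappa> * g) *\<^sub>R (int_mat (gA e) (gB e) (gC e) (gD e) ** int_mat (int (al_perm u e)) 0 0 1)"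
  proof -
    have r: "2 * (real e * real_of_int b) = real (\<kappa> * g) * (real \<kappa>' * real e2 * real_of_int b)"
      using kr w(2) by simp
    have r2: "2 * real N * real_of_int c = real (\<kappa> * g) * (real \<kappa>' * real v2 * real_of_int c * (real u1 * real e2))"
      using kr w(1,3) N_eq by simp
    show ?thesis
      unfolding A B C D w(4) int_mat_def mat2_mult scaleR_mat2 mat2_eq_iff
      using r r2 w(1,2) by (simp add: power2_eq_square mult_ac)
  qed
  show "int_mat (int e) 0 0 1 ** al_mat N (\<kappa>\<^sup>2 * u) a b c d =
      (real (\<kappa> * gcd e u) / sqrt (real (\<kappa>\<^sup>2 * u))) *\<^sub>R (int_mat (gA e) (gB e) (gC e) (gD e) ** int_mat (int (al_perm u e)) 0 0 1)"
    unfolding al_mat_def g_def[symmetric] matrix_mult_scaleR_right 1 by simp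
qed

lemma det_al_mat_level: "det (al_mat N (\<kappa>\<^sup>2 * u) a b c d) = 1"
proof (rule det_al_mat)
  show "\<kappa>\<^sup>2 * u > 0" using uv_pos by simp
  have "int \<kappa>' ^ 2 * int \<kappa> ^ 2 = 4"
    using kappa_cases by auto
  hence "(int \<kappa> ^ 2 * int u) * (int \<kappa> ^ 2 * int u * a * d - int \<kappa>' ^ 2 * int v * b * c) =
     int (\<kappa>\<^sup>2 * u) * a * (int (\<kappa>\<^sup>2 * u) * d) - b * (4 * int N * c)"
    using N_eq kappa_cases by (auto simp: algebra_simps power2_eq_square)
  thus "int (\<kappa>\<^sup>2 * u) * a * (int (\<kappa>\<^sup>2 * u) * d) - b * (4 * int N * c) = int (\<kappa>\<^sup>2 * u)"
    unfolding det by simp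
qed

lemma prod_al_perm: "(\<Prod>e\<in>divisors N. f (al_perm u e)) = (\<Prod>e\<in>divisors N. f e)"
  using N_eq by (intro prod.reindex_bij_betw bij_betw_al_perm squarefree_N N_pos) simp

lemma scale_factor_pos: "real (\<kappa> * gcd e u) / sqrt (real (\<kappa>\<^sup>2 * u)) > 0"
  using uv_pos by simp

lemma g1_al: "transf (g1_weight N) (g1 N) (al_mat N (\<kappa>\<^sup>2 * u) a b c d) (g1 N)"
proof -
  let ?W = "al_mat N (\<kappa>\<^sup>2 * u) a b c d"
  have "transf (1/2) (\<lambda>z. jacobi_theta (of_nat e * z)) ?W (\<lambda>z. jacobi_theta (of_nat (al_perm u e) * z))"
    if "e \<in> divisors N" for e
  proof -
    have e: "e dvd N" using that by (simp add: divisors_def)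
    show ?thesis
      by (rule scale_act(2)[OF al_entries(6)[OF e] scale_factor_pos divisors_pos[OF N_pos that] al_entries(7)[OF e]])
        (use det_al_mat_level al_entries(1)[OF e] jacobi_theta_theta_group[OF al_entries(2)[OF e]] in \<open>auto simp: det_int_mat\<close>)
  qed
  hence "transf (real (card (divisors N)) * (1/2)) (\<lambda>z. \<Prod>e\<in>divisors N. jacobi_theta (of_nat e * z)) ?W
     (\<lambda>z. \<Prod>e\<in>divisors N. jacobi_theta (of_nat (al_perm u e) * z))"
    using det_al_mat_level finite_divisors[OF N_pos] by (intro transf_prod) auto
  also have "(\<lambda>z. \<Prod>e\<in>divisors N. jacobi_theta (of_nat (al_perm u e) * z)) = (\<lambda>z. \<Prod>e\<in>divisors N. jacobi_theta (of_nat e * z))"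
    by (rule ext) (rule prod_al_perm)
  finally have "transf (g1_weight N) (\<lambda>z. \<Prod>e\<in>divisors N. jacobi_theta (of_nat e * z)) ?W
     (\<lambda>z. \<Prod>e\<in>divisors N. jacobi_theta (of_nat e * z))"
    by (simp add: g1_weight_def C_dim_def)
  thus ?thesis
    unfolding transf_def using act_in_upper[of _ ?W] det_al_mat_level by (simp add: g1_eq_prod[OF N_pos])
qed

lemma sum_al_perm: "(\<Sum>e\<in>divisors N. f (al_perm u e)) = (\<Sum>e\<in>divisors N. f e)"
  using N_eq by (intro sum.reindex_bij_betw bij_betw_al_perm squarefree_N N_pos) simp

lemma sum_codivisor: "(\<Sum>e\<in>divisors N. int (N div e)) = int (\<Sum>(divisors N))"
  using sum.reindex_bij_betw[OF bij_betw_div[OF N_pos], of int] by simp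

text \<open>The doubled sum of exponents is congruent to 2 sigma(N) r modulo 16 for some integer r,
  and s sigma(N) = 24 is a multiple of 8.\<close>

lemma weber_exponent_sum_mod_8:
  assumes P: "\<And>e. e \<in> divisors N \<Longrightarrow> weber_exponent (gA e) (gB e) (gC e) (gD e) (P e)"
  shows "8 dvd int s * (\<Sum>e\<in>divisors N. P e)"
proof -
  define \<sigma> where "\<sigma> = int (\<Sum>(divisors N))"
  have s\<sigma>: "int s * \<sigma> = 24" unfolding \<sigma>_def using s_sigma by (metis of_nat_mult of_nat_numeral)
  have sp: "(\<Sum>e\<in>divisors N. int (al_perm u e)) = \<sigma>" using sum_al_perm[of int] by (simp add: \<sigma>_def)
  have sc: "(\<Sum>e\<in>divisors N. int (N div al_perm u e)) = \<sigma>"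
    using sum_al_perm[of "\<lambda>e. int (N div e)"] sum_codivisor by (simp add: \<sigma>_def)
  have "\<exists>r. [2 * (\<Sum>e\<in>divisors N. P e) = 2 * \<sigma> * r] (mod 16)"
  proof (rule disjE[OF kappa_cases])
    assume k: "\<kappa> = 1 \<and> \<kappa>' = 2"
    have "[2 * P e = 2 * b * d * int (al_perm u e) - 2 * c * d * int (N div e)] (mod 16)" if e: "e \<in> divisors N" for e
    proof -
      have e': "e dvd N" using e by (simp add: divisors_def)
      have "even (gB e)" "even (gC e)" unfolding gB_def gC_def using k by simp_all
      hence "[2 * P e = gD e * (gB e - gC e)] (mod 16)" using P[OF e] by (simp add: weber_exponent_def)
      also have "gD e * (gB e - gC e) = gB e * gD e - gC e * gD e" by (simp add: algebra_simps)
      finally show ?thesis unfolding al_entries(3,4)[OF e'] .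
    qed
    hence "[(\<Sum>e\<in>divisors N. 2 * P e) = (\<Sum>e\<in>divisors N. 2 * b * d * int (al_perm u e) - 2 * c * d * int (N div e))] (mod 16)"
      by (rule cong_sum)
    also have "(\<Sum>e\<in>divisors N. 2 * b * d * int (al_perm u e) - 2 * c * d * int (N div e)) = 2 * b * d * \<sigma> - 2 * c * d * \<sigma>"
      unfolding sum_subtractf sum_distrib_left[symmetric] sp sum_codivisor \<sigma>_def ..
    also have "\<dots> = 2 * \<sigma> * (b * d - c * d)" by (simp add: algebra_simps)
    finally show ?thesis unfolding sum_distrib_left[symmetric] by blast
  next
    assume k: "\<kappa> = 2 \<and> \<kappa>' = 1"
    have "[2 * P e = 2 * a * c * int (N div al_perm u e) + 2 * c * d * int (N div e)] (mod 16)" if e: "e \<in> divisors N" for e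
    proof -
      have e': "e dvd N" using e by (simp add: divisors_def)
      have "even (gA e)" "even (gD e)" unfolding gA_def gD_def using k by simp_all
      hence "[2 * P e = gC e * (gA e + gD e)] (mod 16)" using P[OF e] by (simp add: weber_exponent_def)
      also have "gC e * (gA e + gD e) = gA e * gC e + gC e * gD e" by (simp add: algebra_simps)
      finally show ?thesis unfolding al_entries(4,5)[OF e'] .
    qed
    hence "[(\<Sum>e\<in>divisors N. 2 * P e) = (\<Sum>e\<in>divisors N. 2 * a * c * int (N div al_perm u e) + 2 * c * d * int (N div e))] (mod 16)"
      by (rule cong_sum)
    also have "(\<Sum>e\<in>divisors N. 2 * a * c * int (N div al_perm u e) + 2 * c * d * int (N div e)) = 2 * a * c * \<sigma> + 2 * c * d * \<sigma>"
      unfolding sum.distrib sum_distrib_left[symmetric] sc sum_codivisor \<sigma>_def ..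
    also have "\<dots> = 2 * \<sigma> * (a * c + c * d)" by (simp add: algebra_simps)
    finally show ?thesis unfolding sum_distrib_left[symmetric] by blast
  qed
  then obtain r where "[2 * (\<Sum>e\<in>divisors N. P e) = 2 * \<sigma> * r] (mod 16)" by blast
  then obtain q where "2 * (\<Sum>e\<in>divisors N. P e) = 2 * \<sigma> * r + 16 * q"
    by (metis cong_iff_lin cong_sym)
  hence "(\<Sum>e\<in>divisors N. P e) = \<sigma> * r + 8 * q" by simp
  hence "int s * (\<Sum>e\<in>divisors N. P e) = (int s * \<sigma>) * r + 8 * (int s * q)"
    by (simp add: algebra_simps)
  also have "\<dots> = 8 * (3 * r + int s * q)" unfolding s\<sigma> by simp
  finally show ?thesis by simp
qed

text \<open>Passing from e to p e multiplies one entry of a pair by p and divides the other by p: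
  for p | u the diagonal pair, otherwise the off-diagonal one. As p is -1 modulo 3, both entries
  change sign modulo 3, and the polynomial of \<open>weber_exponent\<close> is odd under either sign
  change.\<close>

lemma weber_exponent_pair_mod_3:
  assumes p: "prime p" "p mod 3 = 2" and M: "N = p * M" and e: "e dvd M"
    and P: "weber_exponent (gA e) (gB e) (gC e) (gD e) P" "weber_exponent (gA (p * e)) (gB (p * e)) (gC (p * e)) (gD (p * e)) Q"
  shows "3 dvd P + Q"
proof -
  have cpM: "coprime p M" by (rule squarefree_cofactor_coprime[OF squarefree_N M])
  hence cpe: "coprime p e" using e by (meson coprime_divisors dvd_refl)
  have p0: "p > 0" using p by (simp add: prime_gt_0_nat)
  have eN: "e dvd N" using e M by simp
  define g where "g = gcd e u"
  obtain u1 e2 v2 where w: "u = g * u1" "e = g * e2" "v = e2 * v2"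
    using divisor_split[OF squarefree_N N_pos N_eq eN] unfolding g_def by metis
  have pos: "g > 0" "e2 > 0" using w eN N_pos uv_pos by (auto intro!: Nat.gr0I)
  have pm: "[int p = - 1] (mod 3)"
    unfolding cong_iff_dvd_diff using p(2) by presburger
  let ?f = "\<lambda>A B C D :: int. 2 * A * B + A * C + B * D + 2 * A\<^sup>2 * B * D"
  have fneg: "[?f A B C D + ?f A' B' C' D' = 0] (mod 3)"
    if "[A' = - A] (mod 3)" "[D' = - D] (mod 3)" "[B' = B] (mod 3)" "[C' = C] (mod 3)" for A B C D A' B' C' D' :: int
  proof -
    have "[?f A' B' C' D' = ?f (- A) B C (- D)] (mod 3)"
      by (intro that cong_add cong_mult cong_pow cong_refl)
    hence "[?f A B C D + ?f A' B' C' D' = ?f A B C D + ?f (- A) B C (- D)] (mod 3)"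
      by (rule cong_add[OF cong_refl])
    thus ?thesis by simp
  qed
  have fneg': "[?f A B C D + ?f A' B' C' D' = 0] (mod 3)"
    if "[A' = A] (mod 3)" "[D' = D] (mod 3)" "[B' = - B] (mod 3)" "[C' = - C] (mod 3)" for A B C D A' B' C' D' :: int
  proof -
    have "[?f A' B' C' D' = ?f A (- B) (- C) D] (mod 3)"
      by (intro that cong_add cong_mult cong_pow cong_refl)
    hence "[?f A B C D + ?f A' B' C' D' = ?f A B C D + ?f A (- B) (- C) D] (mod 3)"
      by (rule cong_add[OF cong_refl])
    thus ?thesis by simp
  qed
  have neg: "[x' = - x] (mod 3)" if "x' = int p * x \<or> x = int p * x'" for x x' :: int
  proof -
    have "[int p * y = - 1 * y] (mod 3)" for y by (intro cong_mult pm cong_refl)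
    hence 1: "[int p * y = - y] (mod 3)" for y by simp
    from that show ?thesis
    proof
      assume "x' = int p * x" thus ?thesis using 1 by simp
    next
      assume "x = int p * x'"
      hence "[x = - x'] (mod 3)" using 1 by simp
      hence "[- x = x'] (mod 3)" by (metis cong_minus_minus_iff minus_minus)
      thus ?thesis by (rule cong_sym)
    qed
  qed
  have key: "[?f (gA e) (gB e) (gC e) (gD e) + ?f (gA (p * e)) (gB (p * e)) (gC (p * e)) (gD (p * e)) = 0] (mod 3)"
  proof (cases "p dvd u")
    case True
    have "p dvd u1"
    proof (rule ccontr)
      assume "\<not> p dvd u1"
      hence "p dvd g" using True p(1) w(1) by (simp add: prime_dvd_mult_iff)
      hence "p dvd e" using w(2) by simp
      thus False using cpe p(1) by (metis coprime_common_divisor dvd_refl not_prime_unit)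
    qed
    then obtain u2 where u2: "u1 = p * u2" by (elim dvdE)
    have "coprime e2 u2"
    proof -
      have "g * 1 = g * gcd e2 u1"
        unfolding gcd_mult_distrib_nat w(1,2)[symmetric] by (simp add: g_def)
      hence "gcd e2 u1 = 1" using pos by simp
      thus ?thesis unfolding u2 by (metis coprime_iff_gcd_eq_1 coprime_mult_right_iff)
    qed
    hence "gcd (p * e) u = p * g"
      unfolding w(1,2) u2 by (simp add: gcd_mult_distrib_nat[symmetric] mult.left_commute[of _ p])
    hence "gA (p * e) = int p * gA e" "gB (p * e) = gB e" "gC (p * e) = gC e" "gD e = int p * gD (p * e)"
      unfolding gA_def gB_def gC_def gD_def g_def[symmetric]
      using p0 pos by (simp_all add: w(1,2) u2)
    thus ?thesis by (intro fneg neg) auto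
  next
    case False
    hence cpu: "coprime p u" using p(1) by (simp add: prime_imp_coprime)
    hence gp: "gcd (p * e) u = g" unfolding g_def
      by (intro gcd_mult_left_left_cancel) (simp add: coprime_commute)
    have pe2: "p * e div g = p * e2" using w(2) pos by simp
    have "p dvd v" using M N_eq p(1) cpu by (metis coprime_dvd_mult_right_iff dvd_triv_left)
    moreover have "coprime p e2" using cpe w(2) by simp
    ultimately have "p dvd v2" using w(3) by (simp add: coprime_dvd_mult_right_iff)
    then obtain v3 where v3: "v2 = p * v3" by (elim dvdE)
    have "gA (p * e) = gA e" "gB (p * e) = int p * gB e" "gC e = int p * gC (p * e)" "gD (p * e) = gD e"
      unfolding gA_def gB_def gC_def gD_def gp g_def[symmetric] pe2
      using p0 pos by (simp_all add: w(2,3) v3)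
    thus ?thesis by (intro fneg' neg) auto
  qed
  have "[P + Q = ?f (gA e) (gB e) (gC e) (gD e) + ?f (gA (p * e)) (gB (p * e)) (gC (p * e)) (gD (p * e))] (mod 3)"
    using P unfolding weber_exponent_def by (intro cong_add) auto
  from cong_trans[OF this key] show ?thesis by (simp add: cong_0_iff)
qed

text \<open>Either 3 divides s, or the divisors of N = p M are grouped into the pairs e, p e with e
  | M.\<close>

lemma weber_exponent_sum_mod_3:
  assumes P: "\<And>e. e \<in> divisors N \<Longrightarrow> weber_exponent (gA e) (gB e) (gC e) (gD e) (P e)"
  shows "3 dvd int s * (\<Sum>e\<in>divisors N. P e)"
proof (cases "3 dvd \<Sum>(divisors N)")
  case False
  have "3 dvd s * \<Sum>(divisors N)" unfolding s_sigma by simp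
  hence "3 dvd s" using False prime_dvd_mult_iff[of "3 :: nat"] by simp
  hence "int 3 dvd int s" by (simp only: of_nat_dvd_iff)
  thus ?thesis by simp
next
  case True
  then obtain p where p: "prime p" "p mod 3 = 2" "p dvd N" using three_dvd_sigma by blast
  then obtain M where M: "N = p * M" by (elim dvdE)
  have M0: "M > 0" using N_pos M by (auto intro: Nat.gr0I)
  have cpM: "coprime p M" by (rule squarefree_cofactor_coprime[OF squarefree_N M])
  have p0: "p > 0" using p by (simp add: prime_gt_0_nat)
  have D: "divisors N = divisors M \<union> (*) p ` divisors M"
  proof -
    have "e dvd M \<or> (\<exists>d. e = p * d \<and> d dvd M)" if "e dvd p * M" for e
    proof (cases "p dvd e")
      case True
      then obtain d where "e = p * d" by (elim dvdE)
      thus ?thesis using that p0 by auto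
    next
      case False
      hence "coprime e p" using p(1) by (metis coprime_commute prime_imp_coprime)
      thus ?thesis using that by (simp add: coprime_dvd_mult_right_iff)
    qed
    thus ?thesis unfolding M by (auto simp: divisors_def)
  qed
  have disj: "divisors M \<inter> (*) p ` divisors M = {}"
  proof -
    have "\<not> p dvd e" if "e dvd M" for e
      using that cpM p(1) by (metis coprime_common_divisor dvd_refl dvd_trans not_prime_unit)
    from this[of "p * _"] show ?thesis by (auto simp: divisors_def)
  qed
  have "(\<Sum>e\<in>divisors N. P e) = (\<Sum>e\<in>divisors M. P e) + (\<Sum>e\<in>(*) p ` divisors M. P e)"
    unfolding D using finite_divisors[OF M0] disj by (intro sum.union_disjoint) auto
  also have "(\<Sum>e\<in>(*) p ` divisors M. P e) = (\<Sum>e\<in>divisors M. P (p * e))"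
    using p0 by (subst sum.reindex) (auto simp: inj_on_def)
  finally have "(\<Sum>e\<in>divisors N. P e) = (\<Sum>e\<in>divisors M. P e + P (p * e))"
    by (simp only: sum.distrib)
  moreover have "3 dvd (\<Sum>e\<in>divisors M. P e + P (p * e))"
  proof (rule dvd_sum)
    fix e assume e: "e \<in> divisors M"
    hence "e \<in> divisors N" "p * e \<in> divisors N" using D by auto
    moreover have "e dvd M" using e by (simp add: divisors_def)
    ultimately show "3 dvd P e + P (p * e)"
      using weber_exponent_pair_mod_3[OF p(1,2) M _ P P] by blast
  qed
  ultimately show ?thesis by simp
qed

lemma g2_al:
  assumes z: "z \<in> upper_half_plane"
  shows "g2 N (act (al_mat N (\<kappa>\<^sup>2 * u) a b c d) z) = g2 N z"
proof -
  let ?W = "al_mat N (\<kappa>\<^sup>2 * u) a b c d"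
  define \<zeta> where "\<zeta> = exp (- of_real pi * \<i> / 12)"
  have \<zeta>0: "\<zeta> \<noteq> 0" by (simp add: \<zeta>_def)
  have "\<zeta> ^ 24 = exp (of_nat 24 * (- of_real pi * \<i> / 12))" unfolding \<zeta>_def by (rule exp_of_nat_mult[symmetric])
  also have "\<dots> = inverse (exp (2 * of_real pi * \<i>))" unfolding exp_minus[symmetric] by (rule arg_cong[where f = exp]) simp
  also have "\<dots> = 1" unfolding exp_two_pi_i by simp
  finally have \<zeta>24: "\<zeta> ^ 24 = 1" .
  have "\<forall>e\<in>divisors N. \<exists>P. weber_exponent (gA e) (gB e) (gC e) (gD e) P \<and>
      (\<forall>z\<in>upper_half_plane. weber (act (int_mat (gA e) (gB e) (gC e) (gD e)) z) = \<zeta> powi P * weber z)"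
  proof
    fix e assume "e \<in> divisors N"
    hence "e dvd N" by (simp add: divisors_def)
    from weber_theta_group[OF al_entries(2)[OF this]]
    show "\<exists>P. weber_exponent (gA e) (gB e) (gC e) (gD e) P \<and>
      (\<forall>z\<in>upper_half_plane. weber (act (int_mat (gA e) (gB e) (gC e) (gD e)) z) = \<zeta> powi P * weber z)"
      unfolding \<zeta>_def by metis
  qed
  then obtain P where P: "\<And>e. e \<in> divisors N \<Longrightarrow> weber_exponent (gA e) (gB e) (gC e) (gD e) (P e)"
    "\<And>e z. e \<in> divisors N \<Longrightarrow> z \<in> upper_half_plane \<Longrightarrow>
       weber (act (int_mat (gA e) (gB e) (gC e) (gD e)) z) = \<zeta> powi P e * weber z"
    by (auto simp: bchoice_iff)
  have "weber (of_nat e * act ?W z) = \<zeta> powi P e * weber (of_nat (al_perm u e) * z)" if e: "e \<in> divisors N" for e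
  proof -
    have e': "e dvd N" using e by (simp add: divisors_def)
    have "of_nat e * act ?W z = act (int_mat (gA e) (gB e) (gC e) (gD e)) (of_nat (al_perm u e) * z)"
      by (rule scale_act(1)[OF al_entries(6)[OF e'] scale_factor_pos divisors_pos[OF N_pos e] al_entries(7)[OF e']])
        (use det_al_mat_level al_entries(1)[OF e'] z in \<open>auto simp: det_int_mat\<close>)
    thus ?thesis using P(2)[OF e upper_mult_of_nat[OF z al_entries(7)[OF e']]] by simp
  qed
  hence "weber_prod N (act ?W z) = (\<Prod>e\<in>divisors N. \<zeta> powi P e) * (\<Prod>e\<in>divisors N. weber (of_nat (al_perm u e) * z))"
    unfolding weber_prod_def prod.distrib[symmetric] by (intro prod.cong) auto
  also have "(\<Prod>e\<in>divisors N. weber (of_nat (al_perm u e) * z)) = weber_prod N z"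
    unfolding weber_prod_def by (rule prod_al_perm)
  also have "(\<Prod>e\<in>divisors N. \<zeta> powi P e) = \<zeta> powi (\<Sum>e\<in>divisors N. P e)"
    using finite_divisors[OF N_pos] \<zeta>0 by (induction rule: finite_induct) (auto simp: power_int_add)
  finally have wp: "weber_prod N (act ?W z) = \<zeta> powi (\<Sum>e\<in>divisors N. P e) * weber_prod N z" .
  have "24 dvd int s * (\<Sum>e\<in>divisors N. P e)"
  proof -
    have "24 dvd x" if "8 dvd x" "3 dvd x" for x :: int using that by presburger
    thus ?thesis
      using weber_exponent_sum_mod_8[OF P(1)] weber_exponent_sum_mod_3[OF P(1)] by blast
  qed
  then obtain r where r: "int s * (\<Sum>e\<in>divisors N. P e) = 24 * r" by (elim dvdE)
  have "(\<zeta> powi (\<Sum>e\<in>divisors N. P e)) ^ s = \<zeta> powi (int s * (\<Sum>e\<in>divisors N. P e))"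
    by (simp only: mult.commute[of "int s"] power_int_mult power_int_of_nat)
  also have "\<dots> = (\<zeta> powi 24) powi r" unfolding r by (rule power_int_mult)
  also have "\<zeta> powi 24 = \<zeta> ^ 24" by (rule power_int_numeral)
  finally have "(\<zeta> powi (\<Sum>e\<in>divisors N. P e)) ^ s = 1" unfolding \<zeta>24 by simp
  hence "inverse (weber_prod N (act ?W z)) ^ s = inverse (weber_prod N z) ^ s"
    unfolding wp by (simp add: power_mult_distrib power_inverse)
  thus ?thesis using z act_in_upper[OF z, of ?W] det_al_mat_level by (simp add: g2_eq')
qed

end

end

section \<open>The group \<open>\<onehalf>\<Gamma>\<^sub>0(4N)+\<close>\<close>

lemma group_SL2R: "group SL2R"
proof (rule groupI)
  fix A assume "A \<in> carrier SL2R"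
  hence d: "det A = 1" by (simp add: SL2R_def)
  then obtain B where B: "B ** A = mat 1"
    using invertible_det_nz[of A] unfolding invertible_def by auto
  moreover from this have "det B = 1"
    using d by (metis det_I det_mul mult.right_neutral)
  ultimately show "\<exists>B\<in>carrier SL2R. B \<otimes>\<^bsub>SL2R\<^esub> A = \<one>\<^bsub>SL2R\<^esub>"
    by (intro bexI[of _ B]) (simp_all add: SL2R_def)
qed (simp_all add: SL2R_def det_mul matrix_mul_assoc)

text \<open>Conjugation by diag(2, 1), hence multiplicative; generation and inverses can be treated
  before it is applied.\<close>

definition half_mat :: "real^2^2 \<Rightarrow> real^2^2" where
  "half_mat A = mat2 (A$1$1) (2 * A$1$2) (A$2$1 / 2) (A$2$2)"

lemma half_group_eq: "half_group \<Gamma> = half_mat ` \<Gamma>"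
proof -
  have "X \<in> half_group \<Gamma> \<longleftrightarrow> X \<in> half_mat ` \<Gamma>" for X
  proof
    assume "X \<in> half_group \<Gamma>"
    then obtain a b c d where "X = mat2 a (2 * b) (c / 2) d" "mat2 a b c d \<in> \<Gamma>"
      unfolding half_group_def by blast
    thus "X \<in> half_mat ` \<Gamma>" by (intro image_eqI[of _ _ "mat2 a b c d"]) (simp_all add: half_mat_def)
  next
    assume "X \<in> half_mat ` \<Gamma>"
    then obtain A where "A \<in> \<Gamma>" "X = half_mat A" by blast
    thus "X \<in> half_group \<Gamma>"
      unfolding half_group_def half_mat_def
      by (intro CollectI exI[of _ "A$1$1"] exI[of _ "A$1$2"] exI[of _ "A$2$1"] exI[of _ "A$2$2"])
        (simp add: mat2_eta)
  qed
  thus ?thesis by blast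
qed

lemma half_mat_mult: "half_mat (A ** B) = half_mat A ** half_mat B"
  unfolding half_mat_def mat2_mult mat2_eq_iff
  by (simp add: matrix_matrix_mult_def sum_2 algebra_simps)

lemma half_mat_1: "half_mat (mat 1) = mat 1"
  by (simp add: half_mat_def mat_1_eq_mat2)

lemma det_half_mat: "det (half_mat A) = det A"
  by (simp add: half_mat_def det_mat2 det_2)

lemma half_mat_al: "half_mat ((1 / sqrt (real m)) *\<^sub>R mat2 (of_int (int m * a)) (of_int b) (of_int (int (4 * N) * c)) (of_int (int m * d)))
    = al_mat N m a b c d"
  by (simp add: half_mat_def al_mat_def int_mat_def scaleR_mat2 mat2_eq_iff)

text \<open>The determinant relation also shows that m and n are coprime, so m is an exact divisor
  of 4N.\<close>

lemma al_mat_in_modular_group: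
  assumes m: "m > 0" "m * n = 4 * N" and det: "int m * a * d - int n * b * c = 1"
  shows "al_mat N m a b c d \<in> modular_group N"
proof -
  have "coprime (int m) (int n)"
  proof (rule coprimeI)
    fix k assume "k dvd int m" "k dvd int n"
    hence "k dvd int m * a * d - int n * b * c" by (intro dvd_diff) (simp_all add: mult.assoc)
    thus "is_unit k" using det by simp
  qed
  hence "exact_dvd m (4 * N)"
    using m by (simp add: exact_dvd_def m(2)[symmetric])
  moreover have "int m * a * (int m * d) - b * (int (4 * N) * c) = int m"
  proof -
    have "int m * a * (int m * d) - b * (int (m * n) * c) = int m * (int m * a * d - int n * b * c)"
      by (simp add: algebra_simps)
    thus ?thesis unfolding det m(2) by simp
  qed
  ultimately have "(1 / sqrt (real m)) *\<^sub>R mat2 (of_int (int m * a)) (of_int b) (of_int (int (4 * N) * c)) (of_int (int m * d))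
      \<in> Gamma0_plus (4 * N)"
    unfolding Gamma0_plus_def by (intro generate.incl) (auto simp: atkin_lehner_def)
  thus ?thesis
    unfolding modular_group_def half_group_eq half_mat_al[symmetric] by (rule imageI)
qed

context square_free_level
begin

text \<open>The levels m and 4N/m are coprime, so the factor 4 lies entirely in one of them:
  \<open>\<kappa>\<close> is 1 for odd m and 2 for even m.\<close>

lemma exact_dvd_cases:
  assumes "exact_dvd m (4 * N)"
  obtains \<kappa> \<kappa>' u v where "\<kappa> * \<kappa>' = 2" "N = u * v" "m = \<kappa>\<^sup>2 * u"
proof -
  define n where "n = 4 * N div m"
  have mn: "m * n = 4 * N" "coprime m n" using assms by (auto simp: exact_dvd_def n_def)
  show thesis
  proof (cases "even m")
    case False
    hence "coprime m 4" using coprime_power_right_iff[of m 2 2] by simp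
    hence "m dvd N" using mn(1) by (metis coprime_dvd_mult_right_iff dvd_triv_left)
    then obtain v where "N = m * v" by (elim dvdE)
    thus thesis using that[of 1 2 m v] by simp
  next
    case True
    hence "odd n" using mn(2) by (metis coprime_common_divisor odd_one)
    hence "coprime n 4" using coprime_power_right_iff[of n 2 2] by simp
    hence "n dvd N" using mn(1) by (metis coprime_dvd_mult_right_iff dvd_triv_right)
    then obtain u where u: "N = n * u" by (elim dvdE)
    have "n > 0" using N_pos u by (auto intro: Nat.gr0I)
    hence "m = 4 * u" using mn(1) u by simp
    thus thesis using that[of 2 1 u n] u by simp
  qed
qed

lemma al_mat_invariance:
  assumes m: "m > 0" "exact_dvd m (4 * N)" and det: "int m * a * (int m * d) - b * (int (4 * N) * c) = int m"
  shows "det (al_mat N m a b c d) = 1"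
    and "transf (g1_weight N) (g1 N) (al_mat N m a b c d) (g1 N)"
    and "z \<in> upper_half_plane \<Longrightarrow> g2 N (act (al_mat N m a b c d) z) = g2 N z"
proof -
  obtain \<kappa> \<kappa>' u v where k: "\<kappa> * \<kappa>' = 2" "N = u * v" "m = \<kappa>\<^sup>2 * u" using exact_dvd_cases[OF m(2)] .
  have "int \<kappa> ^ 2 * int \<kappa>' ^ 2 = int (\<kappa> * \<kappa>') ^ 2" by (simp add: power_mult_distrib)
  hence kk: "int \<kappa> ^ 2 * int \<kappa>' ^ 2 = 4" unfolding k(1) by simp
  have "int m * a * (int m * d) - b * (int (4 * N) * c) = int m * a * (int m * d) - b * ((int \<kappa> ^ 2 * int \<kappa>' ^ 2) * int u * int v * c)"
    unfolding kk by (simp add: k(2))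
  also have "\<dots> = int m * (int \<kappa> ^ 2 * int u * a * d - int \<kappa>' ^ 2 * int v * b * c)"
    by (simp add: k(3) algebra_simps power2_eq_square)
  finally have "int m * (int \<kappa> ^ 2 * int u * a * d - int \<kappa>' ^ 2 * int v * b * c) = int m * 1"
    using det by simp
  hence d: "int \<kappa> ^ 2 * int u * a * d - int \<kappa>' ^ 2 * int v * b * c = 1" using m(1) by simp
  show "det (al_mat N m a b c d) = 1" unfolding k(3) by (rule det_al_mat_level[OF k(2,1) d])
  show "transf (g1_weight N) (g1 N) (al_mat N m a b c d) (g1 N)" unfolding k(3) by (rule g1_al[OF k(2,1) d])
  show "z \<in> upper_half_plane \<Longrightarrow> g2 N (act (al_mat N m a b c d) z) = g2 N z"
    unfolding k(3) by (rule g2_al[OF k(2,1) d])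
qed

lemma modular_group_invariance:
  assumes "\<gamma> \<in> modular_group N"
  shows "det \<gamma> = 1" and "transf (g1_weight N) (g1 N) \<gamma> (g1 N)"
    and "z \<in> upper_half_plane \<Longrightarrow> g2 N (act \<gamma> z) = g2 N z"
proof -
  \<comment> \<open>The determinant is part of the induction: it places the generators in
    \<open>SL2R\<close>, so that the group inverse is the inverse matrix.\<close>
  define Q where "Q = (\<lambda>A. det A = 1 \<and> transf (g1_weight N) (g1 N) A (g1 N) \<and>
    (\<forall>z\<in>upper_half_plane. g2 N (act A z) = g2 N z))"
  let ?S = "Gamma0 (4 * N) \<union> (\<Union>m\<in>{m. exact_dvd m (4 * N)}. atkin_lehner (4 * N) m)"
  have Q_gen: "Q (half_mat A)" if "A \<in> ?S" for A
  proof -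
    have "\<exists>m a b c d. m > 0 \<and> exact_dvd m (4 * N) \<and> int m * a * (int m * d) - b * (int (4 * N) * c) = int m \<and>
        half_mat A = al_mat N m a b c d"
      using that
    proof
      assume "A \<in> Gamma0 (4 * N)"
      then obtain a b c d where A: "A = mat2 (of_int a) (of_int b) (of_int c) (of_int d)" "a * d - b * c = 1" "int (4 * N) dvd c"
        unfolding Gamma0_def by blast
      then obtain c' where c: "c = int (4 * N) * c'" by (elim dvdE)
      have "half_mat A = al_mat N 1 a b c' d"
        unfolding half_mat_al[symmetric] by (simp add: A c)
      moreover have "exact_dvd 1 (4 * N)" by (simp add: exact_dvd_def)
      ultimately show ?thesis using A(2) c by (intro exI[of _ 1] exI[of _ a] exI[of _ b] exI[of _ c'] exI[of _ d]) simp
    next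
      assume "A \<in> (\<Union>m\<in>{m. exact_dvd m (4 * N)}. atkin_lehner (4 * N) m)"
      then obtain m where m: "exact_dvd m (4 * N)" "A \<in> atkin_lehner (4 * N) m" by blast
      then obtain a b c d where A: "A = (1 / sqrt (real m)) *\<^sub>R
          mat2 (of_int (int m * a)) (of_int b) (of_int (int (4 * N) * c)) (of_int (int m * d))"
        "(int m * a) * (int m * d) - b * (int (4 * N) * c) = int m"
        unfolding atkin_lehner_def by blast
      have "m > 0" using m(1) N_pos by (auto simp: exact_dvd_def intro!: Nat.gr0I)
      moreover have "half_mat A = al_mat N m a b c d"
        unfolding A(1) by (rule half_mat_al)
      ultimately show ?thesis using A(2) m(1) by blast
    qed
    thus ?thesis unfolding Q_def using al_mat_invariance by metis
  qed
  have "Q (half_mat A)" if "A \<in> generate SL2R ?S" for A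
    using that
  proof induction
    case one
    have "transf (g1_weight N) (g1 N) (mat 1) (g1 N)"
      by (rule transfI[of 1]) (simp_all add: aut_factor_jac)
    thus ?case by (simp add: SL2R_def half_mat_1 Q_def)
  next
    case (incl h) thus ?case by (rule Q_gen)
  next
    case (inv h)
    define h' where "h' = inv\<^bsub>SL2R\<^esub> h"
    have Qh: "Q (half_mat h)" by (rule Q_gen[OF inv])
    hence "h \<in> carrier SL2R" by (simp add: Q_def SL2R_def det_half_mat)
    hence "h \<otimes>\<^bsub>SL2R\<^esub> h' = \<one>\<^bsub>SL2R\<^esub>" "h' \<in> carrier SL2R"
      unfolding h'_def using group.r_inv[OF group_SL2R] group.inv_closed[OF group_SL2R] by blast+
    hence hh: "h ** h' = mat 1" "det (half_mat h') = 1" by (simp_all add: SL2R_def det_half_mat)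
    have hh': "half_mat h ** half_mat h' = mat 1" unfolding half_mat_mult[symmetric] hh(1) half_mat_1 ..
    have "g2 N (act (half_mat h') z) = g2 N z" if z: "z \<in> upper_half_plane" for z
    proof -
      have "g2 N (act (half_mat h') z) = g2 N (act (half_mat h) (act (half_mat h') z))"
        using Qh act_in_upper[OF z, of "half_mat h'"] hh(2) by (simp add: Q_def)
      also have "act (half_mat h) (act (half_mat h') z) = act (half_mat h ** half_mat h') z"
        using act_mult[OF z, of "half_mat h" "half_mat h'"] Qh hh(2) by (simp add: Q_def)
      finally show ?thesis unfolding hh' by simp
    qed
    moreover have "transf (g1_weight N) (g1 N) (half_mat h') (g1 N)"
      using transf_inverse[OF _ _ _ hh', of "g1_weight N" "g1 N" "g1 N"] Qh hh(2) by (simp add: Q_def)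
    ultimately show ?case unfolding Q_def h'_def[symmetric] using hh(2) by blast
  next
    case (eng h1 h2)
    have "det (half_mat h1 ** half_mat h2) = 1" using eng.IH by (simp add: Q_def det_mul)
    moreover have "transf (g1_weight N) (g1 N) (half_mat h1 ** half_mat h2) (g1 N)"
      using eng.IH by (intro transf_mult) (auto simp: Q_def)
    moreover have "g2 N (act (half_mat h1 ** half_mat h2) z) = g2 N z" if "z \<in> upper_half_plane" for z
      using eng.IH that act_mult[of z "half_mat h1" "half_mat h2"] act_in_upper[of z "half_mat h2"] by (simp add: Q_def)
    ultimately show ?case unfolding Q_def by (simp add: SL2R_def half_mat_mult)
  qed
  moreover obtain A where "\<gamma> = half_mat A" "A \<in> generate SL2R ?S"
    using assms unfolding modular_group_def half_group_eq Gamma0_plus_def by blast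
  ultimately have "Q \<gamma>" by blast
  thus "det \<gamma> = 1" "transf (g1_weight N) (g1 N) \<gamma> (g1 N)"
    "z \<in> upper_half_plane \<Longrightarrow> g2 N (act \<gamma> z) = g2 N z" by (auto simp: Q_def)
qed

text \<open>The description in \<open>g1_character\<close> is well defined: evaluation at i, where
  \<open>g1\<close> and the factor of automorphy do not vanish, leaves only the constant from
  \<open>transf\<close>.\<close>

lemma g1_character:
  assumes \<gamma>: "\<gamma> \<in> modular_group N"
  shows "g1_character N \<gamma> \<noteq> 0"
    and "z \<in> upper_half_plane \<Longrightarrow> g1 N (act \<gamma> z) = g1_character N \<gamma> * aut_factor (g1_weight N) \<gamma> z * g1 N z"
proof -
  obtain \<kappa> where \<kappa>: "\<kappa> \<noteq> 0" "\<And>z. z \<in> upper_half_plane \<Longrightarrow> g1 N (act \<gamma> z) = \<kappa> * aut_factor (g1_weight N) \<gamma> z * g1 N z"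
    using modular_group_invariance(2)[OF \<gamma>] unfolding transf_def by blast
  have "g1_character N \<gamma> = \<kappa>"
    unfolding g1_character_def
  proof (rule the_equality)
    fix c assume "\<forall>z\<in>upper_half_plane. g1 N (act \<gamma> z) = c * aut_factor (g1_weight N) \<gamma> z * g1 N z"
    hence "c * aut_factor (g1_weight N) \<gamma> \<i> * g1 N \<i> = \<kappa> * aut_factor (g1_weight N) \<gamma> \<i> * g1 N \<i>"
      using \<kappa>(2)[of \<i>] by simp
    thus "c = \<kappa>"
      using aut_factor_nonzero[of \<i> \<gamma>] modular_group_invariance(1)[OF \<gamma>] g1_nonzero[OF N_pos, of \<i>] by simp
  qed (use \<kappa> in blast)
  thus "g1_character N \<gamma> \<noteq> 0"
    "z \<in> upper_half_plane \<Longrightarrow> g1 N (act \<gamma> z) = g1_character N \<gamma> * aut_factor (g1_weight N) \<gamma> z * g1 N z"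
    using \<kappa> by auto
qed

end

section \<open>Local expansions at infinity and at 1\<close>

section \<open>Leading exponents at infinity\<close>

text \<open>Exponents are counted in exp(pi i z) at every cusp; at a cusp of width h the exponent
  alpha means order alpha h / 2.\<close>

definition leading :: "real \<Rightarrow> (complex \<Rightarrow> complex) \<Rightarrow> bool" where
  "leading \<alpha> f \<longleftrightarrow> (\<exists>L. L \<noteq> 0 \<and> ((\<lambda>z. f z / exp (of_real pi * \<i> * of_real \<alpha> * z)) \<longlongrightarrow> L) at_iinfinity)"

lemma leading_const: "c \<noteq> 0 \<Longrightarrow> leading 0 (\<lambda>z. c)"
  unfolding leading_def by (intro exI[of _ c]) simp

lemma leading_mult:
  assumes "leading \<alpha> f" "leading \<beta> g" shows "leading (\<alpha> + \<beta>) (\<lambda>z. f z * g z)"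
proof -
  obtain L M where L: "L \<noteq> 0" "((\<lambda>z. f z / exp (of_real pi * \<i> * of_real \<alpha> * z)) \<longlongrightarrow> L) at_iinfinity"
    and M: "M \<noteq> 0" "((\<lambda>z. g z / exp (of_real pi * \<i> * of_real \<beta> * z)) \<longlongrightarrow> M) at_iinfinity"
    using assms unfolding leading_def by blast
  have eq: "exp (of_real pi * \<i> * of_real (\<alpha> + \<beta>) * z) =
      exp (of_real pi * \<i> * of_real \<alpha> * z) * exp (of_real pi * \<i> * of_real \<beta> * z)" for z
    by (simp add: exp_add[symmetric] algebra_simps)
  show ?thesis unfolding leading_def eq
    using tendsto_mult[OF L(2) M(2)] L(1) M(1) by (intro exI[of _ "L * M"]) simp
qed

lemma leading_inverse:
  assumes "leading \<alpha> f" shows "leading (- \<alpha>) (\<lambda>z. inverse (f z))"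
proof -
  obtain L where L: "L \<noteq> 0" "((\<lambda>z. f z / exp (of_real pi * \<i> * of_real \<alpha> * z)) \<longlongrightarrow> L) at_iinfinity"
    using assms unfolding leading_def by blast
  have eq: "exp (of_real pi * \<i> * of_real (- \<alpha>) * z) = inverse (exp (of_real pi * \<i> * of_real \<alpha> * z))" for z
    by (simp add: exp_minus)
  show ?thesis unfolding leading_def eq
    using tendsto_inverse[OF L(2,1)] L(1) by (intro exI[of _ "inverse L"]) (simp add: divide_inverse)
qed

lemma leading_divide:
  "leading \<alpha> f \<Longrightarrow> leading \<beta> g \<Longrightarrow> leading (\<alpha> - \<beta>) (\<lambda>z. f z / g z)"
  using leading_mult[of \<alpha> f "- \<beta>" "\<lambda>z. inverse (g z)"] leading_inverse by (simp add: divide_inverse)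

lemma leading_power: "leading \<alpha> f \<Longrightarrow> leading (real n * \<alpha>) (\<lambda>z. f z ^ n)"
proof (induction n)
  case (Suc n)
  thus ?case using leading_mult[of \<alpha> f "real n * \<alpha>" "\<lambda>z. f z ^ n"] by (simp add: distrib_right)
qed (simp add: leading_const)

lemma leading_prod:
  assumes "finite I" "\<And>i. i \<in> I \<Longrightarrow> leading (\<alpha> i) (f i)"
  shows "leading (\<Sum>i\<in>I. \<alpha> i) (\<lambda>z. \<Prod>i\<in>I. f i z)"
  using assms
proof (induction I rule: finite_induct)
  case (insert i I)
  thus ?case using leading_mult[of "\<alpha> i" "f i" "\<Sum>i\<in>I. \<alpha> i" "\<lambda>z. \<Prod>i\<in>I. f i z"] by simp
qed (simp add: leading_const)

lemma leading_cong:
  assumes "leading \<alpha> f" "\<And>z. z \<in> upper_half_plane \<Longrightarrow> f z = g z"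
  shows "leading \<alpha> g"
proof -
  obtain L where L: "L \<noteq> 0" "((\<lambda>z. f z / exp (of_real pi * \<i> * of_real \<alpha> * z)) \<longlongrightarrow> L) at_iinfinity"
    using assms unfolding leading_def by blast
  have "\<forall>\<^sub>F z in at_iinfinity. f z / exp (of_real pi * \<i> * of_real \<alpha> * z) = g z / exp (of_real pi * \<i> * of_real \<alpha> * z)"
    using eventually_at_iinfinity_upper by eventually_elim (simp add: assms(2))
  from Lim_transform_eventually[OF L(2) this] L(1) show ?thesis
    unfolding leading_def by blast
qed

lemma leading_affine:
  assumes "leading \<alpha> f" "a > 0"
  shows "leading (\<alpha> * a) (\<lambda>z. f (of_real a * z + of_real b))"
proof -
  obtain L where L: "L \<noteq> 0" "((\<lambda>z. f z / exp (of_real pi * \<i> * of_real \<alpha> * z)) \<longlongrightarrow> L) at_iinfinity"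
    using assms unfolding leading_def by blast
  define k where "k = exp (of_real pi * \<i> * of_real (\<alpha> * b))"
  have k: "k \<noteq> 0" by (simp add: k_def)
  have "((\<lambda>z. f (of_real a * z + of_real b) / exp (of_real pi * \<i> * of_real \<alpha> * (of_real a * z + of_real b))) \<longlongrightarrow> L) at_iinfinity"
    by (rule filterlim_compose[OF L(2) filterlim_affine_at_iinfinity[OF assms(2)]])
  moreover have "exp (of_real pi * \<i> * of_real \<alpha> * (of_real a * z + of_real b)) = k * exp (of_real pi * \<i> * of_real (\<alpha> * a) * z)" for z
    unfolding k_def exp_add[symmetric] by (rule arg_cong[where f = exp]) (simp add: algebra_simps)
  ultimately have "((\<lambda>z. k * (f (of_real a * z + of_real b) / (k * exp (of_real pi * \<i> * of_real (\<alpha> * a) * z)))) \<longlongrightarrow> k * L) at_iinfinity"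
    by (intro tendsto_mult tendsto_const) simp
  thus ?thesis
    unfolding leading_def using k L(1) by (intro exI[of _ "k * L"]) simp
qed

lemma leading_scale:
  assumes "leading \<alpha> f" "e > 0"
  shows "leading (\<alpha> * real e) (\<lambda>z. f (of_nat e * z))"
  using leading_affine[OF assms(1), of "real e" 0] assms(2) by simp

lemma leading_tendsto_0:
  assumes "leading \<alpha> f" "\<alpha> > 0" shows "(f \<longlongrightarrow> 0) at_iinfinity"
proof -
  obtain L where L: "L \<noteq> 0" "((\<lambda>z. f z / exp (of_real pi * \<i> * of_real \<alpha> * z)) \<longlongrightarrow> L) at_iinfinity"
    using assms unfolding leading_def by blast
  from tendsto_mult[OF L(2) exp_tendsto_0_at_iinfinity[OF assms(2)]] show ?thesis by simp
qed

lemma leading_unique: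
  assumes "leading \<alpha> f" "leading \<beta> f" shows "\<alpha> = \<beta>"
proof (rule ccontr)
  assume ne: "\<alpha> \<noteq> \<beta>"
  have less: False if *: "leading \<alpha> f" "leading \<beta> f" "\<alpha> < \<beta>" for \<alpha> \<beta>
  proof -
    obtain L where L: "L \<noteq> 0" "((\<lambda>z. f z / exp (of_real pi * \<i> * of_real \<alpha> * z)) \<longlongrightarrow> L) at_iinfinity"
      using * unfolding leading_def by blast
    obtain M where M: "((\<lambda>z. f z / exp (of_real pi * \<i> * of_real \<beta> * z)) \<longlongrightarrow> M) at_iinfinity"
      using * unfolding leading_def by blast
    have eq: "exp (of_real pi * \<i> * of_real \<beta> * z) =
        exp (of_real pi * \<i> * of_real \<alpha> * z) * exp (of_real pi * \<i> * of_real (\<beta> - \<alpha>) * z)" for z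
      unfolding exp_add[symmetric] by (rule arg_cong[where f = exp]) (simp add: algebra_simps)
    have "f z / exp (of_real pi * \<i> * of_real \<beta> * z) * exp (of_real pi * \<i> * of_real (\<beta> - \<alpha>) * z) =
        f z / exp (of_real pi * \<i> * of_real \<alpha> * z)" for z
      unfolding eq by simp
    with tendsto_mult[OF M exp_tendsto_0_at_iinfinity[of "\<beta> - \<alpha>"]] *(3)
    have "((\<lambda>z. f z / exp (of_real pi * \<i> * of_real \<alpha> * z)) \<longlongrightarrow> 0) at_iinfinity" by simp
    from tendsto_unique[OF at_iinfinity_neq_bot L(2) this] have "L = 0" .
    thus False using L by simp
  qed
  from ne consider "\<alpha> < \<beta>" | "\<beta> < \<alpha>" by linarith
  thus False using less[OF assms] less[OF assms(2,1)] by cases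
qed

lemma leading_eta: "leading (1/12) eta"
  unfolding leading_def using eta_at_iinfinity by (intro exI[of _ 1]) simp

lemma leading_weber: "leading (- 1/24) weber"
proof -
  have "leading (real 2 * (1/12)) (\<lambda>z. eta z ^ 2)" by (rule leading_power[OF leading_eta])
  moreover have "leading (1/12 * (1/2) + 1/12 * real 2) (\<lambda>z. eta (of_real (1/2) * z + of_real 0) * eta (of_nat 2 * z))"
    by (intro leading_mult leading_affine leading_scale leading_eta) simp_all
  ultimately have "leading (real 2 * (1/12) - (1/12 * (1/2) + 1/12 * real 2))
      (\<lambda>z. eta z ^ 2 / (eta (of_real (1/2) * z + of_real 0) * eta (of_nat 2 * z)))"
    by (rule leading_divide)
  thus ?thesis by (rule leading_cong[THEN back_subst[of "\<lambda>x. leading x weber"]]) (simp_all add: weber_def)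
qed

lemma leading_jacobi_theta: "leading 0 jacobi_theta"
proof -
  have "leading (real 2 * (- 1/24) + 1/12) (\<lambda>z. weber z ^ 2 * eta z)"
    by (intro leading_mult leading_power leading_weber leading_eta)
  hence "leading 0 (\<lambda>z. weber z ^ 2 * eta z)" by simp
  thus ?thesis by (rule leading_cong) (simp add: jacobi_theta_eq_weber)
qed

section \<open>Behaviour at the cusp 1\<close>

definition cusp1 :: "real^2^2" where "cusp1 = mat2 1 0 1 1"

lemma det_cusp1 [simp]: "det cusp1 = 1"
  by (simp add: cusp1_def det_mat2)

lemma jac_cusp1: "jac cusp1 z = z + 1"
  by (simp add: cusp1_def jac_mat2)

text \<open>As e z / (z + 1) = e - e / (z + 1), the cusp 1 is reached by inverting w = (z + 1)/e and
  translating by e. Only the parity of e will matter for the exponents.\<close>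

lemma scale_act_cusp1:
  assumes z: "z \<in> upper_half_plane" and e: "e > 0"
  defines "w \<equiv> of_real (1 / real e) * z + of_real (1 / real e)"
  shows "of_nat e * act cusp1 z = - 1 / w + of_nat e" "w \<in> upper_half_plane" "z + 1 = of_nat e * w"
proof -
  have w: "w = (z + 1) / of_nat e" by (simp add: w_def add_divide_distrib)
  have z1: "z + 1 \<noteq> 0" using z by (auto simp: upper_half_plane_def complex_eq_iff)
  show "of_nat e * act cusp1 z = - 1 / w + of_nat e"
    using z1 e by (simp add: w cusp1_def act_mat2 field_simps)
  show "w \<in> upper_half_plane" using z e by (simp add: w_def upper_half_plane_def)
  show "z + 1 = of_nat e * w" using e by (simp add: w)
qed

lemma jacobi_theta_add_even:
  assumes "z \<in> upper_half_plane" shows "jacobi_theta (z + of_nat (2 * n)) = jacobi_theta z"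
proof (induction n)
  case (Suc n)
  have "jacobi_theta (z + of_nat (2 * Suc n)) = jacobi_theta ((z + of_nat (2 * n)) + 2)" by (simp add: add_ac)
  also have "\<dots> = jacobi_theta z"
    unfolding Suc[symmetric] using assms by (intro jacobi_theta_T upper_add_real) auto
  finally show ?case .
qed simp

lemma weber_add_even:
  assumes "z \<in> upper_half_plane"
  shows "weber (z + of_nat (2 * n)) = exp (- of_real pi * \<i> / 12) ^ n * weber z"
proof (induction n)
  case (Suc n)
  have "weber (z + of_nat (2 * Suc n)) = weber ((z + of_nat (2 * n)) + 2)" by (simp add: add_ac)
  also have "\<dots> = exp (- of_real pi * \<i> / 12) * weber (z + of_nat (2 * n))"
    using assms by (intro weber_T upper_add_real) auto
  finally show ?case unfolding Suc by simp
qed simp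

text \<open>The right-hand side is the theta constant theta_4; its zero at the inverted cusp is the
  zero of \<open>g1\<close> at 1.\<close>

lemma jacobi_theta_add_1:
  assumes "z \<in> upper_half_plane"
  shows "jacobi_theta (z + 1) = eta (z / 2) ^ 2 / eta z"
proof -
  have z1: "z + 1 \<in> upper_half_plane" using assms by (rule upper_add_real) simp
  define c where "c = exp (of_real pi * \<i> / 12)"
  have "(z + 1 + 1) / 2 = z / 2 + 1" "z + 1 + 1 = z + of_nat 2" by simp_all
  hence "jacobi_theta (z + 1) = (c * eta (z / 2)) ^ 2 / (c ^ 2 * eta z)"
    unfolding jacobi_theta_eq_eta[OF z1] c_def using eta_plus_1[of "z / 2"] eta_add_nat[of z 2] by (simp only:)
  thus ?thesis by (simp add: c_def power_mult_distrib)
qed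

text \<open>The quotient on the right is Weber's f_1, and duplication replaces eta((z +
  1)/2).\<close>

lemma weber_add_1:
  assumes z: "z \<in> upper_half_plane"
  shows "weber (z + 1) = exp (- of_real pi * \<i> / 24) * (eta (z / 2) / eta z)"
proof -
  define c where "c = exp (of_real pi * \<i> / 12)"
  define d where "d = exp (of_real pi * \<i> / 24)"
  have cd: "c \<noteq> 0" "d \<noteq> 0" by (simp_all add: c_def d_def)
  have nz: "eta z \<noteq> 0" "eta (z / 2) \<noteq> 0" "eta (2 * z) \<noteq> 0" using z by (simp_all add: eta_nonzero upper_scale)
  have e: "exp (- of_real pi * \<i> / 24) = 1 / d" by (simp add: d_def exp_minus inverse_eq_divide)
  have "2 * (z + 1) = 2 * z + of_nat 2" by simp
  hence 1: "eta (2 * (z + 1)) = c ^ 2 * eta (2 * z)" using eta_add_nat[of "2 * z" 2] by (simp only: c_def)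
  have 2: "eta ((z + 1) / 2) = d * eta z ^ 3 / (eta (z / 2) * eta (2 * z))"
    using eta_duplication[OF z] nz by (simp add: d_def field_simps)
  have "weber (z + 1) = (c * eta z) ^ 2 / (d * eta z ^ 3 / (eta (z / 2) * eta (2 * z)) * (c ^ 2 * eta (2 * z)))"
    unfolding weber_def eta_plus_1 1 2 c_def by (simp only:)
  also have "\<dots> = 1 / d * (eta (z / 2) / eta z)"
    using cd nz by (simp add: power_mult_distrib) (simp add: field_simps power2_eq_square power3_eq_cube)
  finally show ?thesis unfolding e .
qed

text \<open>For even e the translation is absorbed by the period 2 and inversion returns theta(w),
  of exponent 0. For odd e there remains theta(-1/w + 1), proportional to w^(1/2) eta(2w)^2 /
  eta(w), of exponent 4/12 - 1/12 = 1/4 in w and hence 1/(4e) in z.\<close>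

lemma leading_jacobi_theta_cusp1:
  assumes e: "e > 0"
  shows "leading (if odd e then 1 / (4 * real e) else 0)
           (\<lambda>z. jacobi_theta (of_nat e * act cusp1 z) / aut_factor (1/2) cusp1 z)"
proof -
  obtain K where K: "K \<noteq> 0" "\<And>z. z \<in> upper_half_plane \<Longrightarrow> eta (- 1 / z) = K * z powr (1/2) * eta z"
    using eta_inversion by blast
  let ?w = "\<lambda>z. of_real (1 / real e) * z + of_real (1 / real e) :: complex"
  define \<rho> where "\<rho> = (of_nat e :: complex) powr (1/2)"
  have \<rho>: "\<rho> \<noteq> 0" using e by (simp add: \<rho>_def)
  have aut: "aut_factor (1/2) cusp1 z = \<rho> * ?w z powr (1/2)" if z: "z \<in> upper_half_plane" for z
  proof -
    have "aut_factor (1/2) cusp1 z = (of_real (real e) * ?w z) powr (1/2)"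
      unfolding aut_factor_jac jac_cusp1 scale_act_cusp1(3)[OF z e] by simp
    also have "\<dots> = \<rho> * ?w z powr (1/2)"
      unfolding \<rho>_def using e upper_nonzero[OF scale_act_cusp1(2)[OF z e]] by (subst powr_of_real_mult) simp_all
    finally show ?thesis .
  qed
  have nz: "?w z powr (1/2) \<noteq> 0" if z: "z \<in> upper_half_plane" for z
    using upper_nonzero[OF scale_act_cusp1(2)[OF z e]] by simp
  show ?thesis
  proof (cases "odd e")
    case False
    then obtain n where n: "e = 2 * n" by (metis evenE)
    have "leading (0 + 0 * (1 / real e)) (\<lambda>z. K / \<rho> * jacobi_theta (?w z))"
      using K(1) \<rho> e by (intro leading_mult leading_const leading_affine leading_jacobi_theta) auto
    moreover have "K / \<rho> * jacobi_theta (?w z) = jacobi_theta (of_nat e * act cusp1 z) / aut_factor (1/2) cusp1 z"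
      if z: "z \<in> upper_half_plane" for z
    proof -
      note w = scale_act_cusp1[OF z e]
      have "jacobi_theta (of_nat e * act cusp1 z) = jacobi_theta (- 1 / ?w z)"
        unfolding w(1) using jacobi_theta_add_even[OF neg_inverse_in_upper[OF w(2)], of n] n by simp
      also have "\<dots> = K * ?w z powr (1/2) * jacobi_theta (?w z)"
        unfolding jacobi_theta_eq_weber[OF neg_inverse_in_upper[OF w(2)]] jacobi_theta_eq_weber[OF w(2)] weber_S[OF w(2)] K(2)[OF w(2)]
        by (simp only: mult_ac)
      finally have fin: "jacobi_theta (of_nat e * act cusp1 z) = K * ?w z powr (1/2) * jacobi_theta (?w z)" .
      have gen: "K / \<rho> * t = K * p * t / (\<rho> * p)" if "p \<noteq> 0" for p t using that \<rho> by simp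
      show ?thesis unfolding fin aut[OF z] by (rule gen[OF nz[OF z]])
    qed
    ultimately show ?thesis using False by (simp add: leading_cong)
  next
    case True
    then obtain n where n: "e = 2 * n + 1" by (elim oddE)
    define \<tau> where "\<tau> = (2 :: complex) powr (1/2)"
    have \<tau>: "\<tau> \<noteq> 0" by (simp add: \<tau>_def)
    have l: "leading (real 2 * (1/12 * real 2) - 1/12) (\<lambda>w. eta (of_nat 2 * w) ^ 2 / eta w)"
      by (intro leading_divide leading_power leading_scale leading_eta) simp
    have "leading (0 + (real 2 * (1/12 * real 2) - 1/12) * (1 / real e)) (\<lambda>z. (K * \<tau>\<^sup>2 / \<rho>) * (eta (of_nat 2 * ?w z) ^ 2 / eta (?w z)))"
      using leading_mult[OF leading_const leading_affine[OF l, of "1 / real e" "1 / real e"], of "K * \<tau>\<^sup>2 / \<rho>"] K(1) \<rho> \<tau> e by simp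
    hence "leading (1 / (4 * real e)) (\<lambda>z. (K * \<tau>\<^sup>2 / \<rho>) * (eta (of_nat 2 * ?w z) ^ 2 / eta (?w z)))" by simp
    moreover have "(K * \<tau>\<^sup>2 / \<rho>) * (eta (of_nat 2 * ?w z) ^ 2 / eta (?w z)) = jacobi_theta (of_nat e * act cusp1 z) / aut_factor (1/2) cusp1 z"
      if z: "z \<in> upper_half_plane" for z
    proof -
      note w = scale_act_cusp1[OF z e]
      note u = neg_inverse_in_upper[OF w(2)]
      have p2: "(2 * ?w z) powr (1/2) = \<tau> * ?w z powr (1/2)"
        unfolding \<tau>_def using powr_of_real_mult[of 2 "?w z" "1/2"] upper_nonzero[OF w(2)] by simp
      have "(of_nat e :: complex) = 1 + of_nat (2 * n)" by (simp add: n)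
      hence "of_nat e * act cusp1 z = (- 1 / ?w z + 1) + of_nat (2 * n)"
        unfolding w(1) by (simp only: add.assoc)
      hence "jacobi_theta (of_nat e * act cusp1 z) = jacobi_theta (- 1 / ?w z + 1)"
        using jacobi_theta_add_even[OF upper_add_real[OF u, of 1], of n] by (simp only: one_complex.sel)
      also have "\<dots> = eta (- 1 / (2 * ?w z)) ^ 2 / eta (- 1 / ?w z)"
        unfolding jacobi_theta_add_1[OF u] by (simp add: mult.commute)
      also have "\<dots> = (K * (\<tau> * ?w z powr (1/2)) * eta (2 * ?w z)) ^ 2 / (K * ?w z powr (1/2) * eta (?w z))"
        by (simp only: K(2)[OF w(2)] K(2)[OF upper_scale(2)[OF w(2)]] p2)
      finally have fin: "jacobi_theta (of_nat e * act cusp1 z) =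
          (K * (\<tau> * ?w z powr (1/2)) * eta (2 * ?w z)) ^ 2 / (K * ?w z powr (1/2) * eta (?w z))" .
      have gen: "(K * \<tau>\<^sup>2 / \<rho>) * (x ^ 2 / y) = (K * (\<tau> * p) * x) ^ 2 / (K * p * y) / (\<rho> * p)"
        if "p \<noteq> 0" "y \<noteq> 0" for p x y
        using that \<rho> K(1) by (simp add: field_simps power2_eq_square)
      show ?thesis unfolding fin aut[OF z] of_nat_numeral by (rule gen[OF nz[OF z] eta_nonzero[OF w(2)]])
    qed
    ultimately show ?thesis using True by (simp add: leading_cong)
  qed
qed

text \<open>For even e inversion returns f(w), of exponent -1/24. For odd e there remains f(-1/w +
  1), a multiple of eta(2w) / eta(w), of exponent 2/12 - 1/12. Passing from w to z divides by
  e.\<close>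

lemma leading_weber_cusp1:
  assumes e: "e > 0"
  shows "leading (if odd e then 1 / (12 * real e) else - 1 / (24 * real e)) (\<lambda>z. weber (of_nat e * act cusp1 z))"
proof -
  obtain K where K: "K \<noteq> 0" "\<And>z. z \<in> upper_half_plane \<Longrightarrow> eta (- 1 / z) = K * z powr (1/2) * eta z"
    using eta_inversion by blast
  let ?w = "\<lambda>z. of_real (1 / real e) * z + of_real (1 / real e) :: complex"
  define \<zeta> where "\<zeta> = exp (- of_real pi * \<i> / 12)"
  have \<zeta>: "\<zeta> \<noteq> 0" by (simp add: \<zeta>_def)
  show ?thesis
  proof (cases "odd e")
    case False
    then obtain n where n: "e = 2 * n" by (metis evenE)
    have "leading (0 + (- 1/24) * (1 / real e)) (\<lambda>z. \<zeta> ^ n * weber (?w z))"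
      using \<zeta> e by (intro leading_mult leading_const leading_affine leading_weber) auto
    moreover have "\<zeta> ^ n * weber (?w z) = weber (of_nat e * act cusp1 z)" if z: "z \<in> upper_half_plane" for z
    proof -
      note w = scale_act_cusp1[OF z e]
      show ?thesis
        unfolding w(1) using weber_add_even[OF neg_inverse_in_upper[OF w(2)], of n] n weber_S[OF w(2)] by (simp only: \<zeta>_def)
    qed
    ultimately show ?thesis using False by (simp add: leading_cong)
  next
    case True
    then obtain n where n: "e = 2 * n + 1" by (elim oddE)
    define \<tau> where "\<tau> = (2 :: complex) powr (1/2)"
    define k where "k = \<zeta> ^ n * exp (- of_real pi * \<i> / 24) * \<tau>"
    have k: "k \<noteq> 0" by (simp add: \<tau>_def k_def \<zeta>)
    have l: "leading (1/12 * real 2 - 1/12) (\<lambda>w. eta (of_nat 2 * w) / eta w)"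
      by (intro leading_divide leading_scale leading_eta) simp
    have "leading (0 + (1/12 * real 2 - 1/12) * (1 / real e)) (\<lambda>z. k * (eta (of_nat 2 * ?w z) / eta (?w z)))"
      using leading_mult[OF leading_const leading_affine[OF l, of "1 / real e" "1 / real e"], of k] k e by simp
    hence "leading (1 / (12 * real e)) (\<lambda>z. k * (eta (of_nat 2 * ?w z) / eta (?w z)))" by simp
    moreover have "k * (eta (of_nat 2 * ?w z) / eta (?w z)) = weber (of_nat e * act cusp1 z)"
      if z: "z \<in> upper_half_plane" for z
    proof -
      note w = scale_act_cusp1[OF z e]
      note u = neg_inverse_in_upper[OF w(2)]
      have p2: "(2 * ?w z) powr (1/2) = \<tau> * ?w z powr (1/2)"
        unfolding \<tau>_def using powr_of_real_mult[of 2 "?w z" "1/2"] upper_nonzero[OF w(2)] by simp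
      have "(of_nat e :: complex) = 1 + of_nat (2 * n)" by (simp add: n)
      hence "of_nat e * act cusp1 z = (- 1 / ?w z + 1) + of_nat (2 * n)"
        unfolding w(1) by (simp only: add.assoc)
      hence "weber (of_nat e * act cusp1 z) = \<zeta> ^ n * weber (- 1 / ?w z + 1)"
        using weber_add_even[OF upper_add_real[OF u, of 1], of n] by (simp only: one_complex.sel \<zeta>_def)
      moreover have "weber (- 1 / ?w z + 1) = exp (- of_real pi * \<i> / 24) * (eta (- 1 / (2 * ?w z)) / eta (- 1 / ?w z))"
        unfolding weber_add_1[OF u] by (simp add: mult.commute)
      moreover have "eta (- 1 / (2 * ?w z)) / eta (- 1 / ?w z) =
          (K * (\<tau> * ?w z powr (1/2)) * eta (2 * ?w z)) / (K * ?w z powr (1/2) * eta (?w z))"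
        by (simp only: K(2)[OF w(2)] K(2)[OF upper_scale(2)[OF w(2)]] p2)
      ultimately have "weber (of_nat e * act cusp1 z) = \<zeta> ^ n * (exp (- of_real pi * \<i> / 24) *
          ((K * (\<tau> * ?w z powr (1/2)) * eta (2 * ?w z)) / (K * ?w z powr (1/2) * eta (?w z))))"
        by (simp only:)
      thus ?thesis using upper_nonzero[OF w(2)] K(1) by (simp add: k_def)
    qed
    ultimately show ?thesis using True by (simp add: leading_cong)
  qed
qed

section \<open>Reduction of cusps and points\<close>

section \<open>A fundamental domain\<close>

lemma coprime_bezout_int:
  fixes x y :: int
  assumes "coprime x y" obtains u v where "u * x - v * y = 1"
proof -
  obtain u v where "u * x + v * y = gcd x y" using bezout_int by blast
  thus thesis using that[of u "- v"] assms by simp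
qed

text \<open>For squarefree M no prime of g = gcd(M, q) is left in the cofactor g', so g' is coprime
  to q itself and not only to q/g.\<close>

lemma squarefree_gcd_split:
  fixes M :: nat and q :: int
  assumes "squarefree M" "M > 0"
  obtains g g' q' where "M = g * g'" "q = int g * q'" "coprime (int g') q" "g > 0" "g' > 0"
proof -
  define g where "g = gcd M (nat \<bar>q\<bar>)"
  have gi: "int g = gcd (int M) q"
    unfolding g_def gcd_int_def by simp
  have g0: "g > 0" using assms(2) by (simp add: g_def)
  obtain g' where g': "M = g * g'" unfolding g_def by (meson dvdE gcd_dvd1)
  have "int g dvd q" unfolding gi by simp
  then obtain q' where q': "q = int g * q'" by (elim dvdE)
  have cop: "coprime g g'" by (rule squarefree_cofactor_coprime[OF assms(1) g'])
  have "coprime (int g') q"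
  proof (rule coprimeI)
    fix k assume k: "k dvd int g'" "k dvd q"
    have "k dvd int M" unfolding g' using k(1) by simp
    hence "k dvd int g" unfolding gi using k(2) by (rule gcd_greatest)
    moreover have "coprime (int g) (int g')" using cop by simp
    ultimately show "is_unit k" using k(1) coprime_common_divisor by blast
  qed
  moreover have "g' > 0" using assms(2) g' by (auto intro: Nat.gr0I)
  ultimately show thesis using that[OF g' q'] g0 by blast
qed

text \<open>Dirichlet approximation of Re z with denominators up to n = floor(y^(-1/2)), where y =
  Im z. The real part of p - q z contributes at most 1/n^2 <= 4y and the imaginary part at most y,
  whence 5 = 4 + 1. High points take the fraction 1/0.\<close>

lemma rational_approximation_upper:
  assumes z: "z \<in> upper_half_plane"
  obtains p q :: int where "coprime p q" "(norm (of_int p - of_int q * z))\<^sup>2 \<le> 5 * Im z"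
proof (cases "Im z \<ge> 1")
  case True
  show thesis by (rule that[of 1 0]) (use True in auto)
next
  case False
  define y where "y = Im z"
  have y: "0 < y" "y < 1" using z False by (auto simp: y_def upper_half_plane_def)
  define t where "t = 1 / sqrt y"
  have t: "1 < t" using y by (simp add: t_def)
  have t2: "t\<^sup>2 * y = 1" using y by (simp add: t_def power_divide)
  define n where "n = nat \<lfloor>t\<rfloor>"
  have n: "real n \<le> t" "t < real n + 1" "n > 0" using t by (auto simp: n_def le_nat_floor)
  obtain h k where hk: "coprime h k" "0 < k" "k \<le> int n" "\<bar>of_int k * Re z - of_int h\<bar> < 1 / real n"
    by (rule Dirichlet_approx_coprime[OF n(3), of "Re z"])
  have kn: "real_of_int k \<le> real n" "0 < real_of_int k" using hk by linarith+
  have "(norm (of_int h - of_int k * z))\<^sup>2 = (of_int k * Re z - of_int h)\<^sup>2 + (of_int k * y)\<^sup>2"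
    unfolding cmod_power2 y_def by (simp add: power2_commute)
  also have "(of_int k * Re z - of_int h)\<^sup>2 \<le> (1 / real n)\<^sup>2"
    using hk(4) by (intro power2_le_iff_abs_le[THEN iffD2]) auto
  also have "(of_int k * y)\<^sup>2 \<le> (t * y)\<^sup>2"
    using kn n(1) y by (intro power_mono mult_right_mono) auto
  also have "(t * y)\<^sup>2 = y"
    using t2 by (simp add: power2_eq_square) 
  also have "(1 / real n)\<^sup>2 \<le> (2 / t)\<^sup>2"
  proof (rule power_mono)
    have "real n \<ge> 1" using n(3) by simp
    hence "t \<le> 2 * real n" using n(2) by linarith
    thus "1 / real n \<le> 2 / t" using n(3) t by (simp add: field_simps)
  qed auto
  also have "(2 / t)\<^sup>2 = 4 * y"
    using t2 t by (simp add: power_divide field_simps)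
  finally have "(norm (of_int h - of_int k * z))\<^sup>2 \<le> 5 * Im z" by (simp add: y_def)
  thus thesis using that hk(1) by blast
qed

context square_free_level
begin

text \<open>The first column of \<open>al_mat\<close> before normalisation is x (p, q), so r = x /
  sqrt m, and x^2 <= N m is the bound r^2 <= N that later controls the height.\<close>

lemma rep_infinity:
  assumes m: "m > 0" "m * n = 4 * N" and det: "int m * a * d - int n * b * c = 1"
    and x: "int m * a = x * p" "2 * int N * c = x * q" "x > 0" "x\<^sup>2 \<le> int (N * m)"
  shows "\<exists>W\<in>modular_group N. \<exists>\<rho>\<in>{mat 1, cusp1}. \<exists>r>0. r\<^sup>2 \<le> real N \<and>
    (W ** \<rho>)$1$1 = r * of_int p \<and> (W ** \<rho>)$2$1 = r * of_int q"
proof (intro bexI exI conjI)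
  let ?W = "al_mat N m a b c d"
  show "?W \<in> modular_group N" by (rule al_mat_in_modular_group[OF m det])
  show "mat 1 \<in> {mat 1, cusp1}" by simp
  have "real_of_int (x\<^sup>2) \<le> real_of_int (int (N * m))" using x(4) by (simp only: of_int_le_iff)
  hence "(real_of_int x)\<^sup>2 \<le> real N * real m" by simp
  thus "(of_int x / sqrt (real m))\<^sup>2 \<le> real N"
    using m(1) by (simp add: power_divide divide_le_eq)
  show "of_int x / sqrt (real m) > 0" using x(3) m(1) by simp
  have "real_of_int (int m * a) = real_of_int (x * p)" "real_of_int (2 * int N * c) = real_of_int (x * q)"
    using x(1,2) by (simp_all only:)
  hence "real m * of_int a = of_int x * of_int p" "2 * real N * of_int c = of_int x * of_int q"
    by simp_all
  thus "(?W ** mat 1)$1$1 = of_int x / sqrt (real m) * of_int p" "(?W ** mat 1)$2$1 = of_int x / sqrt (real m) * of_int q"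
    by (simp_all add: al_mat_def int_mat_def scaleR_mat2)
qed

text \<open>The analogue for 1: the first column of W ** \<open>cusp1\<close> is the sum of the two
  columns of W.\<close>

lemma rep_one:
  assumes m: "m > 0" "m * n = 4 * N" and det: "int m * a * d - int n * b * c = 1"
    and x: "int m * a + 2 * b = x * p" "2 * int N * c + int m * d = x * q" "x > 0" "x\<^sup>2 \<le> int (N * m)"
  shows "\<exists>W\<in>modular_group N. \<exists>\<rho>\<in>{mat 1, cusp1}. \<exists>r>0. r\<^sup>2 \<le> real N \<and>
    (W ** \<rho>)$1$1 = r * of_int p \<and> (W ** \<rho>)$2$1 = r * of_int q"
proof (intro bexI exI conjI)
  let ?W = "al_mat N m a b c d"
  show "?W \<in> modular_group N" by (rule al_mat_in_modular_group[OF m det])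
  show "cusp1 \<in> {mat 1, cusp1}" by simp
  have "real_of_int (x\<^sup>2) \<le> real_of_int (int (N * m))" using x(4) by (simp only: of_int_le_iff)
  hence "(real_of_int x)\<^sup>2 \<le> real N * real m" by simp
  thus "(of_int x / sqrt (real m))\<^sup>2 \<le> real N"
    using m(1) by (simp add: power_divide divide_le_eq)
  show "of_int x / sqrt (real m) > 0" using x(3) m(1) by simp
  have "real_of_int (int m * a + 2 * b) = real_of_int (x * p)" "real_of_int (2 * int N * c + int m * d) = real_of_int (x * q)"
    using x(1,2) by (simp_all only:)
  hence e: "real m * of_int a + 2 * of_int b = of_int x * of_int p" "2 * real N * of_int c + real m * of_int d = of_int x * of_int q"
    by simp_all
  have "(?W ** cusp1)$1$1 = (real m * of_int a + 2 * of_int b) / sqrt (real m)"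
    "(?W ** cusp1)$2$1 = (2 * real N * of_int c + real m * of_int d) / sqrt (real m)"
    by (simp_all add: al_mat_def int_mat_def scaleR_mat2 cusp1_def mat2_mult add_divide_distrib)
  thus "(?W ** cusp1)$1$1 = of_int x / sqrt (real m) * of_int p" "(?W ** cusp1)$2$1 = of_int x / sqrt (real m) * of_int q"
    unfolding e by simp_all
qed

text \<open>Every rational \<open>p/q\<close> is equivalent to \<open>\<infinity>\<close> or to 1.\<close>

lemma cusp_representative:
  assumes pq: "coprime p q"
  shows "\<exists>W\<in>modular_group N. \<exists>\<rho>\<in>{mat 1, cusp1}. \<exists>r>0. r\<^sup>2 \<le> real N \<and>
    (W ** \<rho>)$1$1 = r * of_int p \<and> (W ** \<rho>)$2$1 = r * of_int q"
proof -
  have podd: "odd p" if "even q" using that pq by (meson coprime_common_divisor odd_one)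
  have qodd: "odd q" if "even p" using that pq by (meson coprime_common_divisor odd_one)
  show ?thesis
  proof (cases "odd N")
    case True
    obtain g g' q' where g: "N = g * g'" "q = int g * q'" "coprime (int g') q" "g > 0" "g' > 0"
      using squarefree_gcd_split[OF squarefree_N N_pos] .
    have godd: "odd g" "odd g'" using True g(1) by auto
    have gp: "int g > 0" "int g' > 0" using g by auto
    \<comment> \<open>For odd N parity decides: odd p and q lead to 1, everything else to infinity,
      by a level g' for even q and 4 g' for even p. The choice of g = gcd(N, q) makes the Bezout
      equations solvable.\<close>
    consider "even q" | "even p" | "odd p" "odd q" by blast
    thus ?thesis
    proof cases
      case 1
      hence "even q'" using g(2) godd by simp
      then obtain c where c: "q' = 2 * c" by (elim evenE)
      have "coprime (int g' * p) (2 * q)" using g(3) pq godd podd[OF 1] by simp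
      then obtain d b where db: "d * (int g' * p) - b * (2 * q) = 1" by (rule coprime_bezout_int)
      show ?thesis
      proof (rule rep_infinity)
        show "g' > 0" "g' * (4 * g) = 4 * N" using g by simp_all
        show "int g' * p * d - int (4 * g) * b * c = 1" using db g(2) c by (simp add: mult_ac)
        show "int g' * p = int g' * p" "2 * int N * c = int g' * q" "int g' > 0" using g c by (simp_all add: mult_ac)
        show "(int g')\<^sup>2 \<le> int (N * g')" using g by (simp add: power2_eq_square)
      qed
    next
      case 2
      then obtain a where a: "p = 2 * a" by (elim evenE)
      have "coprime (2 * int g' * p) q" using g(3) pq qodd[OF 2] by simp
      then obtain d b where db: "d * (2 * int g' * p) - b * q = 1" by (rule coprime_bezout_int)
      show ?thesis
      proof (rule rep_infinity)
        show "4 * g' > 0" "4 * g' * g = 4 * N" using g by simp_all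
        show "int (4 * g') * a * d - int g * b * q' = 1" using db g(2) a by (simp add: mult_ac)
        show "int (4 * g') * a = 2 * int g' * p" "2 * int N * q' = 2 * int g' * q" "2 * int g' > 0" using g a by (simp_all add: mult_ac)
        show "(2 * int g')\<^sup>2 \<le> int (N * (4 * g'))" using g by (simp add: power2_eq_square)
      qed
    next
      case 3
      \<comment> \<open>The first column of W ** \<open>cusp1\<close> is to be (p, q). Eliminating b
        and d from the determinant leaves the Bezout equation in a and c; it makes a odd, so that b
        is integral.\<close>
      have "coprime q (2 * int g' * p)" using g(3) pq 3 by (simp add: coprime_commute)
      then obtain a c where ac: "a * q - c * (2 * int g' * p) = 1" by (rule coprime_bezout_int)
      have "odd (a * q - c * (2 * int g' * p))" unfolding ac by simp
      hence "odd a" by auto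
      hence "even (p - int g * a)" using 3 godd by simp
      then obtain b where b: "p - int g * a = 2 * b" by (elim evenE)
      show ?thesis
      proof (rule rep_one)
        let ?d = "q' - 2 * int g' * c"
        show "g > 0" "g * (4 * g') = 4 * N" using g by simp_all
        have "int g * a * ?d - 4 * int g' * b * c = a * (int g * q') - 2 * int g' * c * (int g * a + 2 * b)"
          by (simp add: algebra_simps)
        also have "\<dots> = 1" using ac b g(2) by (simp add: algebra_simps)
        finally show "int g * a * ?d - int (4 * g') * b * c = 1" by simp
        show "int g * a + 2 * b = 1 * p" using b by simp
        show "2 * int N * c + int g * ?d = 1 * q" using g by (simp add: algebra_simps)
        have "0 < N * g" using g(4) N_pos by simp
        hence "1 \<le> int (N * g)" by linarith
        thus "(1::int)\<^sup>2 \<le> int (N * g)" by (simp only: power_one)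
      qed simp
    qed
  next
    case False
    then obtain M where M: "N = 2 * M" by (metis evenE)
    have M0: "M > 0" using M N_pos by simp
    have sqM: "squarefree M" using squarefree_N M squarefree_mono[of M N] by simp
    have "coprime 2 M" by (rule squarefree_cofactor_coprime[OF squarefree_N M])
    hence oddM: "odd M" by simp
    obtain g g' q' where g: "M = g * g'" "q = int g * q'" "coprime (int g') q" "g > 0" "g' > 0"
      using squarefree_gcd_split[OF sqM M0] .
    have godd: "odd g" "odd g'" using oddM g(1) by auto
    have gp: "int g > 0" "int g' > 0" using g by auto
    \<comment> \<open>For even N the numbers q with exactly one factor 2 join the class of 1;
      infinity receives 4 | q and even p.\<close>
    consider "4 dvd q" | "even p" | "odd p" "odd q" | "even q" "\<not> 4 dvd q" by blast
    thus ?thesis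
    proof cases
      case 1
      have "coprime (2 ^ 2) (int g)" using godd(1) unfolding coprime_power_left_iff by simp
      hence "coprime 4 (int g)" by simp
      hence "4 dvd q'" using 1 unfolding g(2) by (simp add: coprime_dvd_mult_right_iff)
      then obtain c where c: "q' = 4 * c" by (elim dvdE)
      have qe: "even q" using 1 by presburger
      have "coprime (int g' * p) (2 * q)" using g(3) pq godd podd[OF qe] by simp
      then obtain d b where db: "d * (int g' * p) - b * (2 * q) = 1" by (rule coprime_bezout_int)
      show ?thesis
      proof (rule rep_infinity)
        show "g' > 0" "g' * (8 * g) = 4 * N" using g M by simp_all
        show "int g' * p * d - int (8 * g) * b * c = 1" using db g(2) c by (simp add: mult_ac)
        show "int g' * p = int g' * p" "2 * int N * c = int g' * q" "int g' > 0" using g c M by (simp_all add: mult_ac)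
        show "(int g')\<^sup>2 \<le> int (N * g')" using g M by (simp add: power2_eq_square)
      qed
    next
      case 2
      then obtain a where a: "p = 2 * a" by (elim evenE)
      have "coprime (2 ^ 2) q" using qodd[OF 2] unfolding coprime_power_left_iff by simp
      hence "coprime (4 * int g' * p) q" using g(3) pq by simp
      then obtain d b where db: "d * (4 * int g' * p) - b * q = 1" by (rule coprime_bezout_int)
      show ?thesis
      proof (rule rep_infinity)
        show "8 * g' > 0" "8 * g' * g = 4 * N" using g M by simp_all
        show "int (8 * g') * a * d - int g * b * q' = 1" using db g(2) a by (simp add: mult_ac)
        show "int (8 * g') * a = 4 * int g' * p" "2 * int N * q' = 4 * int g' * q" "4 * int g' > 0" using g a M by (simp_all add: mult_ac)
        show "(4 * int g')\<^sup>2 \<le> int (N * (8 * g'))" using g M by (simp add: power2_eq_square)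
      qed
    next
      case 3
      have "coprime (2 ^ 2) q" using 3 unfolding coprime_power_left_iff by simp
      hence "coprime q (4 * int g' * p)" using g(3) pq by (simp add: coprime_commute)
      then obtain a c where ac: "a * q - c * (4 * int g' * p) = 1" by (rule coprime_bezout_int)
      have "odd (a * q - c * (4 * int g' * p))" unfolding ac by simp
      hence "odd a" by auto
      hence "even (p - int g * a)" using 3 godd by simp
      then obtain b where b: "p - int g * a = 2 * b" by (elim evenE)
      show ?thesis
      proof (rule rep_one)
        let ?d = "q' - 4 * int g' * c"
        show "g > 0" "g * (8 * g') = 4 * N" using g M by simp_all
        have "int g * a * ?d - 8 * int g' * b * c = a * (int g * q') - 4 * int g' * c * (int g * a + 2 * b)"
          by (simp add: algebra_simps)
        also have "\<dots> = 1" using ac b g(2) by (simp add: algebra_simps)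
        finally show "int g * a * ?d - int (8 * g') * b * c = 1" by simp
        show "int g * a + 2 * b = 1 * p" using b by simp
        show "2 * int N * c + int g * ?d = 1 * q" using g M by (simp add: algebra_simps)
        have "0 < N * g" using g(4) N_pos by simp
        hence "1 \<le> int (N * g)" by linarith
        thus "(1::int)\<^sup>2 \<le> int (N * g)" by (simp only: power_one)
      qed simp
    next
      case 4
      hence "even q'" using g(2) godd by simp
      then obtain k where k: "q' = 2 * k" by (elim evenE)
      have "odd k"
      proof
        assume "even k"
        then obtain j where "k = 2 * j" by (elim evenE)
        hence "q = 4 * (int g * j)" using g(2) k by simp
        thus False using 4 by simp
      qed
      \<comment> \<open>The level is 8 g and the column is 2 (p, q). Now b comes out integral by
        itself, whereas d needs k - g' c even: k is odd because 4 does not divide q, and c is odd by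
        the Bezout equation.\<close>
      have "coprime (2 * q) (int g' * p)" using g(3) pq godd podd[OF 4(1)] by (simp add: coprime_commute)
      then obtain a c where ac: "a * (2 * q) - c * (int g' * p) = 1" by (rule coprime_bezout_int)
      have "odd (a * (2 * q) - c * (int g' * p))" unfolding ac by simp
      hence "odd c" by auto
      hence "even (k - int g' * c)" using \<open>odd k\<close> godd by simp
      then obtain d where d: "k - int g' * c = 2 * d" by (elim evenE)
      show ?thesis
      proof (rule rep_one)
        let ?b = "p - 4 * int g * a"
        show "8 * g > 0" "8 * g * g' = 4 * N" using g M by simp_all
        have "8 * int g * a * d - int g' * ?b * c = 4 * int g * a * (2 * d) - int g' * ?b * c" by simp
        also have "\<dots> = a * (2 * q) - c * (int g' * p)"
          unfolding d[symmetric] g(2) k by (simp add: algebra_simps)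
        finally show "int (8 * g) * a * d - int g' * ?b * c = 1" using ac by simp
        show "int (8 * g) * a + 2 * ?b = 2 * p" by simp
        have "2 * int N * c + int (8 * g) * d = 4 * int g * (int g' * c + 2 * d)" using g M by (simp add: algebra_simps)
        also have "\<dots> = 2 * q" unfolding d[symmetric] g(2) k by simp
        finally show "2 * int N * c + int (8 * g) * d = 2 * q" .
        have "1 * 1 \<le> N * g" using g(4) N_pos by (intro mult_le_mono) auto
        hence "4 \<le> N * (8 * g)" by simp
        hence "int 4 \<le> int (N * (8 * g))" by (simp only: of_nat_le_iff)
        thus "(2::int)\<^sup>2 \<le> int (N * (8 * g))" by simp
      qed simp
    qed
  qed
qed

text \<open>Choose p/q close to z and apply the inverse of W ** rho, whose first column is r (p, q).
  Its factor of automorphy at z is r (p - q z), of squared norm at most N * 5 Im z.\<close>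

lemma fundamental_domain:
  assumes z: "z \<in> upper_half_plane"
  obtains W \<rho> w where "W \<in> modular_group N" "\<rho> = mat 1 \<or> \<rho> = cusp1" "Im w \<ge> 1 / (5 * real N)" "z = act W (act \<rho> w)"
proof -
  obtain p q where pq: "coprime p q" "(norm (of_int p - of_int q * z))\<^sup>2 \<le> 5 * Im z"
    using rational_approximation_upper[OF z] .
  obtain W \<rho> r where W: "W \<in> modular_group N" "\<rho> \<in> {mat 1, cusp1}" "r > 0" "r\<^sup>2 \<le> real N"
    "(W ** \<rho>)$1$1 = r * of_int p" "(W ** \<rho>)$2$1 = r * of_int q"
    using cusp_representative[OF pq(1)] by blast
  have dW: "det W = 1" by (rule modular_group_invariance(1)[OF W(1)])
  have d\<rho>: "det \<rho> = 1" using W(2) by auto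
  define A where "A = W ** \<rho>"
  have dA: "det A = 1" by (simp add: A_def det_mul dW d\<rho>)
  define B where "B = mat2 (A$2$2) (- A$1$2) (- A$2$1) (A$1$1)"
  have dB: "det B = 1" using dA by (simp add: B_def det_mat2 det_2 mult.commute)
  have AB: "A ** B = mat 1"
    using dA by (subst mat2_eta[of A, symmetric]) (simp add: B_def mat2_mult mat_1_eq_mat2 mat2_eq_iff det_2 mult.commute)
  define w where "w = act B z"
  have wH: "w \<in> upper_half_plane" using act_in_upper[OF z, of B] dB by (simp add: w_def)
  have "act W (act \<rho> w) = act A w"
    using act_mult[OF wH, of W \<rho>] dW d\<rho> by (simp add: A_def)
  also have "\<dots> = act (A ** B) z" using act_mult[OF z, of A B] dA dB by (simp add: w_def)
  finally have 1: "z = act W (act \<rho> w)" unfolding AB by simp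
  have jB: "jac B z = of_real r * (of_int p - of_int q * z)"
    using W(5,6) by (simp add: B_def jac_mat2 A_def algebra_simps)
  have jn: "jac B z \<noteq> 0" using jac_nonzero[OF z, of B] dB by simp
  have "(norm (jac B z))\<^sup>2 = r\<^sup>2 * (norm (of_int p - of_int q * z))\<^sup>2"
    unfolding jB norm_mult power_mult_distrib by simp
  also have "\<dots> \<le> real N * (5 * Im z)"
    using W(4) pq(2) by (intro mult_mono) auto
  finally have "(norm (jac B z))\<^sup>2 \<le> real N * (5 * Im z)" .
  hence "1 / (5 * real N) \<le> Im z / (norm (jac B z))\<^sup>2"
    using jn N_pos by (simp add: field_simps)
  also have "\<dots> = Im w" using Im_act[OF z, of B] dB by (simp add: w_def)
  finally show thesis using that[OF W(1) _ _ 1] W(2) by blast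
qed

section \<open>Orders of \<open>g\<^sub>1\<close> and \<open>g\<^sub>2\<close> at the cusps\<close>

text \<open>The exponent of \<open>g1\<close> at 1, counted in exp(pi i z); only the odd divisors
  contribute.\<close>

definition g1_exponent :: real where
  "g1_exponent = (\<Sum>e\<in>divisors N. if odd e then 1 / (4 * real e) else 0)"

text \<open>The width of the cusp 1 relative to \<open>cusp1\<close>; that no smaller translation
  exists is \<open>cusp_width_cusp1\<close>.\<close>

definition width :: real where
  "width = (if odd N then real N else 2 * real N)"

lemma width_pos: "width > 0"
  using N_pos by (simp add: width_def)

lemma g1_exponent_nonneg: "g1_exponent \<ge> 0"
  unfolding g1_exponent_def by (intro sum_nonneg) auto

lemma aut_factor_power:
  assumes "z \<in> upper_half_plane" "det A \<noteq> 0"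
  shows "aut_factor w A z ^ n = aut_factor (real n * w) A z"
proof (induction n)
  case (Suc n)
  have "real (Suc n) * w = w + real n * w" by (simp add: distrib_right)
  thus ?case using Suc by (simp only: power_Suc aut_factor_add)
qed (simp add: aut_factor_0 assms)

lemma leading_g1_cusp1: "leading g1_exponent (slash (g1_weight N) (g1 N) cusp1)"
proof -
  have "leading g1_exponent (\<lambda>z. \<Prod>e\<in>divisors N. jacobi_theta (of_nat e * act cusp1 z) / aut_factor (1/2) cusp1 z)"
    unfolding g1_exponent_def
    by (intro leading_prod finite_divisors[OF N_pos] leading_jacobi_theta_cusp1 divisors_pos[OF N_pos])
  thus ?thesis
  proof (rule leading_cong)
    fix z assume z: "z \<in> upper_half_plane"
    have "aut_factor (1/2) cusp1 z ^ card (divisors N) = aut_factor (g1_weight N) cusp1 z"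
      using aut_factor_power[OF z, of cusp1 "1/2" "card (divisors N)"] by (simp add: g1_weight_def C_dim_def)
    moreover have "act cusp1 z \<in> upper_half_plane" by (rule act_in_upper[OF z]) simp
    ultimately show "(\<Prod>e\<in>divisors N. jacobi_theta (of_nat e * act cusp1 z) / aut_factor (1/2) cusp1 z) = slash (g1_weight N) (g1 N) cusp1 z"
      by (simp add: slash_def g1_eq_prod[OF N_pos] prod_dividef)
  qed
qed

lemma sum_inverse_divisors:
  assumes "M > 0"
  shows "(\<Sum>e\<in>divisors M. 1 / real e) = real (\<Sum>(divisors M)) / real M"
proof -
  have "(\<Sum>e\<in>divisors M. 1 / real e) = (\<Sum>e\<in>divisors M. real (M div e) / real M)"
  proof (rule sum.cong[OF refl])
    fix e assume "e \<in> divisors M"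
    then obtain k where k: "M = e * k" by (auto simp: divisors_def)
    thus "1 / real e = real (M div e) / real M" using assms by (auto simp: field_simps)
  qed
  also have "\<dots> = (\<Sum>e\<in>divisors M. real (M div e)) / real M" by (simp add: sum_divide_distrib)
  also have "(\<Sum>e\<in>divisors M. real (M div e)) = (\<Sum>e\<in>divisors M. real e)"
    by (rule sum.reindex_bij_betw[OF bij_betw_div[OF assms]])
  finally show ?thesis by simp
qed

text \<open>The value 2 / \<open>width\<close> says that \<open>g2\<close> has a simple pole at 1.
  For odd N it is 24/(12 N). For N = 2M the divisors e and 2e together contribute 1/12 - 1/48 = 1/16
  times 1/e, and sigma(N) = 3 sigma(M) gives s sigma(M) = 8.\<close>

lemma weber_exponent_cusp1:
  "real s * (\<Sum>e\<in>divisors N. if odd e then 1 / (12 * real e) else - 1 / (24 * real e)) = 2 / width"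
proof (cases "odd N")
  case True
  have "(\<Sum>e\<in>divisors N. if odd e then 1 / (12 * real e) else - 1 / (24 * real e)) = (\<Sum>e\<in>divisors N. 1 / 12 * (1 / real e))"
    using True by (intro sum.cong refl) (auto simp: divisors_def)
  also have "\<dots> = real (\<Sum>(divisors N)) / (12 * real N)"
    unfolding sum_distrib_left[symmetric] sum_inverse_divisors[OF N_pos] by simp
  finally have "real s * (\<Sum>e\<in>divisors N. if odd e then 1 / (12 * real e) else - 1 / (24 * real e))
     = real (s * \<Sum>(divisors N)) / (12 * real N)" by simp
  thus ?thesis unfolding s_sigma using True by (simp add: width_def)
next
  case False
  then obtain M where M: "N = 2 * M" by (metis evenE)
  have M0: "M > 0" using M N_pos by simp
  have "coprime 2 M" by (rule squarefree_cofactor_coprime[OF squarefree_N M])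
  hence oddM: "odd M" by simp
  have fin: "finite (divisors M)" by (rule finite_divisors[OF M0])
  have split: "(\<Sum>e\<in>divisors N. f e) = (\<Sum>e\<in>divisors M. f e) + (\<Sum>e\<in>divisors M. f (2 * e))" for f :: "nat \<Rightarrow> 'a :: comm_monoid_add"
  proof -
    have "(\<Sum>e\<in>divisors N. f e) = (\<Sum>e\<in>divisors M. f e) + (\<Sum>e\<in>(*) 2 ` divisors M. f e)"
      unfolding M divisors_double(1)[OF oddM M0]
      by (rule sum.union_disjoint) (use fin divisors_double(2)[OF oddM M0] in auto)
    thus ?thesis by (subst (asm) sum.reindex) (auto simp: inj_on_def)
  qed
  have "\<Sum>(divisors N) = 3 * \<Sum>(divisors M)"
    using split[of "\<lambda>e. e"] by (simp add: sum_distrib_left[symmetric])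
  hence s8: "s * \<Sum>(divisors M) = 8" using s_sigma by simp
  have "(\<Sum>e\<in>divisors N. if odd e then 1 / (12 * real e) else - 1 / (24 * real e)) =
     (\<Sum>e\<in>divisors M. 1 / 12 * (1 / real e)) + (\<Sum>e\<in>divisors M. - 1 / 48 * (1 / real e))"
    unfolding split using oddM by (intro arg_cong2[where f = "(+)"] sum.cong refl) (auto simp: divisors_def)
  also have "\<dots> = real (\<Sum>(divisors M)) / (16 * real M)"
    by (simp only: sum_distrib_left[symmetric] sum_inverse_divisors[OF M0]) simp
  finally have "real s * (\<Sum>e\<in>divisors N. if odd e then 1 / (12 * real e) else - 1 / (24 * real e))
     = real (s * \<Sum>(divisors M)) / (16 * real M)" by simp
  moreover have "width = 4 * real M" unfolding width_def by (simp add: M)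
  ultimately show ?thesis unfolding s8 by simp
qed

lemma leading_g2_cusp1: "leading (- 2 / width) (\<lambda>z. g2 N (act cusp1 z))"
proof -
  let ?\<beta> = "\<Sum>e\<in>divisors N. if odd e then 1 / (12 * real e) else - 1 / (24 * real e)"
  have "leading ?\<beta> (\<lambda>z. weber_prod N (act cusp1 z))"
    unfolding weber_prod_def by (intro leading_prod finite_divisors[OF N_pos] leading_weber_cusp1 divisors_pos[OF N_pos])
  hence "leading (real s * (- ?\<beta>)) (\<lambda>z. inverse (weber_prod N (act cusp1 z)) ^ s)"
    by (intro leading_power leading_inverse)
  moreover have "real s * (- ?\<beta>) = - 2 / width" using weber_exponent_cusp1 by simp
  ultimately have "leading (- 2 / width) (\<lambda>z. inverse (weber_prod N (act cusp1 z)) ^ s)" by simp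
  thus ?thesis by (rule leading_cong) (simp add: g2_eq' act_in_upper)
qed

lemma leading_g2: "leading 1 (g2 N)"
proof -
  have "leading (\<Sum>e\<in>divisors N. (- 1/24) * real e) (weber_prod N)"
    unfolding weber_prod_def[abs_def]
    by (intro leading_prod finite_divisors[OF N_pos] leading_scale leading_weber divisors_pos[OF N_pos])
  hence "leading (real s * (- (\<Sum>e\<in>divisors N. (- 1/24) * real e))) (\<lambda>z. inverse (weber_prod N z) ^ s)"
    by (intro leading_power leading_inverse)
  moreover have "real s * (- (\<Sum>e\<in>divisors N. (- 1/24) * real e)) = real (s * \<Sum>(divisors N)) / 24"
    by (simp only: sum_distrib_left[symmetric]) simp
  ultimately have "leading 1 (\<lambda>z. inverse (weber_prod N z) ^ s)" unfolding s_sigma by simp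
  thus ?thesis by (rule leading_cong) (simp add: g2_eq')
qed

lemma leading_g1: "leading 0 (g1 N)"
proof -
  have "leading (\<Sum>e\<in>divisors N. 0 * real e) (\<lambda>z. \<Prod>e\<in>divisors N. jacobi_theta (of_nat e * z))"
    by (intro leading_prod finite_divisors[OF N_pos] leading_scale leading_jacobi_theta divisors_pos[OF N_pos])
  hence "leading 0 (\<lambda>z. \<Prod>e\<in>divisors N. jacobi_theta (of_nat e * z))" by simp
  thus ?thesis by (rule leading_cong) (simp add: g1_eq_prod[OF N_pos])
qed

lemma g2_nonzero: "z \<in> upper_half_plane \<Longrightarrow> g2 N z \<noteq> 0"
  using weber_prod_nonzero[OF N_pos] by (simp add: g2_eq')

lemma g2_holomorphic: "g2 N holomorphic_on upper_half_plane"
  by (rule holomorphic_transform[of "\<lambda>z. inverse (weber_prod N z) ^ s"])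
    (auto intro!: holomorphic_intros weber_prod_holomorphic N_pos simp: g2_eq' weber_prod_nonzero[OF N_pos])

lemma T2_in_modular_group: "mat2 1 2 0 1 \<in> modular_group N"
proof -
  have "al_mat N 1 1 1 0 1 \<in> modular_group N"
    by (rule al_mat_in_modular_group[of 1 "4 * N"]) simp_all
  thus ?thesis by (simp add: al_mat_def int_mat_def)
qed

text \<open>The conjugate by \<open>cusp1\<close> of translation by \<open>width\<close>. For odd N
  its upper right entry N is odd, so it comes from an Atkin-Lehner matrix of level 4; for even N it
  comes from level 1.\<close>

lemma cusp1_stabilizer: "mat2 (1 - width) width (- width) (1 + width) \<in> modular_group N"
proof (cases "odd N")
  case True
  then obtain n where n: "N = 2 * n + 1" by (elim oddE)
  have "al_mat N 4 (- int n) (int N) (- 1) (int n + 1) \<in> modular_group N"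
    by (rule al_mat_in_modular_group[of 4 N]) (simp_all add: n algebra_simps)
  moreover have "al_mat N 4 (- int n) (int N) (- 1) (int n + 1) = mat2 (1 - width) width (- width) (1 + width)"
  proof -
    have "width = real N" using True by (simp add: width_def)
    thus ?thesis by (simp add: al_mat_def int_mat_def scaleR_mat2 mat2_eq_iff) (simp add: n)
  qed
  ultimately show ?thesis by simp
next
  case False
  have "al_mat N 1 (1 - 2 * int N) (int N) (- 1) (1 + 2 * int N) \<in> modular_group N"
    by (rule al_mat_in_modular_group[of 1 "4 * N"]) (simp_all add: algebra_simps)
  moreover have "al_mat N 1 (1 - 2 * int N) (int N) (- 1) (1 + 2 * int N) = mat2 (1 - width) width (- width) (1 + width)"
    using False by (simp add: al_mat_def int_mat_def mat2_eq_iff width_def)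
  ultimately show ?thesis by simp
qed

lemma cusp1_stabilizer_mult:
  "mat2 (1 - width) width (- width) (1 + width) ** cusp1 = cusp1 ** mat2 1 width 0 1"
  by (simp add: cusp1_def mat2_mult mat2_eq_iff)

lemma width_in_cusp_translations: "width \<in> cusp_translations (modular_group N) cusp1"
  unfolding cusp_translations_def using width_pos cusp1_stabilizer cusp1_stabilizer_mult by blast

lemma cusp_at_cusp1: "cusp_at (modular_group N) cusp1"
  unfolding cusp_at_def using width_in_cusp_translations by auto

lemma cusp_at_infinity: "cusp_at (modular_group N) (mat 1)"
proof -
  have "2 \<in> cusp_translations (modular_group N) (mat 1)"
    unfolding cusp_translations_def using T2_in_modular_group by auto
  thus ?thesis unfolding cusp_at_def by auto
qed

text \<open>The simple pole of the invariant function \<open>g\<^sub>2\<close> forces every translation to be a multiple of \<open>width\<close>.\<close>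

lemma cusp_width_cusp1: "cusp_width (modular_group N) cusp1 = width"
proof -
  have "width \<le> h" if h: "h \<in> cusp_translations (modular_group N) cusp1" for h
  proof -
    obtain \<gamma> where \<gamma>: "h > 0" "\<gamma> \<in> modular_group N" "\<gamma> ** cusp1 = cusp1 ** mat2 1 h 0 1 \<or> \<gamma> ** cusp1 = - (cusp1 ** mat2 1 h 0 1)"
      using h unfolding cusp_translations_def by blast
    have d\<gamma>: "det \<gamma> = 1" by (rule modular_group_invariance(1)[OF \<gamma>(2)])
    have per: "g2 N (act cusp1 (of_real 1 * z + of_real h)) = g2 N (act cusp1 z)" if z: "z \<in> upper_half_plane" for z
    proof -
      have dT: "det (mat2 1 h 0 1) = 1" by (simp add: det_mat2)
      have "act cusp1 (of_real 1 * z + of_real h) = act (cusp1 ** mat2 1 h 0 1) z"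
        using act_mult[OF z, of cusp1 "mat2 1 h 0 1"] dT by (simp add: act_mat2)
      also have "\<dots> = act (\<gamma> ** cusp1) z" using \<gamma>(3) act_uminus by auto
      also have "\<dots> = act \<gamma> (act cusp1 z)" using act_mult[OF z, of \<gamma> cusp1] d\<gamma> by simp
      finally show ?thesis using modular_group_invariance(3)[OF \<gamma>(2)] act_in_upper[OF z, of cusp1] by simp
    qed
    obtain L where L: "L \<noteq> 0" "((\<lambda>z. g2 N (act cusp1 z) / exp (of_real pi * \<i> * of_real (- 2 / width) * z)) \<longlongrightarrow> L) at_iinfinity"
      using leading_g2_cusp1 unfolding leading_def by blast
    define c where "c = exp (of_real pi * \<i> * of_real (- 2 / width) * of_real h)"
    have c0: "c \<noteq> 0" by (simp add: c_def)
    have "((\<lambda>z. c * (g2 N (act cusp1 (of_real 1 * z + of_real h)) / exp (of_real pi * \<i> * of_real (- 2 / width) * (of_real 1 * z + of_real h)))) \<longlongrightarrow> c * L) at_iinfinity"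
      by (intro tendsto_mult tendsto_const filterlim_compose[OF L(2) filterlim_affine_at_iinfinity]) simp
    moreover have "\<forall>\<^sub>F z in at_iinfinity. c * (g2 N (act cusp1 (of_real 1 * z + of_real h)) / exp (of_real pi * \<i> * of_real (- 2 / width) * (of_real 1 * z + of_real h)))
       = g2 N (act cusp1 z) / exp (of_real pi * \<i> * of_real (- 2 / width) * z)"
      using eventually_at_iinfinity_upper
    proof eventually_elim
      case (elim z)
      have "exp (of_real pi * \<i> * of_real (- 2 / width) * (of_real 1 * z + of_real h)) = exp (of_real pi * \<i> * of_real (- 2 / width) * z) * c"
        unfolding c_def exp_add[symmetric] by (simp add: distrib_left)
      thus ?case using per[OF elim] c0 by simp
    qed
    ultimately have "((\<lambda>z. g2 N (act cusp1 z) / exp (of_real pi * \<i> * of_real (- 2 / width) * z)) \<longlongrightarrow> c * L) at_iinfinity"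
      by (rule Lim_transform_eventually)
    from tendsto_unique[OF at_iinfinity_neq_bot this L(2)] have "c = 1" using L(1) by simp
    then obtain n :: int where "Im (of_real pi * \<i> * of_real (- 2 / width) * of_real h) = of_int (2 * n) * pi"
      unfolding c_def exp_eq_1 by blast
    hence "pi * (- 2 / width * h) = pi * (2 * of_int n)" by (simp add: mult_ac)
    hence "- 2 / width * h = 2 * of_int n" by (subst (asm) mult_left_cancel) auto
    hence hn: "h = of_int (- n) * width" using width_pos by (simp add: field_simps)
    hence "0 < real_of_int (- n) * width" using \<gamma>(1) by simp
    hence "of_int (- n) > (0::real)" using width_pos by (rule zero_less_mult_pos2)
    hence "1 \<le> - n" by (simp only: of_int_0_less_iff)
    hence "1 \<le> real_of_int (- n)" by (simp only: of_int_1_le_iff)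
    hence "1 * width \<le> of_int (- n) * width" using width_pos by (intro mult_right_mono) auto
    thus ?thesis using hn by simp
  qed
  thus ?thesis
    unfolding cusp_width_def by (intro cInf_eq_minimum width_in_cusp_translations)
qed

text \<open>Conversion from exp(pi i z) to the local parameter exp(2 pi i z / \<open>width\<close>)
  multiplies the exponent by \<open>width\<close> / 2.\<close>

lemma ord_1_g1_eq: "ord_1_g1 N = g1_exponent * width / 2"
proof -
  have eq: "2 * of_real pi * \<i> * of_real r * z / of_real width = of_real pi * \<i> * of_real (2 * r / width) * z" for r and z :: complex
    by simp
  have "cusp_order (g1_weight N) (modular_group N) cusp1 (g1 N) =
     (THE r. leading (2 * r / width) (slash (g1_weight N) (g1 N) cusp1))"
    unfolding cusp_order_def cusp_width_cusp1 leading_def eq ..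
  also have "\<dots> = g1_exponent * width / 2"
  proof (rule the_equality)
    show "leading (2 * (g1_exponent * width / 2) / width) (slash (g1_weight N) (g1 N) cusp1)"
      using leading_g1_cusp1 width_pos by simp
    fix r assume "leading (2 * r / width) (slash (g1_weight N) (g1 N) cusp1)"
    from leading_unique[OF this leading_g1_cusp1] show "r = g1_exponent * width / 2"
      using width_pos by (simp add: field_simps)
  qed
  finally show ?thesis by (simp add: ord_1_g1_def cusp1_def)
qed

end

section \<open>The structure of the space of modular forms\<close>

section \<open>Functions bounded at the cusps\<close>

lemma Bfun_mult:
  fixes f g :: "'a \<Rightarrow> 'b :: real_normed_algebra"
  assumes "Bfun f F" "Bfun g F" shows "Bfun (\<lambda>x. f x * g x) F"
proof -
  obtain A B where A: "\<forall>\<^sub>F x in F. norm (f x) \<le> A" and B: "\<forall>\<^sub>F x in F. norm (g x) \<le> B" and "A > 0"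
    using assms unfolding Bfun_def by blast
  have "\<forall>\<^sub>F x in F. norm (f x * g x) \<le> A * B"
    using A B
  proof eventually_elim
    case (elim x)
    have "norm (f x * g x) \<le> norm (f x) * norm (g x)" by (rule norm_mult_ineq)
    also have "\<dots> \<le> A * B" using elim \<open>A > 0\<close> by (intro mult_mono) auto
    finally show ?case .
  qed
  thus ?thesis by (rule BfunI)
qed

lemma Bfun_diff:
  fixes f g :: "'a \<Rightarrow> 'b :: real_normed_vector"
  assumes "Bfun f F" "Bfun g F" shows "Bfun (\<lambda>x. f x - g x) F"
proof -
  obtain A B where A: "\<forall>\<^sub>F x in F. norm (f x) \<le> A" and B: "\<forall>\<^sub>F x in F. norm (g x) \<le> B"
    using assms unfolding Bfun_def by blast
  have "\<forall>\<^sub>F x in F. norm (f x - g x) \<le> A + B"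
    using A B by eventually_elim (rule order.trans[OF norm_triangle_ineq4 add_mono])
  thus ?thesis by (rule BfunI)
qed

lemma tendsto_imp_Bfun:
  fixes f :: "'a \<Rightarrow> 'b :: real_normed_vector"
  assumes "(f \<longlongrightarrow> l) F" shows "Bfun f F"
proof -
  have "\<forall>\<^sub>F x in F. dist (f x) l < 1" by (rule tendstoD[OF assms]) simp
  hence "\<forall>\<^sub>F x in F. norm (f x) \<le> norm l + 1"
  proof eventually_elim
    case (elim x)
    thus ?case using norm_triangle_ineq2[of "f x" l] by (simp add: dist_norm)
  qed
  thus ?thesis by (rule BfunI)
qed

lemma Bfun_cong_upper:
  fixes f g :: "complex \<Rightarrow> 'b :: real_normed_vector"
  assumes "Bfun f at_iinfinity" "\<And>z. z \<in> upper_half_plane \<Longrightarrow> f z = g z"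
  shows "Bfun g at_iinfinity"
proof -
  obtain A where A: "\<forall>\<^sub>F x in at_iinfinity. norm (f x) \<le> A"
    using assms unfolding Bfun_def by blast
  have "\<forall>\<^sub>F x in at_iinfinity. norm (g x) \<le> A"
    using A eventually_at_iinfinity_upper by eventually_elim (simp add: assms(2))
  thus ?thesis by (rule BfunI)
qed

lemma Bfun_tendsto_0_mult:
  fixes f g :: "'a \<Rightarrow> 'b :: real_normed_algebra"
  assumes "Bfun f F" "(g \<longlongrightarrow> 0) F" shows "((\<lambda>x. f x * g x) \<longlongrightarrow> 0) F"
proof -
  obtain A where A: "\<forall>\<^sub>F x in F. norm (f x) \<le> A"
    using assms unfolding Bfun_def by blast
  have "((\<lambda>x. A * norm (g x)) \<longlongrightarrow> 0) F"
    using tendsto_mult[OF tendsto_const[of A] tendsto_norm[OF assms(2)]] by simp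
  moreover have "\<forall>\<^sub>F x in F. norm (f x * g x) \<le> A * norm (g x)"
    using A
  proof eventually_elim
    case (elim x)
    have "norm (f x * g x) \<le> norm (f x) * norm (g x)" by (rule norm_mult_ineq)
    also have "\<dots> \<le> A * norm (g x)" using elim by (intro mult_right_mono) auto
    finally show ?case .
  qed
  ultimately show ?thesis by (rule Lim_null_comparison[rotated])
qed

lemma tendsto_cong_upper:
  assumes "(f \<longlongrightarrow> l) at_iinfinity" "\<And>z. z \<in> upper_half_plane \<Longrightarrow> f z = g z"
  shows "(g \<longlongrightarrow> l) at_iinfinity"
proof -
  have "\<forall>\<^sub>F z in at_iinfinity. f z = g z"
    using eventually_at_iinfinity_upper by eventually_elim (rule assms(2))
  from Lim_transform_eventually[OF assms(1) this] show ?thesis .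
qed

lemma periodic_representative:
  fixes F :: "complex \<Rightarrow> 'a"
  assumes per: "\<And>w. w \<in> upper_half_plane \<Longrightarrow> F (w + of_real p) = F w" and p: "p > 0" and w: "w \<in> upper_half_plane"
  obtains w' where "0 \<le> Re w'" "Re w' \<le> p" "Im w' = Im w" "F w' = F w"
proof -
  have nat: "F (v + of_nat n * of_real p) = F v" if v: "v \<in> upper_half_plane" for n v
  proof (induction n)
    case (Suc n)
    have "F (v + of_nat (Suc n) * of_real p) = F ((v + of_nat n * of_real p) + of_real p)"
      by (simp add: algebra_simps)
    also have "\<dots> = F (v + of_nat n * of_real p)"
      by (rule per) (use v in \<open>simp add: upper_half_plane_def\<close>)
    finally show ?case using Suc by simp
  qed simp
  define n where "n = \<lfloor>Re w / p\<rfloor>"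
  define w' where "w' = w - of_int n * of_real p"
  have w'H: "w' \<in> upper_half_plane" using w by (simp add: w'_def upper_half_plane_def)
  have "of_int n \<le> Re w / p" "Re w / p < of_int n + 1" unfolding n_def by linarith+
  hence b: "of_int n * p \<le> Re w" "Re w \<le> of_int n * p + p"
    using p by (simp_all add: field_simps)
  have "F w' = F w"
  proof (cases "n \<ge> 0")
    case True
    hence "w = w' + of_nat (nat n) * of_real p" by (simp add: w'_def)
    thus ?thesis using nat[OF w'H, of "nat n"] by metis
  next
    case False
    hence "of_nat (nat (- n)) = (- of_int n :: complex)" by simp
    hence "w' = w + of_nat (nat (- n)) * of_real p" by (simp add: w'_def)
    thus ?thesis using nat[OF w, of "nat (- n)"] by metis
  qed
  thus thesis using b by (intro that[of w']) (auto simp: w'_def)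
qed

text \<open>A bounded function of period 2 is a holomorphic function of \<open>q = exp (\<pi>iz)\<close> near \<open>q = 0\<close>.\<close>

lemma periodic_first_coefficient:
  assumes hol: "F holomorphic_on upper_half_plane"
    and per: "\<And>z. z \<in> upper_half_plane \<Longrightarrow> F (z + 2) = F z"
    and bnd: "Bfun F at_iinfinity"
  obtains c D where "((\<lambda>z. (F z - c) / exp (of_real pi * \<i> * z)) \<longlongrightarrow> D) at_iinfinity"
proof -
  let ?l = "\<lambda>q. Ln q / (of_real pi * \<i>)"
  define \<phi> where "\<phi> = (\<lambda>q. F (?l q))"
  have expl: "exp (of_real pi * \<i> * ?l q) = q" if "q \<noteq> 0" for q using that by simp
  have lH: "?l q \<in> upper_half_plane" if "q \<in> ball 0 1 - {0}" for q
    using that by (simp add: upper_half_plane_def Im_divide power2_eq_square)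
      (simp add: divide_less_0_iff zero_less_divide_iff mult_neg_pos)
  have nat: "F (v + of_nat n * 2) = F v" if v: "v \<in> upper_half_plane" for n v
  proof (induction n)
    case (Suc n)
    have "F (v + of_nat (Suc n) * 2) = F ((v + of_nat n * 2) + 2)" by (simp add: algebra_simps)
    also have "\<dots> = F (v + of_nat n * 2)"
      by (rule per) (use v in \<open>simp add: upper_half_plane_def\<close>)
    finally show ?case using Suc by simp
  qed simp
  have eqF: "F z = F w" if z: "z \<in> upper_half_plane" and w: "w \<in> upper_half_plane"
    and e: "exp (of_real pi * \<i> * z) = exp (of_real pi * \<i> * w)" for z w
  proof -
    obtain n :: int where "of_real pi * \<i> * z = of_real pi * \<i> * w + (of_int (2 * n) * of_real pi) * \<i>"
      using e unfolding exp_eq by (auto simp: of_real_mult)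
    hence "of_real pi * \<i> * z = of_real pi * \<i> * (w + of_int n * 2)" by (simp add: algebra_simps)
    hence zn: "z = w + of_int n * 2" by (subst (asm) mult_left_cancel) auto
    show ?thesis
    proof (cases "n \<ge> 0")
      case True
      hence "z = w + of_nat (nat n) * 2" using zn by simp
      thus ?thesis using nat[OF w, of "nat n"] by metis
    next
      case False
      hence "of_nat (nat (- n)) = (- of_int n :: complex)" by simp
      hence "w = z + of_nat (nat (- n)) * 2" using zn by simp
      thus ?thesis using nat[OF z, of "nat (- n)"] by metis
    qed
  qed
  \<comment> \<open>Two slit discs cover the punctured disc, because \<open>Ln\<close> jumps on the
    negative axis. On the second, (Ln(-q)) / (pi i) + 1 is another preimage of q, and periodicity
    identifies the two values of F.\<close>
  define D1 where "D1 = ball 0 1 \<inter> - (\<real>\<^sub>\<le>\<^sub>0 :: complex set)"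
  define D2 where "D2 = ball 0 1 \<inter> {q :: complex. - q \<in> - \<real>\<^sub>\<le>\<^sub>0}"
  have op: "open D1" "open D2"
  proof -
    have 1: "open (- (\<real>\<^sub>\<le>\<^sub>0 :: complex set))" using closed_nonpos_Reals_complex by (rule open_Compl)
    show "open D1" unfolding D1_def using 1 by blast
    have "open ((\<lambda>q::complex. - q) -` (- \<real>\<^sub>\<le>\<^sub>0))" by (intro open_vimage 1 continuous_intros)
    moreover have "(\<lambda>q::complex. - q) -` (- \<real>\<^sub>\<le>\<^sub>0) = {q. - q \<in> - \<real>\<^sub>\<le>\<^sub>0}" by auto
    ultimately show "open D2" unfolding D2_def by (metis open_Int open_ball)
  qed
  have D12: "D1 \<union> D2 = ball 0 1 - {0}"
    by (auto simp: D1_def D2_def complex_nonpos_Reals_iff complex_eq_iff)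
  have lH1: "?l q \<in> upper_half_plane" if "q \<in> D1" for q
    by (rule lH) (use that in \<open>simp only: D12[symmetric] UnI1\<close>)
  have lhol: "?l holomorphic_on D1"
    unfolding D1_def by (intro holomorphic_intros) auto
  have "?l ` D1 \<subseteq> upper_half_plane" using lH1 by (rule image_subsetI)
  hence "\<phi> holomorphic_on D1"
    unfolding \<phi>_def by (rule holomorphic_on_compose_gen[OF lhol hol, unfolded o_def])
  moreover have "\<phi> holomorphic_on D2"
  proof -
    have D2: "q \<in> ball 0 1 - {0}" if "q \<in> D2" for q
      unfolding D12[symmetric] using that by (rule UnI2)
    have lH1: "?l (- q) \<in> upper_half_plane" if "q \<in> D2" for q
      by (rule lH) (use D2[OF that] in simp)
    have lH2: "?l (- q) + 1 \<in> upper_half_plane" if "q \<in> D2" for q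
      using lH1[OF that] by (simp only: upper_half_plane_def mem_Collect_eq plus_complex.sel one_complex.sel add_0_right)
    have "(\<lambda>q. Ln (- q)) holomorphic_on D2"
      by (rule holomorphic_on_Ln') (auto simp: D2_def intro: holomorphic_intros)
    hence l2: "(\<lambda>q. ?l (- q) + 1) holomorphic_on D2"
      by (rule holomorphic_on_add[OF holomorphic_on_divide[OF _ holomorphic_on_const] holomorphic_on_const]) simp
    have "(\<lambda>q. ?l (- q) + 1) ` D2 \<subseteq> upper_half_plane" using lH2 by (rule image_subsetI)
    hence *: "(\<lambda>q. F (?l (- q) + 1)) holomorphic_on D2"
      by (rule holomorphic_on_compose_gen[OF l2 hol, unfolded o_def])
    have "F (?l (- q) + 1) = \<phi> q" if q: "q \<in> D2" for q
    proof -
      have q0: "q \<noteq> 0" using D2[OF q] by simp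
      have "of_real pi * \<i> * (?l (- q) + 1) = of_real pi * \<i> * ?l (- q) + of_real pi * \<i>"
        by (simp only: distrib_left mult_1_right)
      hence "exp (of_real pi * \<i> * (?l (- q) + 1)) = exp (of_real pi * \<i> * ?l (- q)) * exp (of_real pi * \<i>)"
        by (simp only: exp_add)
      also have "\<dots> = exp (of_real pi * \<i> * ?l q)"
        using expl[of "- q"] expl[OF q0] q0 by (simp only: exp_pi_i neg_equal_0_iff_equal simp_thms) simp
      finally show ?thesis unfolding \<phi>_def by (rule eqF[OF lH2[OF q] lH[OF D2[OF q]]])
    qed
    with * show ?thesis by (rule holomorphic_transform)
  qed
  ultimately have "\<phi> holomorphic_on D1 \<union> D2" using op by (intro holomorphic_on_Un)
  hence h\<phi>: "\<phi> holomorphic_on ball 0 1 - {0}" unfolding D12 .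
  obtain A where "\<forall>\<^sub>F z in at_iinfinity. norm (F z) \<le> A" using bnd unfolding Bfun_def by blast
  then obtain b where b: "\<And>z. Im z > b \<Longrightarrow> norm (F z) \<le> A" unfolding eventually_at_iinfinity by blast
  define \<delta> where "\<delta> = min 1 (exp (- pi * b))"
  have \<delta>: "\<delta> > 0" by (simp add: \<delta>_def)
  have "norm (\<phi> q) \<le> A" if q: "q \<noteq> 0" "norm q < \<delta>" for q
  proof -
    have "norm (exp (of_real pi * \<i> * w)) = exp (- pi * Im w)" for w by (simp add: norm_exp_eq_Re)
    from this[of "?l q"] have "norm q = exp (- pi * Im (?l q))" unfolding expl[OF q(1)] .
    hence "exp (- pi * Im (?l q)) < exp (- pi * b)" using q(2) by (simp add: \<delta>_def)
    hence "b < Im (?l q)" by simp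
    thus ?thesis unfolding \<phi>_def by (rule b)
  qed
  hence "\<forall>\<^sub>F q in at 0. norm (\<phi> q) \<le> A"
    unfolding eventually_at using \<delta> by (intro exI[of _ \<delta>]) auto
  hence "\<exists>g. g holomorphic_on ball 0 1 \<and> (\<forall>z\<in>ball 0 1 - {0}. g z = \<phi> z)"
    using holomorphic_on_extend_bounded[OF h\<phi>] by auto
  then obtain g where g: "g holomorphic_on ball 0 1" "\<And>q. q \<in> ball 0 1 - {0} \<Longrightarrow> g q = \<phi> q" by blast
  obtain D where "(g has_field_derivative D) (at 0)"
    using g(1) unfolding holomorphic_on_open[OF open_ball] by (meson centre_in_ball zero_less_one)
  hence d: "((\<lambda>q. (g q - g 0) / (q - 0)) \<longlongrightarrow> D) (at 0)" by (simp only: has_field_derivative_iff)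
  have "((\<lambda>z. exp (of_real pi * \<i> * z)) \<longlongrightarrow> 0) at_iinfinity"
    using exp_tendsto_0_at_iinfinity[of 1] by simp
  hence "filterlim (\<lambda>z. exp (of_real pi * \<i> * z)) (at 0) at_iinfinity"
    by (simp add: filterlim_at)
  from filterlim_compose[OF d this]
  have "((\<lambda>z. (g (exp (of_real pi * \<i> * z)) - g 0) / (exp (of_real pi * \<i> * z) - 0)) \<longlongrightarrow> D) at_iinfinity" .
  hence "((\<lambda>z. (F z - g 0) / exp (of_real pi * \<i> * z)) \<longlongrightarrow> D) at_iinfinity"
  proof (rule tendsto_cong_upper)
    fix z assume z: "z \<in> upper_half_plane"
    have q: "exp (of_real pi * \<i> * z) \<in> ball 0 1 - {0}" using norm_exp_ii_upper_simps(2)[OF z] by simp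
    have "g (exp (of_real pi * \<i> * z)) = F z"
      unfolding g(2)[OF q] \<phi>_def by (intro eqF lH[OF q] z) (simp only: expl[OF exp_not_eq_zero])
    thus "(g (exp (of_real pi * \<i> * z)) - g 0) / (exp (of_real pi * \<i> * z) - 0) = (F z - g 0) / exp (of_real pi * \<i> * z)"
      by simp
  qed
  thus thesis by (rule that)
qed

context square_free_level
begin

text \<open>An invariant function whose pole order at 1 is at most beta in the local parameter exp(2
  pi i z / \<open>width\<close>). The bound is real, since k times the order of \<open>g1\<close>
  may be fractional.\<close>

definition pole_bounded :: "real \<Rightarrow> (complex \<Rightarrow> complex) \<Rightarrow> bool" where
  "pole_bounded \<beta> F \<longleftrightarrow> F holomorphic_on upper_half_plane \<and>
     (\<forall>\<gamma>\<in>modular_group N. \<forall>z\<in>upper_half_plane. F (act \<gamma> z) = F z) \<and> Bfun F at_iinfinity \<and>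
     Bfun (\<lambda>z. F (act cusp1 z) * exp (of_real pi * \<i> * of_real (2 * \<beta> / width) * z)) at_iinfinity"

lemma invariant_periods:
  assumes "\<forall>\<gamma>\<in>modular_group N. \<forall>z\<in>upper_half_plane. F (act \<gamma> z) = F z" "z \<in> upper_half_plane"
  shows "F (z + 2) = F z" "F (act cusp1 (z + of_real width)) = F (act cusp1 z)"
proof -
  show "F (z + 2) = F z"
    using assms T2_in_modular_group by (fastforce simp: act_mat2)
  let ?\<gamma> = "mat2 (1 - width) width (- width) (1 + width)"
  have dT: "det (mat2 1 width 0 1) = 1" by (simp add: det_mat2)
  have d\<gamma>: "det ?\<gamma> = 1" by (rule modular_group_invariance(1)[OF cusp1_stabilizer])
  have "act cusp1 (z + of_real width) = act (cusp1 ** mat2 1 width 0 1) z"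
    using act_mult[OF assms(2), of cusp1 "mat2 1 width 0 1"] dT by (simp add: act_mat2)
  also have "\<dots> = act ?\<gamma> (act cusp1 z)"
    unfolding cusp1_stabilizer_mult[symmetric] using act_mult[OF assms(2), of ?\<gamma> cusp1] d\<gamma> by simp
  finally show "F (act cusp1 (z + of_real width)) = F (act cusp1 z)"
    using assms(1) cusp1_stabilizer act_in_upper[OF assms(2), of cusp1] by simp
qed

text \<open>The maximum principle on the compactified quotient.\<close>

lemma vanishing_at_cusps_imp_zero:
  assumes hol: "K holomorphic_on upper_half_plane"
    and inv: "\<forall>\<gamma>\<in>modular_group N. \<forall>z\<in>upper_half_plane. K (act \<gamma> z) = K z"
    and inf: "(K \<longlongrightarrow> 0) at_iinfinity" and one: "((\<lambda>z. K (act cusp1 z)) \<longlongrightarrow> 0) at_iinfinity"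
    and z0: "z0 \<in> upper_half_plane"
  shows "K z0 = 0"
proof (rule ccontr)
  assume nz: "K z0 \<noteq> 0"
  define \<epsilon> where "\<epsilon> = norm (K z0)"
  have \<epsilon>: "\<epsilon> > 0" using nz by (simp add: \<epsilon>_def)
  obtain Y1 where Y1: "\<And>w. Im w > Y1 \<Longrightarrow> norm (K w) < \<epsilon>"
    using tendstoD[OF inf \<epsilon>] unfolding eventually_at_iinfinity dist_norm by auto
  obtain Y2 where Y2: "\<And>w. Im w > Y2 \<Longrightarrow> norm (K (act cusp1 w)) < \<epsilon>"
    using tendstoD[OF one \<epsilon>] unfolding eventually_at_iinfinity dist_norm by auto
  define y0 where "y0 = 1 / (5 * real N)"
  have y0: "y0 > 0" using N_pos by (simp add: y0_def)
  define Y where "Y = max y0 (max Y1 Y2)"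
  define R where "R = max 2 width"
  define C where "C = cbox (Complex 0 y0) (Complex R Y)"
  have CH: "C \<subseteq> upper_half_plane" using y0 by (auto simp: C_def in_cbox_complex_iff upper_half_plane_def)
  have Cmem: "w \<in> C \<longleftrightarrow> 0 \<le> Re w \<and> Re w \<le> R \<and> y0 \<le> Im w \<and> Im w \<le> Y" for w
    by (auto simp: C_def in_cbox_complex_iff)
  define S where "S = C \<union> act cusp1 ` C"
  have "compact C" by (simp add: C_def)
  moreover have "continuous_on C (act cusp1)"
    by (rule continuous_on_subset[OF continuous_on_act CH]) simp
  ultimately have "compact S" unfolding S_def by (intro compact_Un compact_continuous_image)
  have "Complex 0 y0 \<in> C" unfolding Cmem using width_pos by (auto simp: R_def Y_def)
  hence "S \<noteq> {}" by (auto simp: S_def)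
  have SH: "S \<subseteq> upper_half_plane"
    using CH act_in_upper[of _ cusp1] by (auto simp: S_def)
  have "continuous_on S (\<lambda>z. norm (K z))"
    by (intro continuous_on_norm holomorphic_on_imp_continuous_on holomorphic_on_subset[OF hol SH])
  then obtain \<xi> where \<xi>: "\<xi> \<in> S" "\<And>y. y \<in> S \<Longrightarrow> norm (K y) \<le> norm (K \<xi>)"
    using continuous_attains_sup[OF \<open>compact S\<close> \<open>S \<noteq> {}\<close>] by blast
  \<comment> \<open>A point is equivalent to one in S or to one so close to a cusp that |K| is below
    |K(z0)|. The second alternative fails at z0 itself, so the maximum over S is the maximum over
    the half plane.\<close>
  have dich: "norm (K z) \<le> norm (K \<xi>) \<or> norm (K z) < \<epsilon>" if z: "z \<in> upper_half_plane" for z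
  proof -
    obtain W \<rho> w where W: "W \<in> modular_group N" "\<rho> = mat 1 \<or> \<rho> = cusp1" "Im w \<ge> y0" "z = act W (act \<rho> w)"
      using fundamental_domain[OF z] unfolding y0_def by metis
    have wH: "w \<in> upper_half_plane" using W(3) y0 by (simp add: upper_half_plane_def)
    have "act \<rho> w \<in> upper_half_plane" using W(2) by (intro act_in_upper[OF wH]) auto
    hence Kz: "K z = K (act \<rho> w)" using inv W(1,4) by simp
    from W(2) show ?thesis
    proof
      assume \<rho>: "\<rho> = mat 1"
      obtain w' where w': "0 \<le> Re w'" "Re w' \<le> 2" "Im w' = Im w" "K w' = K w"
        by (rule periodic_representative[of K 2, OF _ _ wH]) (use invariant_periods(1)[OF inv] in auto)
      show ?thesis
      proof (cases "Im w \<le> Y")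
        case True
        hence "w' \<in> S" using w' W(3) by (auto simp: S_def Cmem R_def)
        thus ?thesis using \<xi>(2)[of w'] w' Kz \<rho> by simp
      next
        case False
        thus ?thesis using Y1[of w] Kz \<rho> by (simp add: Y_def)
      qed
    next
      assume \<rho>: "\<rho> = cusp1"
      obtain w' where w': "0 \<le> Re w'" "Re w' \<le> width" "Im w' = Im w" "K (act cusp1 w') = K (act cusp1 w)"
        by (rule periodic_representative[of "\<lambda>w. K (act cusp1 w)" width, OF _ _ wH])
          (use invariant_periods(2)[OF inv] width_pos in auto)
      show ?thesis
      proof (cases "Im w \<le> Y")
        case True
        hence "act cusp1 w' \<in> S" using w' W(3) by (auto simp: S_def Cmem R_def)
        thus ?thesis using \<xi>(2)[of "act cusp1 w'"] w' Kz \<rho> by simp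
      next
        case False
        thus ?thesis using Y2[of w] Kz \<rho> by (simp add: Y_def)
      qed
    qed
  qed
  have "\<epsilon> \<le> norm (K \<xi>)" using dich[OF z0] by (simp add: \<epsilon>_def)
  hence mx: "norm (K z) \<le> norm (K \<xi>)" if "z \<in> upper_half_plane" for z
    using dich[OF that] by linarith
  have "K constant_on upper_half_plane"
    by (rule maximum_modulus_principle[OF hol _ _ open_upper_half_plane order_refl, of \<xi>]) (use \<xi>(1) SH mx in auto)
  then obtain k where k: "\<And>z. z \<in> upper_half_plane \<Longrightarrow> K z = k" unfolding constant_on_def by blast
  have "((\<lambda>z. k) \<longlongrightarrow> 0) at_iinfinity"
    using inf by (rule tendsto_cong_upper) (rule k)
  hence "k = 0" using tendsto_unique[OF at_iinfinity_neq_bot tendsto_const] by blast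
  thus False using k[OF z0] nz by simp
qed

lemma pole_bounded_imp_limit:
  assumes "pole_bounded \<beta> F"
  obtains c D where "((\<lambda>z. (F z - c) / exp (of_real pi * \<i> * z)) \<longlongrightarrow> D) at_iinfinity"
  using assms unfolding pole_bounded_def
  by (elim conjE) (rule periodic_first_coefficient[of F], auto simp: invariant_periods(1))

text \<open>F tends to 0 at 1 and to some a at infinity, so F (F - a) vanishes at both cusps and
  therefore everywhere. By connectedness F is constantly 0 or constantly a, and its limit at 1 gives
  0.\<close>

lemma pole_bounded_negative:
  assumes F: "pole_bounded \<beta> F" and \<beta>: "\<beta> < 0" and z: "z \<in> upper_half_plane"
  shows "F z = 0"
proof -
  have hol: "F holomorphic_on upper_half_plane"
    and inv: "\<forall>\<gamma>\<in>modular_group N. \<forall>z\<in>upper_half_plane. F (act \<gamma> z) = F z"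
    and b1: "Bfun (\<lambda>z. F (act cusp1 z) * exp (of_real pi * \<i> * of_real (2 * \<beta> / width) * z)) at_iinfinity"
    using F unfolding pole_bounded_def by auto
  obtain a D where "((\<lambda>z. (F z - a) / exp (of_real pi * \<i> * z)) \<longlongrightarrow> D) at_iinfinity"
    using pole_bounded_imp_limit[OF F] .
  from tendsto_mult[OF this exp_tendsto_0_at_iinfinity[of 1]]
  have "((\<lambda>z. F z - a) \<longlongrightarrow> 0) at_iinfinity" by simp
  hence Fa: "(F \<longlongrightarrow> a) at_iinfinity" using Lim_null by blast
  have pos: "- 2 * \<beta> / width > 0" using \<beta> width_pos by (simp add: divide_less_0_iff mult_neg_pos)
  have "((\<lambda>z. (F (act cusp1 z) * exp (of_real pi * \<i> * of_real (2 * \<beta> / width) * z)) *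
      exp (of_real pi * \<i> * of_real (- 2 * \<beta> / width) * z)) \<longlongrightarrow> 0) at_iinfinity"
    by (rule Bfun_tendsto_0_mult[OF b1 exp_tendsto_0_at_iinfinity[OF pos]])
  moreover have "exp (of_real pi * \<i> * of_real (2 * \<beta> / width) * z) * exp (of_real pi * \<i> * of_real (- 2 * \<beta> / width) * z) = 1" for z
    unfolding exp_add[symmetric] by (simp add: distrib_right[symmetric])
  ultimately have F1: "((\<lambda>z. F (act cusp1 z)) \<longlongrightarrow> 0) at_iinfinity"
    by (simp only: mult.assoc mult_1_right)
  have K: "F z * (F z - a) = 0" if z: "z \<in> upper_half_plane" for z
  proof (rule vanishing_at_cusps_imp_zero[of "\<lambda>z. F z * (F z - a)", OF _ _ _ _ z])
    show "(\<lambda>z. F z * (F z - a)) holomorphic_on upper_half_plane" by (intro holomorphic_intros hol)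
    show "((\<lambda>z. F z * (F z - a)) \<longlongrightarrow> 0) at_iinfinity"
      using tendsto_mult[OF Fa tendsto_diff[OF Fa tendsto_const[of a]]] by simp
    show "((\<lambda>z. F (act cusp1 z) * (F (act cusp1 z) - a)) \<longlongrightarrow> 0) at_iinfinity"
      using tendsto_mult[OF F1 tendsto_diff[OF F1 tendsto_const[of a]]] by simp
  qed (use inv in auto)
  have "F constant_on upper_half_plane"
  proof (rule continuous_finite_range_constant[OF connected_upper_half_plane holomorphic_on_imp_continuous_on[OF hol]])
    have "F ` upper_half_plane \<subseteq> {0, a}" using K by auto
    thus "finite (F ` upper_half_plane)" by (rule finite_subset) simp
  qed
  then obtain k where k: "\<And>z. z \<in> upper_half_plane \<Longrightarrow> F z = k" unfolding constant_on_def by blast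
  have "((\<lambda>z. k) \<longlongrightarrow> 0) at_iinfinity"
    using F1 by (rule tendsto_cong_upper) (rule k, rule act_in_upper, auto)
  hence "k = 0" using tendsto_unique[OF at_iinfinity_neq_bot tendsto_const] by blast
  thus ?thesis using k[OF z] by simp
qed

text \<open>As \<open>g\<^sub>2\<close> has divisor \<open>\<infinity> - 1\<close>, dividing \<open>F - F(\<infinity>)\<close> by it lowers the pole order at 1
  and keeps \<open>F\<close> holomorphic everywhere else.\<close>

lemma pole_bounded_step:
  assumes F: "pole_bounded \<beta> F" and \<beta>: "\<beta> \<ge> 0"
  obtains c G where "pole_bounded (\<beta> - 1) G" "\<And>z. z \<in> upper_half_plane \<Longrightarrow> F z = c + g2 N z * G z"
proof -
  have hol: "F holomorphic_on upper_half_plane"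
    and inv: "\<forall>\<gamma>\<in>modular_group N. \<forall>z\<in>upper_half_plane. F (act \<gamma> z) = F z"
    and b1: "Bfun (\<lambda>z. F (act cusp1 z) * exp (of_real pi * \<i> * of_real (2 * \<beta> / width) * z)) at_iinfinity"
    using F unfolding pole_bounded_def by auto
  obtain c D where cD: "((\<lambda>z. (F z - c) / exp (of_real pi * \<i> * z)) \<longlongrightarrow> D) at_iinfinity"
    using pole_bounded_imp_limit[OF F] .
  define G where "G = (\<lambda>z. (F z - c) / g2 N z)"
  obtain L where L: "L \<noteq> 0" "((\<lambda>z. g2 N z / exp (of_real pi * \<i> * of_real 1 * z)) \<longlongrightarrow> L) at_iinfinity"
    using leading_g2 unfolding leading_def by blast
  obtain M where M: "M \<noteq> 0" "((\<lambda>z. g2 N (act cusp1 z) / exp (of_real pi * \<i> * of_real (- 2 / width) * z)) \<longlongrightarrow> M) at_iinfinity"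
    using leading_g2_cusp1 unfolding leading_def by blast
  have "pole_bounded (\<beta> - 1) G"
    unfolding pole_bounded_def
  proof (intro conjI ballI)
    show "G holomorphic_on upper_half_plane"
      unfolding G_def by (intro holomorphic_intros hol g2_holomorphic g2_nonzero)
    show "G (act \<gamma> z) = G z" if "\<gamma> \<in> modular_group N" "z \<in> upper_half_plane" for \<gamma> z
      using inv modular_group_invariance(3)[OF that] that by (simp add: G_def)
    have "((\<lambda>z. ((F z - c) / exp (of_real pi * \<i> * z)) / (g2 N z / exp (of_real pi * \<i> * of_real 1 * z))) \<longlongrightarrow> D / L) at_iinfinity"
      by (rule tendsto_divide[OF cD L(2,1)])
    hence "(G \<longlongrightarrow> D / L) at_iinfinity" by (simp add: G_def)
    thus "Bfun G at_iinfinity" by (rule tendsto_imp_Bfun)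
    let ?E = "\<lambda>r z. exp (of_real pi * \<i> * of_real r * z)"
    \<comment> \<open>This is where beta >= 0 enters: subtracting the constant c must not violate
      the bound at 1.\<close>
    have "norm (c * ?E (2 * \<beta> / width) z) \<le> norm c" if z: "z \<in> upper_half_plane" for z
    proof -
      define r where "r = 2 * \<beta> / width"
      have "r \<ge> 0" unfolding r_def using \<beta> width_pos by (intro divide_nonneg_pos) auto
      moreover have "Im z > 0" using z by (simp add: upper_half_plane_def)
      ultimately have "pi * r * Im z \<ge> 0" by simp
      moreover have "Re (of_real pi * \<i> * of_real r * z) = - (pi * r * Im z)" by simp
      ultimately have "norm (?E r z) \<le> 1"
        unfolding norm_exp_eq_Re by simp
      hence "norm (?E (2 * \<beta> / width) z) \<le> 1" unfolding r_def .
      thus ?thesis unfolding norm_mult by (intro mult_left_le) auto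
    qed
    hence "\<forall>\<^sub>F z in at_iinfinity. norm (c * ?E (2 * \<beta> / width) z) \<le> norm c"
      using eventually_at_iinfinity_upper by (auto elim: eventually_mono)
    hence "Bfun (\<lambda>z. c * ?E (2 * \<beta> / width) z) at_iinfinity" by (rule BfunI)
    from Bfun_mult[OF Bfun_diff[OF b1 this] tendsto_imp_Bfun[OF tendsto_inverse[OF M(2,1)]]]
    have B: "Bfun (\<lambda>z. (F (act cusp1 z) * ?E (2 * \<beta> / width) z - c * ?E (2 * \<beta> / width) z) *
        inverse (g2 N (act cusp1 z) / ?E (- 2 / width) z)) at_iinfinity" .
    have E: "?E (2 * (\<beta> - 1) / width) z = ?E (2 * \<beta> / width) z * ?E (- 2 / width) z" for z
      unfolding exp_add[symmetric]
      by (rule arg_cong[where f = exp]) (simp add: distrib_right[symmetric] distrib_left[symmetric] add_divide_distrib[symmetric] diff_divide_distrib algebra_simps)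
    show "Bfun (\<lambda>z. G (act cusp1 z) * ?E (2 * (\<beta> - 1) / width) z) at_iinfinity"
      using B
    proof (rule Bfun_cong_upper)
      fix z
      have gen: "(f * e - c * e) * inverse (g / e') = (f - c) / g * (e * e')" for f e e' g :: complex
        by (simp add: divide_inverse algebra_simps)
      show "(F (act cusp1 z) * ?E (2 * \<beta> / width) z - c * ?E (2 * \<beta> / width) z) *
        inverse (g2 N (act cusp1 z) / ?E (- 2 / width) z) = G (act cusp1 z) * ?E (2 * (\<beta> - 1) / width) z"
        unfolding E G_def by (rule gen)
    qed
  qed
  moreover have "F z = c + g2 N z * G z" if "z \<in> upper_half_plane" for z
    using g2_nonzero[OF that] by (simp add: G_def)
  ultimately show thesis by (rule that)
qed

text \<open>Each division by \<open>g2\<close> contributes one coefficient and costs one unit of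
  pole order; a bound below n is negative after n divisions, which leaves remainder 0.\<close>

lemma pole_bounded_polynomial:
  "pole_bounded \<beta> F \<Longrightarrow> \<beta> < real n \<Longrightarrow> \<exists>c. \<forall>z\<in>upper_half_plane. F z = (\<Sum>i<n. c i * g2 N z ^ i)"
proof (induction n arbitrary: \<beta> F)
  case 0
  thus ?case using pole_bounded_negative by simp
next
  case (Suc n)
  show ?case
  proof (cases "\<beta> < 0")
    \<comment> \<open>\<open>pole_bounded_step\<close> requires beta >= 0; a negative bound already
      means F = 0.\<close>
    case True
    thus ?thesis using pole_bounded_negative[OF Suc.prems(1)] by (intro exI[of _ "\<lambda>_. 0"]) simp
  next
    case False
    then obtain c0 G where G: "pole_bounded (\<beta> - 1) G" "\<And>z. z \<in> upper_half_plane \<Longrightarrow> F z = c0 + g2 N z * G z"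
      using pole_bounded_step[OF Suc.prems(1)] by (metis not_less)
    have "\<beta> - 1 < real n" using Suc.prems(2) by simp
    then obtain c where c: "\<And>z. z \<in> upper_half_plane \<Longrightarrow> G z = (\<Sum>i<n. c i * g2 N z ^ i)"
      using Suc.IH[OF G(1)] by blast
    have "F z = (\<Sum>i<Suc n. case_nat c0 c i * g2 N z ^ i)" if z: "z \<in> upper_half_plane" for z
      unfolding sum.lessThan_Suc_shift G(2)[OF z] c[OF z] by (simp add: sum_distrib_left mult_ac)
    thus ?thesis by blast
  qed
qed

text \<open>A nonzero polynomial has finitely many roots, but \<open>g2\<close> takes infinitely
  many values: it never vanishes and yet tends to 0 at infinity, so |g2| has no least value.\<close>

lemma g2_polynomial_zero:
  assumes "\<forall>z\<in>upper_half_plane. (\<Sum>i=0..n. d i * g2 N z ^ i) = 0" "i \<le> n"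
  shows "d i = 0"
proof (rule ccontr)
  assume "d i \<noteq> 0"
  hence fin: "finite {z. (\<Sum>i\<le>n. d i * z ^ i) = 0}" using assms(2) by (intro polyfun_rootbound_finite) auto
  have "g2 N ` upper_half_plane \<subseteq> {z. (\<Sum>i\<le>n. d i * z ^ i) = 0}"
    using assms(1) by (auto simp: atLeast0AtMost)
  hence "finite (g2 N ` upper_half_plane)" using fin by (rule finite_subset)
  hence "finite (norm ` g2 N ` upper_half_plane)" by (rule finite_imageI)
  moreover have "norm ` g2 N ` upper_half_plane \<noteq> {}" using ii_in_upper_half_plane by blast
  ultimately obtain m where m: "m \<in> norm ` g2 N ` upper_half_plane" "\<And>x. x \<in> norm ` g2 N ` upper_half_plane \<Longrightarrow> m \<le> x"
    using Min_in Min_le by metis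
  have "m > 0" using m(1) g2_nonzero by auto
  have "\<forall>\<^sub>F z in at_iinfinity. dist (g2 N z) 0 < m"
    by (rule tendstoD[OF leading_tendsto_0[OF leading_g2] \<open>m > 0\<close>]) simp
  with eventually_at_iinfinity_upper have "\<forall>\<^sub>F z in at_iinfinity. False"
  proof eventually_elim
    case (elim z)
    thus ?case using m(2)[of "norm (g2 N z)"] by simp
  qed
  thus False by simp
qed

text \<open>Character and factor of automorphy cancel in the quotient. At infinity \<open>g1\<close>
  has a nonzero limit; at 1 the form is bounded, so the exponent of \<open>g1\<close>^k is the bound
  for the pole.\<close>

lemma modular_form_quotient:
  assumes f: "f \<in> modular_forms (real k * g1_weight N) (modular_group N) (\<lambda>\<gamma>. g1_character N \<gamma> ^ k)"
  shows "pole_bounded (real k * ord_1_g1 N) (\<lambda>z. f z / g1 N z ^ k)"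
  unfolding pole_bounded_def
proof (intro conjI ballI)
  let ?w = "g1_weight N"
  have hol: "f holomorphic_on upper_half_plane"
    and inv: "\<And>\<gamma> z. \<gamma> \<in> modular_group N \<Longrightarrow> z \<in> upper_half_plane \<Longrightarrow>
        f (act \<gamma> z) = g1_character N \<gamma> ^ k * aut_factor (real k * ?w) \<gamma> z * f z"
    and bnd: "\<And>\<sigma>. cusp_at (modular_group N) \<sigma> \<Longrightarrow> Bfun (slash (real k * ?w) f \<sigma>) at_iinfinity"
    using f unfolding modular_forms_def by auto
  note g1nz = g1_nonzero[OF N_pos]
  show "(\<lambda>z. f z / g1 N z ^ k) holomorphic_on upper_half_plane"
    by (intro holomorphic_intros hol g1_holomorphic N_pos) (simp add: g1nz)
  show "f (act \<gamma> z) / g1 N (act \<gamma> z) ^ k = f z / g1 N z ^ k"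
    if \<gamma>: "\<gamma> \<in> modular_group N" and z: "z \<in> upper_half_plane" for \<gamma> z
  proof -
    have d: "det \<gamma> = 1" by (rule modular_group_invariance(1)[OF \<gamma>])
    have e: "g1 N (act \<gamma> z) ^ k = g1_character N \<gamma> ^ k * aut_factor (real k * ?w) \<gamma> z * g1 N z ^ k"
      unfolding g1_character(2)[OF \<gamma> z] using aut_factor_power[OF z, of \<gamma> ?w k] d by (simp add: power_mult_distrib)
    have nz: "g1_character N \<gamma> ^ k * aut_factor (real k * ?w) \<gamma> z \<noteq> 0"
      using g1_character(1)[OF \<gamma>] aut_factor_nonzero[OF z, of \<gamma>] d by simp
    show ?thesis unfolding inv[OF \<gamma> z] e by (rule mult_divide_mult_cancel_left[OF nz])
  qed
  have g1k: "leading (real k * 0) (\<lambda>z. g1 N z ^ k)" by (rule leading_power[OF leading_g1])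
  then obtain L where L: "L \<noteq> 0" "((\<lambda>z. g1 N z ^ k) \<longlongrightarrow> L) at_iinfinity"
    unfolding leading_def by auto
  have "slash (real k * ?w) f (mat 1) = f" by (rule ext) (simp add: slash_def aut_factor_jac)
  hence "Bfun f at_iinfinity" using bnd[OF cusp_at_infinity] by simp
  from Bfun_mult[OF this tendsto_imp_Bfun[OF tendsto_inverse[OF L(2,1)]]]
  show "Bfun (\<lambda>z. f z / g1 N z ^ k) at_iinfinity" by (simp add: divide_inverse)
  obtain M where M: "M \<noteq> 0"
    "((\<lambda>z. slash ?w (g1 N) cusp1 z ^ k / exp (of_real pi * \<i> * of_real (real k * g1_exponent) * z)) \<longlongrightarrow> M) at_iinfinity"
    using leading_power[OF leading_g1_cusp1, of k] unfolding leading_def by blast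
  have ex: "2 * (real k * ord_1_g1 N) / width = real k * g1_exponent"
    unfolding ord_1_g1_eq using width_pos by simp
  have B: "Bfun (\<lambda>z. slash (real k * ?w) f cusp1 z *
      inverse (slash ?w (g1 N) cusp1 z ^ k / exp (of_real pi * \<i> * of_real (real k * g1_exponent) * z))) at_iinfinity"
    by (rule Bfun_mult[OF bnd[OF cusp_at_cusp1] tendsto_imp_Bfun[OF tendsto_inverse[OF M(2,1)]]])
  show "Bfun (\<lambda>z. f (act cusp1 z) / g1 N (act cusp1 z) ^ k *
      exp (of_real pi * \<i> * of_real (2 * (real k * ord_1_g1 N) / width) * z)) at_iinfinity"
    unfolding ex using B
  proof (rule Bfun_cong_upper)
    fix z assume z: "z \<in> upper_half_plane"
    have a: "aut_factor (real k * ?w) cusp1 z = aut_factor ?w cusp1 z ^ k" "aut_factor ?w cusp1 z \<noteq> 0"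
      using aut_factor_power[OF z, of cusp1 ?w k] aut_factor_nonzero[OF z, of cusp1] by simp_all
    show "slash (real k * ?w) f cusp1 z *
      inverse (slash ?w (g1 N) cusp1 z ^ k / exp (of_real pi * \<i> * of_real (real k * g1_exponent) * z)) =
      f (act cusp1 z) / g1 N (act cusp1 z) ^ k * exp (of_real pi * \<i> * of_real (real k * g1_exponent) * z)"
      unfolding slash_def a(1) using a(2) by (simp add: power_divide)
  qed
qed

text \<open>At infinity \<open>g2\<close> tends to 0 and \<open>g1\<close> does not, which isolates
  the constant coefficient. At 1, if n equals k times the order of \<open>g1\<close>, then
  \<open>g1\<close>^k \<open>g2\<close>^n has a nonzero limit and the lower powers of
  \<open>g2\<close> contribute nothing, which isolates the last one.\<close>

lemma cusp_form_coefficients: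
  assumes f: "f \<in> cusp_forms (real k * g1_weight N) (modular_group N) (\<lambda>\<gamma>. g1_character N \<gamma> ^ k)"
    and c: "\<forall>z\<in>upper_half_plane. f z = g1 N z ^ k * (\<Sum>i=0..n. c i * g2 N z ^ i)"
  shows "c 0 = 0" and "real n = real k * ord_1_g1 N \<Longrightarrow> c n = 0"
proof -
  let ?w = "g1_weight N"
  let ?E = "\<lambda>r z. exp (of_real pi * \<i> * of_real r * z)"
  have lim: "\<And>\<sigma>. cusp_at (modular_group N) \<sigma> \<Longrightarrow> (slash (real k * ?w) f \<sigma> \<longlongrightarrow> 0) at_iinfinity"
    using f unfolding cusp_forms_def by auto
  have "slash (real k * ?w) f (mat 1) = f" by (rule ext) (simp add: slash_def aut_factor_jac)
  hence f0: "(f \<longlongrightarrow> 0) at_iinfinity" using lim[OF cusp_at_infinity] by simp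
  have "leading (real k * 0) (\<lambda>z. g1 N z ^ k)" by (rule leading_power[OF leading_g1])
  then obtain L where L: "L \<noteq> 0" "((\<lambda>z. g1 N z ^ k) \<longlongrightarrow> L) at_iinfinity"
    unfolding leading_def by auto
  have g20: "(g2 N \<longlongrightarrow> 0) at_iinfinity" by (rule leading_tendsto_0[OF leading_g2]) simp
  have "((\<lambda>z. g1 N z ^ k * (\<Sum>i=0..n. c i * g2 N z ^ i)) \<longlongrightarrow> L * (\<Sum>i=0..n. c i * 0 ^ i)) at_iinfinity"
    by (intro tendsto_intros L g20)
  moreover have "((\<lambda>z. g1 N z ^ k * (\<Sum>i=0..n. c i * g2 N z ^ i)) \<longlongrightarrow> 0) at_iinfinity"
    using f0 by (rule tendsto_cong_upper) (use c in blast)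
  ultimately have "L * (\<Sum>i=0..n. c i * 0 ^ i) = 0"
    by (rule tendsto_unique[OF at_iinfinity_neq_bot])
  moreover have "(\<Sum>i=0..n. c i * 0 ^ i) = c 0"
    by (simp add: sum.atLeast_Suc_atMost[of 0 n] power_0_left)
  ultimately show "c 0 = 0" using L(1) by simp
  assume n: "real n = real k * ord_1_g1 N"
  obtain M where M: "M \<noteq> 0" "((\<lambda>z. slash ?w (g1 N) cusp1 z ^ k / ?E (real k * g1_exponent) z) \<longlongrightarrow> M) at_iinfinity"
    using leading_power[OF leading_g1_cusp1, of k] unfolding leading_def by blast
  obtain P where P: "P \<noteq> 0" "((\<lambda>z. g2 N (act cusp1 z) / ?E (- 2 / width) z) \<longlongrightarrow> P) at_iinfinity"
    using leading_g2_cusp1 unfolding leading_def by blast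
  have e0: "(?E (2 / width) \<longlongrightarrow> 0) at_iinfinity"
    using width_pos by (intro exp_tendsto_0_at_iinfinity) simp
  have Em: "?E (- 2 / width) z * ?E (2 / width) z = 1" for z
    unfolding exp_add[symmetric] by (simp add: distrib_right[symmetric])
  have kn: "real k * g1_exponent = real n * (2 / width)"
    unfolding n ord_1_g1_eq using width_pos by simp
  have En: "?E (real k * g1_exponent) z = ?E (2 / width) z ^ n" for z
    unfolding kn exp_of_nat_mult[symmetric] by (rule arg_cong[where f = exp]) (simp add: mult_ac)
  \<comment> \<open>The slashed form with \<open>g1\<close> and \<open>g2\<close> normalised to have
    nonzero limits. The n exponentials split off from \<open>g1\<close>^k are partly used up by
    \<open>g2\<close>^i; the remaining n - i tend to 0 unless i = n.\<close>
  let ?s = "\<lambda>z. (slash ?w (g1 N) cusp1 z ^ k / ?E (real k * g1_exponent) z) *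
      (\<Sum>i=0..n. c i * (g2 N (act cusp1 z) / ?E (- 2 / width) z) ^ i * ?E (2 / width) z ^ (n - i))"
  have "(?s \<longlongrightarrow> M * (\<Sum>i=0..n. c i * P ^ i * 0 ^ (n - i))) at_iinfinity"
    by (intro tendsto_intros M P e0)
  moreover have "(?s \<longlongrightarrow> 0) at_iinfinity"
    using lim[OF cusp_at_cusp1]
  proof (rule tendsto_cong_upper)
    fix z assume z: "z \<in> upper_half_plane"
    have a: "aut_factor (real k * ?w) cusp1 z = aut_factor ?w cusp1 z ^ k"
      using aut_factor_power[OF z, of cusp1 ?w k] by simp
    have zH: "act cusp1 z \<in> upper_half_plane" by (rule act_in_upper[OF z]) simp
    have t: "c i * (g2 N (act cusp1 z) / ?E (- 2 / width) z) ^ i * ?E (2 / width) z ^ (n - i) =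
        c i * g2 N (act cusp1 z) ^ i * ?E (2 / width) z ^ n" if "i \<in> {0..n}" for i
    proof -
      have "g2 N (act cusp1 z) / ?E (- 2 / width) z = g2 N (act cusp1 z) * ?E (2 / width) z"
        using inverse_unique[OF Em[of z]] by (metis divide_inverse)
      hence "(g2 N (act cusp1 z) / ?E (- 2 / width) z) ^ i * ?E (2 / width) z ^ (n - i) =
          g2 N (act cusp1 z) ^ i * (?E (2 / width) z ^ i * ?E (2 / width) z ^ (n - i))"
        by (simp only: power_mult_distrib mult.assoc)
      also have "?E (2 / width) z ^ i * ?E (2 / width) z ^ (n - i) = ?E (2 / width) z ^ n"
        using that by (simp only: power_add[symmetric]) simp
      finally show ?thesis by (simp only: mult.assoc)
    qed
    have "?s z = slash ?w (g1 N) cusp1 z ^ k / ?E (2 / width) z ^ n * ((\<Sum>i=0..n. c i * g2 N (act cusp1 z) ^ i) * ?E (2 / width) z ^ n)"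
      unfolding En sum_distrib_right using t by (simp only: cong: sum.cong)
    also have "\<dots> = slash ?w (g1 N) cusp1 z ^ k * (\<Sum>i=0..n. c i * g2 N (act cusp1 z) ^ i)"
      by simp
    also have "\<dots> = slash (real k * ?w) f cusp1 z"
      using c zH unfolding slash_def a by (simp add: power_divide)
    finally show "slash (real k * ?w) f cusp1 z = ?s z" by simp
  qed
  ultimately have "M * (\<Sum>i=0..n. c i * P ^ i * 0 ^ (n - i)) = 0"
    by (rule tendsto_unique[OF at_iinfinity_neq_bot])
  moreover have "(\<Sum>i=0..n. c i * P ^ i * 0 ^ (n - i)) = c n * P ^ n"
  proof -
    have "(\<Sum>i=0..n. c i * P ^ i * 0 ^ (n - i)) = (\<Sum>i=0..n. if i = n then c n * P ^ n else 0)"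
      by (intro sum.cong refl) (auto simp: power_0_left)
    thus ?thesis by simp
  qed
  ultimately show "c n = 0" using M(1) P(1) by simp
qed

end

section \<open>The ten levels and the conclusion\<close>

section \<open>The levels with \<open>\<sigma>(N)\<close> dividing 24\<close>

text \<open>For squarefree N the denominator of \<open>D_const\<close> is sigma(N), so s = 24 /
  sigma(N). Apart from 1 the levels are primes or products of two distinct primes.\<close>

lemma square_free_level_exists:
  assumes "N \<in> {1, 2, 3, 5, 6, 7, 11, 14, 15, 23}"
  shows "\<exists>s. square_free_level N s"
proof -
  have gen: "square_free_level N s"
    if "N > 0" "squarefree N" "(\<Prod>p\<in>prime_factors N. real p + 1) = real \<sigma>" "\<Sum>(divisors N) = \<sigma>" "s * \<sigma> = 24"
      "3 dvd \<sigma> \<Longrightarrow> \<exists>p. prime p \<and> p mod 3 = 2 \<and> p dvd N" for N s \<sigma> :: nat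
  proof
    have "card (divisors N) > 0"
      using finite_divisors[OF that(1)] by (auto simp: card_gt_0_iff divisors_def)
    moreover have "real s * real \<sigma> = 24" using that(5) by (metis of_nat_mult of_nat_numeral)
    moreover have "\<sigma> > 0" using that(5) by (auto intro: Nat.gr0I)
    ultimately show "s_const N = real s"
      unfolding s_const_def D_const_def C_dim_def that(3) by (simp add: field_simps)
  qed (use that in auto)
  have pr: "square_free_level p s"
    if "prime p" "s * Suc p = 24" "3 dvd Suc p \<Longrightarrow> p mod 3 = 2" for p s :: nat
  proof (rule gen[of p "Suc p"])
    show "p > 0" using that(1) by (rule prime_gt_0_nat)
    show "squarefree p" using that(1) by (rule squarefree_prime)
    show "(\<Prod>q\<in>prime_factors p. real q + 1) = real (Suc p)" using that(1) by (simp add: prime_prime_factors)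
    have "divisors p = {1, p}" using that(1) by (auto simp: divisors_def prime_nat_iff)
    thus "\<Sum>(divisors p) = Suc p" using prime_gt_1_nat[OF that(1)] by simp
    show "s * Suc p = 24" by (rule that(2))
    show "\<exists>q. prime q \<and> q mod 3 = 2 \<and> q dvd p" if "3 dvd Suc p"
      using \<open>prime p\<close> \<open>3 dvd Suc p \<Longrightarrow> p mod 3 = 2\<close> that by (intro exI[of _ p]) simp
  qed
  \<comment> \<open>The prime congruent to 2 modulo 3 comes first, hence 15 is entered as 5 *
    3.\<close>
  have pq: "square_free_level (p * q) s"
    if p: "prime p" "prime q" "p \<noteq> q" and s: "s * (Suc p * Suc q) = 24" and m: "p mod 3 = 2" for p q s :: nat
  proof (rule gen[of "p * q" "Suc p * Suc q"])
    have cop: "coprime p q" using p by (simp add: primes_coprime)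
    show "p * q > 0" using p by (simp add: prime_gt_0_nat)
    show "squarefree (p * q)" using p cop by (intro squarefree_mult_coprime squarefree_prime)
    have "prime_factors (p * q) = {p, q}"
      using p by (subst prime_factors_product) (auto simp: prime_prime_factors prime_gt_0_nat)
    thus "(\<Prod>r\<in>prime_factors (p * q). real r + 1) = real (Suc p * Suc q)" using p(3) by (simp add: algebra_simps)
    have g1: "p > 1" "q > 1" by (rule prime_gt_1_nat[OF p(1)], rule prime_gt_1_nat[OF p(2)])
    have "divisors (p * q) = {1, p, q, p * q}"
    proof -
      have "d = 1 \<or> d = p \<or> d = q \<or> d = p * q" if h: "d dvd p * q" for d
      proof -
        obtain x y where "d = x * y" "x dvd p" "y dvd q" using division_decomp[OF h] by blast
        moreover have "x = 1 \<or> x = p" "y = 1 \<or> y = q"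
          using p(1,2) calculation by (auto simp only: prime_nat_iff)
        ultimately show ?thesis by auto
      qed
      thus ?thesis by (auto simp: divisors_def)
    qed
    moreover have "p \<noteq> p * q" "q \<noteq> p * q" "1 \<noteq> p * q" using g1 by auto
    ultimately show "\<Sum>(divisors (p * q)) = Suc p * Suc q" using g1 p(3) by (simp add: algebra_simps)
    show "s * (Suc p * Suc q) = 24" by (rule s)
    show "\<exists>r. prime r \<and> r mod 3 = 2 \<and> r dvd p * q" using p m by (intro exI[of _ p]) simp
  qed
  have "square_free_level 1 24"
    by (rule gen[of 1 1]) (simp_all add: divisors_def)
  moreover have "square_free_level 2 8" "square_free_level 3 6" "square_free_level 5 4" "square_free_level 7 3"
      "square_free_level 11 2" "square_free_level 23 1"
    by (rule pr; simp)+
  moreover have "square_free_level 6 2" using pq[of 2 3 2] by simp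
  moreover have "square_free_level 14 1" using pq[of 2 7 1] by simp
  moreover have "square_free_level 15 1" using pq[of 5 3 1] by simp
  ultimately show ?thesis using assms by auto
qed

theorem theorem9:
  fixes N k n :: nat and f :: "complex \<Rightarrow> complex"
  assumes "N \<in> {1, 2, 3, 5, 6, 7, 11, 14, 15, 23}"
    and n: "n = nat \<lfloor>real k * ord_1_g1 N\<rfloor>"
    and "f \<in> modular_forms (real k * g1_weight N) (modular_group N) (\<lambda>\<gamma>. g1_character N \<gamma> ^ k)"
  shows "(\<exists>!c :: nat \<Rightarrow> complex. c \<in> {0..n} \<rightarrow>\<^sub>E UNIV \<and>
            (\<forall>z\<in>upper_half_plane. f z = g1 N z ^ k * (\<Sum>i=0..n. c i * g2 N z ^ i))) \<and>
         (f \<in> cusp_forms (real k * g1_weight N) (modular_group N) (\<lambda>\<gamma>. g1_character N \<gamma> ^ k) \<longrightarrow>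
            (\<forall>c :: nat \<Rightarrow> complex.
               (\<forall>z\<in>upper_half_plane. f z = g1 N z ^ k * (\<Sum>i=0..n. c i * g2 N z ^ i)) \<longrightarrow>
               c 0 = 0 \<and> (real k * ord_1_g1 N \<in> \<int> \<longrightarrow> c n = 0)))"
proof -
  obtain s where "square_free_level N s" using square_free_level_exists[OF assms(1)] by blast
  then interpret square_free_level N s .
  define \<beta> where "\<beta> = real k * ord_1_g1 N"
  have \<beta>: "\<beta> \<ge> 0"
    unfolding \<beta>_def ord_1_g1_eq using g1_exponent_nonneg width_pos by simp
  have "\<beta> < real (Suc n)" using \<beta> n unfolding \<beta>_def[symmetric] by linarith
  then obtain c where c: "\<And>z. z \<in> upper_half_plane \<Longrightarrow> f z / g1 N z ^ k = (\<Sum>i<Suc n. c i * g2 N z ^ i)"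
    using pole_bounded_polynomial[OF modular_form_quotient[OF assms(3)]] unfolding \<beta>_def by blast
  have set_eq: "{..<Suc n} = {0..n}" by auto
  have nz: "g1 N z ^ k \<noteq> 0" if "z \<in> upper_half_plane" for z using g1_nonzero[OF N_pos that] by simp
  \<comment> \<open>Uniqueness refers to extensional coefficient families, so the values of c beyond
    n are made undefined.\<close>
  have ex: "f z = g1 N z ^ k * (\<Sum>i=0..n. restrict c {0..n} i * g2 N z ^ i)" if z: "z \<in> upper_half_plane" for z
  proof -
    have "f z = g1 N z ^ k * (\<Sum>i=0..n. c i * g2 N z ^ i)"
      using c[OF z] nz[OF z] unfolding set_eq by (simp add: divide_eq_eq mult.commute)
    thus ?thesis by simp
  qed
  have uniq: "c' = c''" if c': "c' \<in> {0..n} \<rightarrow>\<^sub>E UNIV" "\<forall>z\<in>upper_half_plane. f z = g1 N z ^ k * (\<Sum>i=0..n. c' i * g2 N z ^ i)"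
    and c'': "c'' \<in> {0..n} \<rightarrow>\<^sub>E UNIV" "\<forall>z\<in>upper_half_plane. f z = g1 N z ^ k * (\<Sum>i=0..n. c'' i * g2 N z ^ i)"
    for c' c'' :: "nat \<Rightarrow> complex"
  proof (rule PiE_ext[OF c'(1) c''(1)])
    have "(\<Sum>i=0..n. (c' i - c'' i) * g2 N z ^ i) = 0" if z: "z \<in> upper_half_plane" for z
    proof -
      have "g1 N z ^ k * (\<Sum>i=0..n. c' i * g2 N z ^ i) = g1 N z ^ k * (\<Sum>i=0..n. c'' i * g2 N z ^ i)"
        using c'(2) c''(2) z by metis
      hence "(\<Sum>i=0..n. c' i * g2 N z ^ i) = (\<Sum>i=0..n. c'' i * g2 N z ^ i)"
        using nz[OF z] by (metis mult_cancel_left)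
      thus ?thesis by (simp only: left_diff_distrib sum_subtractf) simp
    qed
    thus "c' i = c'' i" if "i \<in> {0..n}" for i
      using g2_polynomial_zero[of "\<lambda>i. c' i - c'' i" n i] that by simp
  qed
  have "\<exists>!c :: nat \<Rightarrow> complex. c \<in> {0..n} \<rightarrow>\<^sub>E UNIV \<and>
            (\<forall>z\<in>upper_half_plane. f z = g1 N z ^ k * (\<Sum>i=0..n. c i * g2 N z ^ i))"
  proof (rule ex1I)
    show "restrict c {0..n} \<in> {0..n} \<rightarrow>\<^sub>E UNIV \<and>
      (\<forall>z\<in>upper_half_plane. f z = g1 N z ^ k * (\<Sum>i=0..n. restrict c {0..n} i * g2 N z ^ i))"
      using ex by (intro conjI ballI) (auto intro!: restrict_PiE_iff[THEN iffD2])
  qed (use uniq ex in \<open>auto intro!: uniq\<close>)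
  moreover have "c 0 = 0 \<and> (real k * ord_1_g1 N \<in> \<int> \<longrightarrow> c n = 0)"
    if cusp: "f \<in> cusp_forms (real k * g1_weight N) (modular_group N) (\<lambda>\<gamma>. g1_character N \<gamma> ^ k)"
      and c: "\<forall>z\<in>upper_half_plane. f z = g1 N z ^ k * (\<Sum>i=0..n. c i * g2 N z ^ i)" for c :: "nat \<Rightarrow> complex"
  proof (intro conjI impI)
    show "c 0 = 0" by (rule cusp_form_coefficients(1)[OF cusp c])
    assume "real k * ord_1_g1 N \<in> \<int>"
    \<comment> \<open>Integrality makes the floor exact, so n is the order itself and the highest
      coefficient is the one that is seen at the cusp 1.\<close>
    hence "real n = real k * ord_1_g1 N"
      using n \<beta> unfolding \<beta>_def by (auto elim!: Ints_cases)
    thus "c n = 0" by (rule cusp_form_coefficients(2)[OF cusp c])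
  qed
  ultimately show ?thesis by blast
qed

end
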